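(* Let $N\ge 2$, let $\Omega\subset\mathbb{R}^N$ be a bounded radial domain and $m\in\mathbb{N}$. Assume that $f_i\in C^1([0,\infty)\times\mathbb{R}^m)$, $(r,u_1,\ldots,u_m)\mapsto f_i(r,u_1,\ldots,u_m)\in\mathbb{R}$, $i=1,\ldots,m$, satisfy $$\frac{\partial}{\partial u_i} f_j>0\quad\text{on }[0,\infty)\times\mathbb{R}^m,\quad i,j\in\{1,\ldots,m\},\ i\neq j.$$ Let $u_1,\ldots,u_m:\mathbb{R}^N\to\mathbb{R}$ be continuous bounded functions satisfying in weak sense $$Iu_i=f_i(|x|,u_1,\ldots,u_m)\ \text{ in }\Omega,\ i=1,\ldots,m,\qquad u_1=\ldots=u_m=0\ \text{ in }\mathbb{R}^N\setminus\Omega.$$ If $$u_i(x_1,x')\ge u_i(-x_1,x')\quad\text{for all }x_1>0,\ x'\in\mathbb{R}^{N-1},\ i=1,\ldots,m,$$ and there are $x_1>0$, $x'\in\mathbb{R}^{N-1}$ with $u_1(x_1,x')>u_1(-x_1,x')$, then there is $p\in S^{N-1}$ such that $u_1,\ldots,u_m$ are foliated Schwarz symmetric in $\Omega$ with respect to $p$ and strictly decreasing in the polar angle.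
   Context: $S^{N-1}=\{x\in\mathbb{R}^N:|x|=1\}$. A radial domain is an open connected set invariant under all rotations about the origin. Kernel and operator: $k:\mathbb{R}^N\to[0,\infty]$, $k(z)=k_0(|z|)$, where $k_0:[0,\infty)\to[0,\infty]$ is monotone decreasing (nonincreasing) with $\int_0^\infty\min\{1,r^2\}k_0(r)r^{N-1}\,dr<\infty$ and $\int_0^\infty k_0(r)r^{N-1}\,dr=\infty$. The operator $I$ is given, for $u\in C^2(\mathbb{R}^N)\cap L^\infty(\mathbb{R}^N)$, by $Iu(x)=\lim_{\epsilon\to0^+}\int_{\mathbb{R}^N\setminus B_\epsilon(x)}(u(x)-u(y))k(x-y)\,dy$. Set $\mathcal{E}_k(u,v)=\frac12\int_{\mathbb{R}^N}\int_{\mathbb{R}^N}(u(x)-u(y))(v(x)-v(y))k(x-y)\,dx\,dy$ and, for $\Omega$ open, $\mathcal{D}_k(\Omega)=\{u\in L^2(\mathbb{R}^N): u=0 \text{ on }\mathbb{R}^N\setminus\Omega,\ \mathcal{E}_k(u,u)<\infty\}$. The functions $u_1,\dots,u_m$ satisfy the system in weak sense if $u_i\in\mathcal{D}_k(\Omega)$ and $\mathcal{E}_k(u_i,\phi)=\int_\Omega f_i(|x|,u_1(x),\ldots,u_m(x))\phi(x)\,dx$ for all $\phi\in\mathcal{D}_k(\Omega)$, $i=1,\ldots,m$. A function $u$ is foliated Schwarz symmetric with respect to $p\in S^{N-1}$ in $\Omega$ if for every $r>0$ with $rS^{N-1}\subset\Omega$ and every $c\in\mathbb{R}$, the set $\{x\in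 rS^{N-1}:u(x)\ge c\}$ is equal to $rS^{N-1}$ or to a geodesic ball in $rS^{N-1}$ centered at $rp$ (the empty set and $\{rp\}$ count as degenerate geodesic balls). Equivalently (for continuous $u$), in $\Omega$ the function $u$ depends only on $|x|$ and the polar angle $\theta=\arccos(\frac{x}{|x|}\cdot p)$ and is nonincreasing in $\theta$. It is strictly decreasing in the polar angle if $u(x)>u(y)$ whenever $x,y\in rS^{N-1}\subset\Omega$, $r>0$, and $x\cdot p>y\cdot p$. *)

theory Defs
  imports "HOL-Analysis.Analysis"
begin

definition radial_domain :: "(real^'n) set \<Rightarrow> bool" where
  "radial_domain \<Omega> \<longleftrightarrow> open \<Omega> \<and> connected \<Omega> \<and>
     (\<forall>Q. rotation_matrix Q \<longrightarrow> (\<lambda>x. Q *v x) ` \<Omega> = \<Omega>)"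

text \<open>Meant for sets \<open>S\<close> such as \<open>{0..} \<times> UNIV\<close> on which derivatives within \<open>S\<close> are unique; they are
  one-sided at boundary points.\<close>

definition C1_on :: "'a::real_normed_vector set \<Rightarrow> ('a \<Rightarrow> real) \<Rightarrow> bool" where
  "C1_on S g \<longleftrightarrow> (\<exists>g' :: 'a \<Rightarrow> 'a \<Rightarrow>\<^sub>L real.
     (\<forall>x\<in>S. (g has_derivative blinfun_apply (g' x)) (at x within S)) \<and> continuous_on S g')"

definition partial_deriv :: "'m \<Rightarrow> (real^'m \<Rightarrow> real) \<Rightarrow> real^'m \<Rightarrow> real" where
  "partial_deriv i g v = deriv (\<lambda>s. g (v + s *\<^sub>R axis i 1)) 0"

text \<open>Conditions on the radial profile of the kernel; its values on the negative half-line are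
  irrelevant.\<close>

definition kernel_profile :: "nat \<Rightarrow> (real \<Rightarrow> ennreal) \<Rightarrow> bool" where
  "kernel_profile N k0 \<longleftrightarrow>
     antimono_on {0..} k0 \<and>
     (\<integral>\<^sup>+r\<in>{0<..}. ennreal (min 1 (r\<^sup>2)) * k0 r * ennreal (r ^ (N - 1)) \<partial>lborel) < \<infinity> \<and>
     (\<integral>\<^sup>+r\<in>{0<..}. k0 r * ennreal (r ^ (N - 1)) \<partial>lborel) = \<infinity>"

text \<open>The quadratic form \<open>\<E>\<^sub>k(u,u)\<close>, with values in the extended half-line.\<close>

definition energy :: "(real^'n \<Rightarrow> ennreal) \<Rightarrow> (real^'n \<Rightarrow> real) \<Rightarrow> ennreal" where
  "energy k u =
     (\<integral>\<^sup>+y. \<integral>\<^sup>+x. ennreal ((u x - u y) * (u x - u y)) * k (x - y) \<partial>lborel \<partial>lborel) / 2"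

text \<open>The bilinear form \<open>\<E>\<^sub>k(u,v)\<close>, for \<open>u\<close> and \<open>v\<close> of finite energy. A kernel as above is finite
  except possibly at the origin, and there the differences of \<open>u\<close> and \<open>v\<close> vanish, so
  replacing the value \<open>\<infinity>\<close> by \<open>0\<close> does not affect the integral.\<close>

definition energy_form ::
    "(real^'n \<Rightarrow> ennreal) \<Rightarrow> (real^'n \<Rightarrow> real) \<Rightarrow> (real^'n \<Rightarrow> real) \<Rightarrow> real" where
  "energy_form k u v =
     1/2 * (LINT y|lborel. LINT x|lborel. (u x - u y) * (v x - v y) * enn2real (k (x - y)))"

text \<open>On the diagonal the two forms agree.\<close>

lemma energy_form_self:
  fixes k :: "real^'n \<Rightarrow> ennreal"
  assumes [measurable]: "u \<in> borel_measurable borel" "k \<in> borel_measurable borel"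
    and fin: "\<And>z. z \<noteq> 0 \<Longrightarrow> k z < \<infinity>" and E: "energy k u < \<infinity>"
  shows "energy_form k u u = enn2real (energy k u)"
proof -
  define F where
    "F y = (\<integral>\<^sup>+x. ennreal ((u x - u y) * (u x - u y)) * k (x - y) \<partial>lborel)" for y
  have [measurable]: "F \<in> borel_measurable borel"
    unfolding F_def by measurable
  have pointwise: "ennreal ((u x - u y) * (u x - u y) * enn2real (k (x - y))) =
      ennreal ((u x - u y) * (u x - u y)) * k (x - y)" for x y
    using fin[of "x - y"] by (cases "x = y") (auto simp: ennreal_mult less_top)
  have inner: "(LINT x|lborel. (u x - u y) * (u x - u y) * enn2real (k (x - y))) =
      enn2real (F y)" for y
    by (subst integral_eq_nn_integral) (auto simp: pointwise F_def)
  have total: "(\<integral>\<^sup>+y. F y \<partial>lborel) \<noteq> \<infinity>"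
    using E by (auto simp: energy_def F_def ennreal_top_divide)
  have "AE y in lborel. F y \<noteq> \<infinity>"
    by (rule nn_integral_PInf_AE) (use total in auto)
  then have "(\<integral>\<^sup>+y. ennreal (enn2real (F y)) \<partial>lborel) = (\<integral>\<^sup>+y. F y \<partial>lborel)"
    by (intro nn_integral_cong_AE) (auto simp: less_top)
  then have "(LINT y|lborel. enn2real (F y)) = enn2real (\<integral>\<^sup>+y. F y \<partial>lborel)"
    by (subst integral_eq_nn_integral) auto
  moreover have "enn2real (c / 2) = enn2real c / 2" for c :: ennreal
    by (cases c) (auto simp: ennreal_top_divide ennreal_divide_numeral)
  ultimately show ?thesis
    by (simp add: energy_form_def energy_def inner F_def)
qed

text \<open>As for any \<open>L\<^sup>2\<close> space, elements are considered up to null sets (every class has a Borel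
  representative), and vanishing outside \<open>\<Omega>\<close> is understood almost everywhere.\<close>

definition energy_space :: "(real^'n \<Rightarrow> ennreal) \<Rightarrow> (real^'n) set \<Rightarrow> (real^'n \<Rightarrow> real) set" where
  "energy_space k \<Omega> = {u. u \<in> borel_measurable borel \<and> integrable lborel (\<lambda>x. (u x)\<^sup>2) \<and>
     (AE x in lborel. x \<notin> \<Omega> \<longrightarrow> u x = 0) \<and> energy k u < \<infinity>}"

definition weak_solution ::
    "(real^'n \<Rightarrow> ennreal) \<Rightarrow> (real^'n) set \<Rightarrow> ('m \<Rightarrow> real \<Rightarrow> real^'m \<Rightarrow> real) \<Rightarrow>
     ('m \<Rightarrow> real^'n \<Rightarrow> real) \<Rightarrow> bool" where
  "weak_solution k \<Omega> f u \<longleftrightarrow>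
     (\<forall>i. u i \<in> energy_space k \<Omega> \<and>
       (\<forall>\<phi>\<in>energy_space k \<Omega>.
         energy_form k (u i) \<phi> = (LINT x:\<Omega>|lborel. f i (norm x) (\<chi> j. u j x) * \<phi> x)))"

definition reflect :: "'n \<Rightarrow> real^'n \<Rightarrow> real^'n" where
  "reflect a x = (\<chi> b. if b = a then - x $ b else x $ b)"

text \<open>Geodesic distance between \<open>x\<close> and \<open>r p\<close> on the sphere of radius \<open>r > 0\<close>, where \<open>p\<close> is a unit
  vector.\<close>

definition geodesic_dist :: "real \<Rightarrow> real^'n \<Rightarrow> real^'n \<Rightarrow> real" where
  "geodesic_dist r p x = r * arccos ((x \<bullet> p) / r)"

text \<open>Open and closed geodesic balls around \<open>r p\<close>. Radius \<open>0\<close> yields the degenerate balls: the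
  empty set and the singleton of \<open>r p\<close>.\<close>

definition geodesic_ball :: "real \<Rightarrow> real^'n \<Rightarrow> (real^'n) set \<Rightarrow> bool" where
  "geodesic_ball r p A \<longleftrightarrow>
     (\<exists>\<rho>\<ge>0. A = {x \<in> sphere 0 r. geodesic_dist r p x < \<rho>} \<or>
             A = {x \<in> sphere 0 r. geodesic_dist r p x \<le> \<rho>})"

definition foliated_Schwarz_symmetric ::
    "real^'n \<Rightarrow> (real^'n) set \<Rightarrow> (real^'n \<Rightarrow> real) \<Rightarrow> bool" where
  "foliated_Schwarz_symmetric p \<Omega> u \<longleftrightarrow>
     (\<forall>r>0. sphere 0 r \<subseteq> \<Omega> \<longrightarrow>
       (\<forall>c. {x \<in> sphere 0 r. u x \<ge> c} = sphere 0 r \<or>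
            geodesic_ball r p {x \<in> sphere 0 r. u x \<ge> c}))"

definition strictly_decreasing_polar_angle ::
    "real^'n \<Rightarrow> (real^'n) set \<Rightarrow> (real^'n \<Rightarrow> real) \<Rightarrow> bool" where
  "strictly_decreasing_polar_angle p \<Omega> u \<longleftrightarrow>
     (\<forall>r>0. sphere 0 r \<subseteq> \<Omega> \<longrightarrow>
       (\<forall>x\<in>sphere 0 r. \<forall>y\<in>sphere 0 r. x \<bullet> p > y \<bullet> p \<longrightarrow> u x > u y))"

end

theory Submission
  imports Defs
begin

text \<open>
  For a direction \<open>z \<noteq> 0\<close> compare \<open>u\<^sub>i\<close> with its reflection in the hyperplane orthogonal to \<open>z\<close>. The
  difference \<open>w\<^sub>i\<close> is antisymmetric and solves a cooperative problem of the same kind; call \<open>z\<close> dominating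
  if all \<open>w\<^sub>i\<close> are positive in the part of \<open>\<Omega>\<close> on the side of \<open>z\<close>. If the \<open>w\<^sub>i\<close> are merely nonnegative
  there, a strong maximum principle shows that \<open>z\<close> is dominating or all \<open>w\<^sub>i\<close> vanish: at an interior
  zero of \<open>w\<^sub>i\<close> one tests with \<open>(t \<eta> - \<bar>w\<^sub>i\<bar>)\<^sup>+\<close> for a small bump \<open>t \<eta>\<close>. A maximum principle on sets of small
  measure, based on the non-integrability of the kernel, shows that the set of dominating directions is
  open. Let \<open>q\<close> maximise one component on a sphere contained in \<open>\<Omega>\<close>. Every dominating \<open>z\<close> satisfies
  \<open>z \<bullet> q > 0\<close>, and a direction in the boundary of the dominating set with \<open>z \<bullet> q > 0\<close> would make \<open>u\<close>
  symmetric, so that the reflection of \<open>q\<close> would be a maximiser on the wrong side. Hence the dominating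
  directions are exactly the half-space \<open>z \<bullet> q > 0\<close>, and two points \<open>x, y\<close> of a sphere are compared by
  reflecting in the direction \<open>x - y\<close>.
\<close>

subsection \<open>Isometries and reflections\<close>

text \<open>The \<open>u i\<close> are only continuous, so the operator cannot be applied to them
  pointwise; all comparisons are made in the weak form, on integrals over pairs of points. The sign
  comes from one fact: two points on the same side of a hyperplane are at most as far apart as one
  is from the mirror image of the other, so the kernel prefers same-side pairs. Summing an integrand
  over the four reflected pairs exposes the difference of the two kernel values. This difference may
  vanish for distant points, since the kernel may have bounded support; only near the origin does
  the singularity make it large. Hence positivity of a difference helps only close to a zero, the
  strong maximum principle is local, and connectedness of one half of \<Omega> has to spread its
  conclusion. The system is not linearised: strict cooperation transfers vanishing from one
  component to the others, and a one-sided Lipschitz bound by negative parts serves the maximum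
  principle on small sets. The non-integrable singularity enters twice, through the strict kernel
  difference and through a Poincare inequality whose constant grows as the support shrinks.\<close>

lemma nn_integral_lborel_plus:
  fixes g :: "'a::euclidean_space \<Rightarrow> ennreal"
  assumes [measurable]: "g \<in> borel_measurable borel"
  shows "(\<integral>\<^sup>+x. g (c + x) \<partial>lborel) = (\<integral>\<^sup>+x. g x \<partial>lborel)"
  by (subst (2) lborel_distr_plus[of c, symmetric]) (simp add: nn_integral_distr)

lemma nn_integral_lborel_diff:
  fixes g :: "'a::euclidean_space \<Rightarrow> ennreal"
  assumes [measurable]: "g \<in> borel_measurable borel"
  shows "(\<integral>\<^sup>+x. g (c - x) \<partial>lborel) = (\<integral>\<^sup>+x. g x \<partial>lborel)"
  by (subst (2) lborel_affine[of "-1" c]) (simp_all add: nn_integral_distr density_1)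

text \<open>A translation-invariant measure is determined up to a factor, by exchanging the order of
  integration; the factor is found by testing with the unit ball.\<close>

lemma nn_integral_isometry:
  fixes f :: "'a::euclidean_space \<Rightarrow> 'a" and g :: "'a \<Rightarrow> ennreal"
  assumes lin: "linear f" and nrm: "\<And>x. norm (f x) = norm x"
    and [measurable]: "g \<in> borel_measurable borel"
  shows "(\<integral>\<^sup>+x. g (f x) \<partial>lborel) = (\<integral>\<^sup>+x. g x \<partial>lborel)"
proof -
  have inj: "inj f"
    using lin nrm by (metis linear_injective_0 norm_eq_zero)
  then have surj: "surj f"
    using lin linear_injective_imp_surjective by blast
  define f' where "f' = inv f"
  have ff': "f (f' x) = x" for x
    using surj by (simp add: f'_def surj_f_inv_f)
  have cf[measurable]: "f \<in> borel_measurable borel"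
    using lin by (intro borel_measurable_continuous_onI linear_continuous_on linear_conv_bounded_linear[THEN iffD1])
  define h :: "'a \<Rightarrow> ennreal" where "h = indicator (ball 0 1)"
  have [measurable]: "h \<in> borel_measurable borel"
    unfolding h_def by (intro borel_measurable_indicator) simp
  have hf: "h (f x) = h x" for x
    by (simp add: h_def indicator_def nrm)
  have fd: "f (x - y) = f x - f y" for x y
    using lin by (simp add: linear_diff)
  have fa: "f (x + y) = f x + f y" for x y
    using lin by (simp add: linear_add)
  have "(\<integral>\<^sup>+x. g x \<partial>lborel) * (\<integral>\<^sup>+y. h y \<partial>lborel) = (\<integral>\<^sup>+y. h y * (\<integral>\<^sup>+x. g x \<partial>lborel) \<partial>lborel)"
    by (simp add: nn_integral_multc mult.commute)
  also have "\<dots> = (\<integral>\<^sup>+y. h y * (\<integral>\<^sup>+x. g (f y + x) \<partial>lborel) \<partial>lborel)"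
    by (simp add: nn_integral_lborel_plus)
  also have "\<dots> = (\<integral>\<^sup>+y. \<integral>\<^sup>+x. h (f y) * g (f y + x) \<partial>lborel \<partial>lborel)"
    by (simp add: nn_integral_cmult hf)
  also have "\<dots> = (\<integral>\<^sup>+x. \<integral>\<^sup>+y. h (f y) * g (f y + x) \<partial>lborel \<partial>lborel)"
    by (rule lborel_pair.Fubini') simp
  \<comment> \<open>The shift by \<open>- f' x\<close> cancels \<open>x\<close> in the argument of
    \<open>g\<close>, so that \<open>x\<close> survives only in \<open>h\<close>.\<close>
  also have "\<dots> = (\<integral>\<^sup>+x. \<integral>\<^sup>+y. h (f (- f' x + y)) * g (f (- f' x + y) + x) \<partial>lborel \<partial>lborel)"
    by (intro nn_integral_cong nn_integral_lborel_plus[symmetric]) measurable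
  also have "\<dots> = (\<integral>\<^sup>+x. \<integral>\<^sup>+y. h (f y - x) * g (f y) \<partial>lborel \<partial>lborel)"
    by (simp add: fd ff')
  also have "\<dots> = (\<integral>\<^sup>+y. \<integral>\<^sup>+x. h (f y - x) * g (f y) \<partial>lborel \<partial>lborel)"
    by (rule lborel_pair.Fubini') simp
  also have "\<dots> = (\<integral>\<^sup>+y. (\<integral>\<^sup>+x. h (f y - x) \<partial>lborel) * g (f y) \<partial>lborel)"
    by (simp add: nn_integral_multc)
  also have "\<dots> = (\<integral>\<^sup>+y. h y \<partial>lborel) * (\<integral>\<^sup>+y. g (f y) \<partial>lborel)"
    by (simp add: nn_integral_lborel_diff nn_integral_cmult)
  finally have eq: "(\<integral>\<^sup>+y. h y \<partial>lborel) * (\<integral>\<^sup>+x. g x \<partial>lborel) =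
      (\<integral>\<^sup>+y. h y \<partial>lborel) * (\<integral>\<^sup>+y. g (f y) \<partial>lborel)"
    by (simp add: mult.commute)
  have "(\<integral>\<^sup>+y. h y \<partial>lborel) = emeasure lborel (ball 0 1 :: 'a set)"
    by (simp add: h_def)
  moreover have "emeasure lborel (ball 0 1 :: 'a set) \<noteq> 0" "emeasure lborel (ball 0 1 :: 'a set) \<noteq> top"
    using order_less_imp_not_eq2[OF unit_ball_vol_pos[of "real DIM('a)"]] by (simp_all add: emeasure_ball)
  ultimately show ?thesis
    using eq by (metis ennreal_mult_cancel_left)
qed

lemma linear_borel_measurable:
  fixes f :: "'a::euclidean_space \<Rightarrow> 'a"
  shows "linear f \<Longrightarrow> f \<in> borel_measurable borel"
  by (intro borel_measurable_continuous_onI linear_continuous_on linear_conv_bounded_linear[THEN iffD1])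

lemma lborel_distr_isometry:
  fixes f :: "'a::euclidean_space \<Rightarrow> 'a"
  assumes lin: "linear f" and nrm: "\<And>x. norm (f x) = norm x"
  shows "distr lborel borel f = lborel"
proof (rule measure_eqI)
  note [measurable] = linear_borel_measurable[OF lin]
  fix A assume "A \<in> sets (distr lborel borel f)"
  then have [measurable]: "A \<in> sets borel" by simp
  have "emeasure (distr lborel borel f) A = (\<integral>\<^sup>+x. indicator A x \<partial>distr lborel borel f)"
    by simp
  also have "\<dots> = (\<integral>\<^sup>+x. indicator A (f x) \<partial>lborel)"
    by (rule nn_integral_distr) auto
  also have "\<dots> = emeasure lborel A"
    by (simp add: nn_integral_isometry[OF lin nrm])
  finally show "emeasure (distr lborel borel f) A = emeasure lborel A" .
qed simp

lemma integral_isometry: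
  fixes f :: "'a::euclidean_space \<Rightarrow> 'a" and g :: "'a \<Rightarrow> real"
  assumes lin: "linear f" and nrm: "\<And>x. norm (f x) = norm x"
    and [measurable]: "g \<in> borel_measurable borel"
  shows "(LINT x|lborel. g (f x)) = (LINT x|lborel. g x)"
  using linear_borel_measurable[OF lin]
  by (subst (2) lborel_distr_isometry[OF lin nrm, symmetric]) (simp add: integral_distr)

lemma integrable_isometry:
  fixes f :: "'a::euclidean_space \<Rightarrow> 'a" and g :: "'a \<Rightarrow> real"
  assumes lin: "linear f" and nrm: "\<And>x. norm (f x) = norm x"
    and [measurable]: "g \<in> borel_measurable borel"
  shows "integrable lborel (\<lambda>x. g (f x)) \<longleftrightarrow> integrable lborel g"
  using linear_borel_measurable[OF lin]
  by (subst (2) lborel_distr_isometry[OF lin nrm, symmetric]) (simp add: integrable_distr_eq)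

text \<open>Reflection in the hyperplane orthogonal to \<open>z\<close>; the identity for \<open>z = 0\<close>.\<close>

definition mirror :: "'a::euclidean_space \<Rightarrow> 'a \<Rightarrow> 'a" where
  "mirror z x = x - (2 * (x \<bullet> z) / (z \<bullet> z)) *\<^sub>R z"

lemma linear_mirror: "linear (mirror z)"
  by (rule linearI) (auto simp: mirror_def algebra_simps inner_simps add_divide_distrib)

lemma inner_mirror_normal: "mirror z x \<bullet> z = - (x \<bullet> z)"
  by (cases "z = 0") (auto simp: mirror_def inner_simps)

lemma mirror_mirror [simp]: "mirror z (mirror z x) = x"
proof -
  have "mirror z (mirror z x) = mirror z x - (2 * (mirror z x \<bullet> z) / (z \<bullet> z)) *\<^sub>R z"
    by (simp add: mirror_def)
  then show ?thesis
    unfolding inner_mirror_normal by (simp add: mirror_def)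
qed

lemma norm_mirror [simp]: "norm (mirror z x) = norm x"
proof (cases "z = 0")
  case False
  have "mirror z x \<bullet> mirror z x = mirror z x \<bullet> x - (2 * (x \<bullet> z) / (z \<bullet> z)) * (mirror z x \<bullet> z)"
    by (subst (2) mirror_def) (simp add: inner_simps)
  also have "\<dots> = x \<bullet> x"
    unfolding inner_mirror_normal using False by (simp add: mirror_def inner_simps inner_commute)
  finally show ?thesis by (simp add: norm_eq_sqrt_inner)
qed (simp add: mirror_def)

lemma mirror_measurable [measurable]: "mirror z \<in> borel_measurable borel"
  by (rule linear_borel_measurable[OF linear_mirror])

lemma mirror_diff: "mirror z x - mirror z y = mirror z (x - y)"
  by (simp add: linear_diff[OF linear_mirror])

lemma norm_mirror_diff: "norm (mirror z x - mirror z y) = norm (x - y)"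
  by (simp add: mirror_diff)

lemma norm_diff_mirror: "norm (mirror z x - y) = norm (x - mirror z y)"
  by (metis mirror_mirror norm_mirror_diff)

lemma norm_diff_mirror_square:
  "(norm (x - mirror z y))\<^sup>2 = (norm (x - y))\<^sup>2 + 4 * (x \<bullet> z) * (y \<bullet> z) / (z \<bullet> z)"
proof (cases "z = 0")
  case False
  define c where "c = 2 * (y \<bullet> z) / (z \<bullet> z)"
  have cz: "c * (z \<bullet> z) = 2 * (y \<bullet> z)" using False by (simp add: c_def)
  have "x - mirror z y = (x - y) + c *\<^sub>R z" by (simp add: mirror_def c_def)
  moreover have "(norm (d + c *\<^sub>R z))\<^sup>2 = (norm d)\<^sup>2 + 2 * c * (d \<bullet> z) + c * (c * (z \<bullet> z))" for d
    by (simp add: power2_norm_eq_inner inner_simps inner_commute[of z d] distrib_left)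
  ultimately have "(norm (x - mirror z y))\<^sup>2 = (norm (x - y))\<^sup>2 + 2 * c * ((x - y) \<bullet> z) + c * (c * (z \<bullet> z))"
    by metis
  also have "\<dots> = (norm (x - y))\<^sup>2 + 2 * c * (x \<bullet> z)"
    unfolding cz by (simp add: inner_simps algebra_simps)
  finally show ?thesis by (simp add: c_def algebra_simps)
qed (simp add: mirror_def)

text \<open>The source of every sign below: for a radially nonincreasing kernel, a same-side pair
  weighs at least as much as the pair with one point reflected.\<close>

lemma norm_diff_le_mirror:
  assumes "x \<bullet> z \<ge> 0" "y \<bullet> z \<ge> 0"
  shows "norm (x - y) \<le> norm (x - mirror z y)"
proof (rule power2_le_imp_le)
  show "(norm (x - y))\<^sup>2 \<le> (norm (x - mirror z y))\<^sup>2"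
    unfolding norm_diff_mirror_square using assms by simp
qed simp

lemma mirror_fixed: "x \<bullet> z = 0 \<Longrightarrow> mirror z x = x"
  by (simp add: mirror_def)

text \<open>Points of equal norm have their perpendicular bisector through the origin. This turns
  reflection inequalities into comparisons along a sphere.\<close>

lemma mirror_difference:
  assumes "norm x = norm y"
  shows "mirror (x - y) x = y"
proof (cases "x = y")
  case False
  have "x \<bullet> x = y \<bullet> y" using assms by (simp add: norm_eq_sqrt_inner)
  then have "(x - y) \<bullet> (x - y) = 2 * (x \<bullet> (x - y))"
    by (simp add: inner_simps inner_commute)
  moreover have "(x - y) \<bullet> (x - y) \<noteq> 0" using False by simp
  ultimately show ?thesis by (simp add: mirror_def)
qed (simp add: mirror_def)

section \<open>Symmetrisation over reflected pairs\<close>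

definition mirror_sum :: "'a::euclidean_space \<Rightarrow> ('a \<times> 'a \<Rightarrow> 'b::comm_monoid_add) \<Rightarrow> 'a \<times> 'a \<Rightarrow> 'b" where
  "mirror_sum z G p = G p + G (mirror z (fst p), snd p) + G (fst p, mirror z (snd p)) +
     G (mirror z (fst p), mirror z (snd p))"

lemma mirror_sum_mono:
  fixes G B :: "'a::euclidean_space \<times> 'a \<Rightarrow> 'b::ordered_comm_monoid_add"
  assumes "\<And>x y. x \<bullet> z \<ge> 0 \<Longrightarrow> y \<bullet> z \<ge> 0 \<Longrightarrow> mirror_sum z G (x, y) \<le> mirror_sum z B (x, y)"
  shows "mirror_sum z G p \<le> mirror_sum z B p"
proof -
  obtain x y where p: "p = (x, y)" by fastforce
  \<comment> \<open>The sum is invariant under reflecting either entry, so both points may be moved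
    into the closed half-space.\<close>
  define x' where "x' = (if x \<bullet> z \<ge> 0 then x else mirror z x)"
  define y' where "y' = (if y \<bullet> z \<ge> 0 then y else mirror z y)"
  have "x' \<bullet> z \<ge> 0" "y' \<bullet> z \<ge> 0"
    by (auto simp: x'_def y'_def inner_mirror_normal)
  moreover have "mirror_sum z H (x', y') = mirror_sum z H p" for H :: "'a \<times> 'a \<Rightarrow> 'b"
    by (simp add: x'_def y'_def p mirror_sum_def ac_simps)
  ultimately show ?thesis using assms by metis
qed

lemma isometries_pair:
  fixes z :: "'a::euclidean_space"
  shows "linear (\<lambda>p. (mirror z (fst p), snd p))" "linear (\<lambda>p. (fst p, mirror z (snd p)))"
    "linear (\<lambda>p. (mirror z (fst p), mirror z (snd p)))"
  by (rule linearI; simp add: linear_add[OF linear_mirror] linear_cmul[OF linear_mirror])+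

lemma nn_integral_mirror_sum:
  fixes G :: "'a::euclidean_space \<times> 'a \<Rightarrow> ennreal"
  assumes [measurable]: "G \<in> borel_measurable borel"
  shows "(\<integral>\<^sup>+p. mirror_sum z G p \<partial>lborel) = 4 * (\<integral>\<^sup>+p. G p \<partial>lborel)"
proof -
  note [measurable] = isometries_pair[of z, THEN linear_borel_measurable]
  have "4 * c = c + c + c + (c::ennreal)" for c
    by (metis (no_types, lifting) add.assoc distrib_right mult_2 mult_2_right mult_numeral_1 numeral_Bit0)
  then show ?thesis
    unfolding mirror_sum_def
    by (simp add: nn_integral_add nn_integral_isometry[OF isometries_pair(1)]
        nn_integral_isometry[OF isometries_pair(2)] nn_integral_isometry[OF isometries_pair(3)] norm_prod_def)
qed

text \<open>Summing over the four reflected pairs multiplies an integral over the product space by four, and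
  this sum is determined by its values on the half-space.\<close>

lemma nn_integral_mirror_le:
  fixes G B :: "'a::euclidean_space \<times> 'a \<Rightarrow> ennreal"
  assumes [measurable]: "G \<in> borel_measurable borel" "B \<in> borel_measurable borel"
    and "\<And>x y. x \<bullet> z \<ge> 0 \<Longrightarrow> y \<bullet> z \<ge> 0 \<Longrightarrow> mirror_sum z G (x, y) \<le> mirror_sum z B (x, y)"
  shows "(\<integral>\<^sup>+p. G p \<partial>lborel) \<le> (\<integral>\<^sup>+p. B p \<partial>lborel)"
proof -
  have "4 * (\<integral>\<^sup>+p. G p \<partial>lborel) \<le> 4 * (\<integral>\<^sup>+p. B p \<partial>lborel)"
    unfolding nn_integral_mirror_sum[OF assms(1), of z, symmetric] nn_integral_mirror_sum[OF assms(2), of z, symmetric]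
    by (rule nn_integral_mono[OF mirror_sum_mono[OF assms(3)]])
  then show ?thesis
    by (simp add: ennreal_mult_le_mult_iff)
qed

lemma integral_mirror_le:
  fixes G B :: "'a::euclidean_space \<times> 'a \<Rightarrow> real"
  assumes G: "integrable lborel G" and B: "integrable lborel B"
    and le: "\<And>x y. x \<bullet> z \<ge> 0 \<Longrightarrow> y \<bullet> z \<ge> 0 \<Longrightarrow> mirror_sum z G (x, y) \<le> mirror_sum z B (x, y)"
  shows "(LINT p|lborel. G p) \<le> (LINT p|lborel. B p)"
proof -
  have *: "integrable lborel (mirror_sum z H) \<and> (LINT p|lborel. mirror_sum z H p) = 4 * (LINT p|lborel. H p)"
    if H: "integrable lborel H" for H :: "'a \<times> 'a \<Rightarrow> real"
  proof -
    have [measurable]: "H \<in> borel_measurable borel" using H by simp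
    have i: "integrable lborel (\<lambda>p. H (mirror z (fst p), snd p))"
      "integrable lborel (\<lambda>p. H (fst p, mirror z (snd p)))"
      "integrable lborel (\<lambda>p. H (mirror z (fst p), mirror z (snd p)))"
      using H by (simp_all add: integrable_isometry[OF isometries_pair(1)]
        integrable_isometry[OF isometries_pair(2)] integrable_isometry[OF isometries_pair(3)] norm_prod_def)
    show ?thesis
      unfolding mirror_sum_def using i H
      by (simp add: integral_isometry[OF isometries_pair(1)]
        integral_isometry[OF isometries_pair(2)] integral_isometry[OF isometries_pair(3)] norm_prod_def)
  qed
  have "4 * (LINT p|lborel. G p) \<le> 4 * (LINT p|lborel. B p)"
    using *[OF G] *[OF B] integral_mono[of lborel "mirror_sum z G" "mirror_sum z B"] mirror_sum_mono[OF le]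
    by fastforce
  then show ?thesis by simp
qed

subsection \<open>Radially decreasing kernels\<close>

text \<open>Polar coordinates without a surface measure: on half-lines the left side is the volume
  of a ball, the right side the integral of the derivative of this volume in the radius.\<close>

lemma distr_norm_lborel:
  "distr lborel borel (norm :: 'a::euclidean_space \<Rightarrow> real) = density lborel
     (\<lambda>r. ennreal (unit_ball_vol DIM('a) * DIM('a)) * (ennreal (r ^ (DIM('a) - 1)) * indicator {0<..} r))"
  (is "?D = density lborel ?g")
proof (rule measure_eqI_generator_eq[where E = "range (\<lambda>a::real. {..a})" and \<Omega> = UNIV
      and A = "\<lambda>i. {..real i}"])
  let ?c = "unit_ball_vol DIM('a)"
  let ?n = "DIM('a)"
  have c: "?c \<ge> 0" by simp
  have gm: "?g \<in> borel_measurable lborel"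
    by (intro borel_measurable_times_ennreal borel_measurable_indicator measurable_compose[OF _ measurable_ennreal]
        borel_measurable_power borel_measurable_const) simp_all
  show "Int_stable (range (\<lambda>a::real. {..a}))"
  proof (rule Int_stableI, safe)
    fix a b :: real
    have "{..a} \<inter> {..b} = {..min a b}" by auto
    then show "{..a} \<inter> {..b} \<in> range (\<lambda>a. {..a})" by blast
  qed
  have D: "emeasure ?D {..a} = ennreal (if a \<ge> 0 then ?c * a ^ ?n else 0)" for a
  proof -
    have "norm -` {..a} = cball (0::'a) a" by auto
    then have "emeasure ?D {..a} = emeasure lborel (cball (0::'a) a)"
      by (simp add: emeasure_distr)
    then show ?thesis
      by (cases "a \<ge> 0") (auto simp: emeasure_cball)
  qed
  show "emeasure ?D X = emeasure (density lborel ?g) X" if "X \<in> range (\<lambda>a::real. {..a})" for X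
  proof -
    obtain a where X: "X = {..a}" using \<open>X \<in> range _\<close> by blast
    show ?thesis
    proof (cases "a \<ge> 0")
      case True
      have "emeasure (density lborel ?g) X = (\<integral>\<^sup>+r. ?g r * indicator {..a} r \<partial>lborel)"
        unfolding X by (rule emeasure_density[OF gm]) simp
      also have "\<dots> = (\<integral>\<^sup>+r. ennreal (?c * ?n * r ^ (?n - 1)) * indicator {0..a} r \<partial>lborel)"
      \<comment> \<open>The origin is discarded because in dimension one \<open>0 ^ 0 = 1\<close>,
        whereas the density on the left is 0 there.\<close>
      proof (rule nn_integral_cong_AE[OF AE_mp[OF AE_lborel_singleton[of "0::real"] AE_I2]], rule impI)
        fix r :: real assume "r \<noteq> 0"
        show "?g r * indicator {..a} r = ennreal (?c * ?n * r ^ (?n - 1)) * indicator {0..a} r"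
        proof (cases "0 < r \<and> r \<le> a")
          case True
          then show ?thesis by (simp add: ennreal_mult[symmetric] c)
        next
          case False
          then have "r < 0 \<or> r > a" using \<open>r \<noteq> 0\<close> by linarith
          then show ?thesis by auto
        qed
      qed
      also have "\<dots> = ennreal (?c * a ^ ?n - ?c * 0 ^ ?n)"
      proof (rule nn_integral_FTC_Icc)
        show "((\<lambda>r. ?c * r ^ ?n) has_real_derivative ?c * ?n * r ^ (?n - 1)) (at r)" for r
          by (rule derivative_eq_intros refl | simp)+
      qed (use True c in auto)
      also have "\<dots> = emeasure ?D X"
        using True D by (simp add: X)
      finally show ?thesis ..
    next
      case False
      have "emeasure (density lborel ?g) X = (\<integral>\<^sup>+r. ?g r * indicator {..a} r \<partial>lborel)"
        unfolding X by (rule emeasure_density[OF gm]) simp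
      also have "\<dots> = (\<integral>\<^sup>+r. 0 \<partial>(lborel :: real measure))"
        using False by (intro nn_integral_cong) (auto simp: indicator_def)
      finally show ?thesis using False D by (simp add: X)
    qed
  qed
  show "sets ?D = sigma_sets UNIV (range (\<lambda>a::real. {..a}))"
    "sets (density lborel ?g) = sigma_sets UNIV (range (\<lambda>a::real. {..a}))"
    by (simp_all add: borel_eq_atMost)
  show "(\<Union>i. {..real i}) = UNIV"
    using real_arch_simple by (intro set_eqI) simp
  show "emeasure ?D {..real i} \<noteq> \<infinity>" for i
    by (simp add: D)
  show "range (\<lambda>a::real. {..a}) \<subseteq> Pow UNIV" by blast
  show "range (\<lambda>i. {..real i}) \<subseteq> range (\<lambda>a::real. {..a})" by blast
qed

lemma nn_integral_radial:
  assumes [measurable]: "g \<in> borel_measurable borel"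
  shows "(\<integral>\<^sup>+x. g (norm x) \<partial>(lborel :: 'a::euclidean_space measure)) =
     ennreal (unit_ball_vol DIM('a) * DIM('a)) * (\<integral>\<^sup>+r\<in>{0<..}. g r * ennreal (r ^ (DIM('a) - 1)) \<partial>lborel)"
proof -
  have "(\<integral>\<^sup>+x. g (norm x) \<partial>(lborel :: 'a measure)) = (\<integral>\<^sup>+r. g r \<partial>distr lborel borel (norm :: 'a \<Rightarrow> real))"
    by (simp add: nn_integral_distr)
  also have "\<dots> = (\<integral>\<^sup>+r. ennreal (unit_ball_vol DIM('a) * DIM('a)) *
      ((g r * ennreal (r ^ (DIM('a) - 1))) * indicator {0<..} r) \<partial>lborel)"
    unfolding distr_norm_lborel by (simp add: nn_integral_density ac_simps)
  finally show ?thesis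
    by (simp add: nn_integral_cmult)
qed

text \<open>The profile conditions carried over to the whole space. Finiteness away from the origin
  is not part of the profile; \<open>levy_kernelI\<close> derives it.\<close>

locale levy_kernel =
  fixes k :: "real^'n \<Rightarrow> ennreal"
  assumes k_measurable [measurable]: "k \<in> borel_measurable borel"
    and k_antimono: "\<And>x y. norm x \<le> norm y \<Longrightarrow> k y \<le> k x"
    and k_finite: "\<And>z. z \<noteq> 0 \<Longrightarrow> k z < \<infinity>"
    and k_levy: "(\<integral>\<^sup>+z. ennreal (min 1 ((norm z)\<^sup>2)) * k z \<partial>lborel) < \<infinity>"
    and k_infinite: "(\<integral>\<^sup>+z. k z \<partial>lborel) = \<infinity>"

lemma levy_kernelI:
  fixes k :: "real^'n \<Rightarrow> ennreal"
  assumes prof: "kernel_profile CARD('n) k0" and k: "\<And>z. k z = k0 (norm z)"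
  shows "levy_kernel k"
proof
  have anti: "k0 s \<le> k0 r" if "0 \<le> r" "r \<le> s" for r s
    using prof that by (auto simp: kernel_profile_def monotone_on_def)
  \<comment> \<open>The even extension replaces the arbitrary values of the profile on the negative
    half-line; its superlevel sets are intervals, hence Borel.\<close>
  define g where "g r = k0 \<bar>r\<bar>" for r
  show kanti: "k y \<le> k x" if "norm x \<le> norm y" for x y
    using that anti by (simp add: k)
  have gm [measurable]: "g \<in> borel_measurable borel"
  proof (rule borel_measurableI_greater)
    fix a
    have "is_interval {r. a < g r}"
      unfolding is_interval_1
    proof (intro ballI allI impI)
      fix p q x assume "p \<in> {r. a < g r}" "q \<in> {r. a < g r}" "p \<le> x \<and> x \<le> q"
      moreover then have "\<bar>x\<bar> \<le> \<bar>p\<bar> \<or> \<bar>x\<bar> \<le> \<bar>q\<bar>" by linarith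
      ultimately show "x \<in> {r. a < g r}"
        using anti unfolding g_def by (auto intro: less_le_trans)
    qed
    then have "{r. a < g r} \<in> sets borel"
      by (rule real_interval_borel_measurable)
    then show "{x \<in> space borel. a < g x} \<in> sets borel" by simp
  qed
  have kg: "k z = g (norm z)" for z by (simp add: k g_def)
  show km [measurable]: "k \<in> borel_measurable borel"
    unfolding kg[abs_def] by measurable
  have vol: "unit_ball_vol (real DIM(real^'n)) * real DIM(real^'n) > 0"
    by (intro mult_pos_pos unit_ball_vol_pos) auto
  have "(\<integral>\<^sup>+z. ennreal (min 1 ((norm z)\<^sup>2)) * k z \<partial>lborel) =
      ennreal (unit_ball_vol DIM(real^'n) * DIM(real^'n)) *
      (\<integral>\<^sup>+r\<in>{0<..}. (ennreal (min 1 (r\<^sup>2)) * g r) * ennreal (r ^ (DIM(real^'n) - 1)) \<partial>lborel)"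
    unfolding kg by (rule nn_integral_radial[where g = "\<lambda>r. ennreal (min 1 (r\<^sup>2)) * g r"]) simp
  also have "(\<integral>\<^sup>+r\<in>{0<..}. (ennreal (min 1 (r\<^sup>2)) * g r) * ennreal (r ^ (DIM(real^'n) - 1)) \<partial>lborel) =
      (\<integral>\<^sup>+r\<in>{0<..}. ennreal (min 1 (r\<^sup>2)) * k0 r * ennreal (r ^ (CARD('n) - 1)) \<partial>lborel)"
    by (intro nn_integral_cong) (auto simp: g_def indicator_def)
  finally show levy: "(\<integral>\<^sup>+z. ennreal (min 1 ((norm z)\<^sup>2)) * k z \<partial>lborel) < \<infinity>"
    using prof by (simp add: kernel_profile_def ennreal_mult_less_top)
  have "(\<integral>\<^sup>+z. k z \<partial>lborel) = ennreal (unit_ball_vol DIM(real^'n) * DIM(real^'n)) *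
      (\<integral>\<^sup>+r\<in>{0<..}. g r * ennreal (r ^ (DIM(real^'n) - 1)) \<partial>lborel)"
    unfolding kg by (rule nn_integral_radial) simp
  also have "(\<integral>\<^sup>+r\<in>{0<..}. g r * ennreal (r ^ (DIM(real^'n) - 1)) \<partial>lborel) =
      (\<integral>\<^sup>+r\<in>{0<..}. k0 r * ennreal (r ^ (CARD('n) - 1)) \<partial>lborel)"
    by (intro nn_integral_cong) (auto simp: g_def indicator_def)
  also have "\<dots> = \<infinity>" using prof by (simp add: kernel_profile_def)
  also have "ennreal (unit_ball_vol DIM(real^'n) * DIM(real^'n)) * \<infinity> = \<infinity>"
    using vol[unfolded not_le[symmetric]]
    by (simp only: ennreal_mult_top ennreal_eq_0_iff infinity_ennreal_def if_False)
  finally show "(\<integral>\<^sup>+z. k z \<partial>lborel) = \<infinity>" .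
  show "k z < \<infinity>" if z: "z \<noteq> 0" for z
  proof (rule ccontr)
    assume "\<not> k z < \<infinity>"
    then have kz: "k z = \<infinity>" by (metis less_top infinity_ennreal_def)
    \<comment> \<open>An infinite value at \<open>z\<close> would spread to the whole ball of radius
      \<open>norm z\<close>, while the Levy integrand is finite almost everywhere and its weight is
      positive off the origin.\<close>
    have "AE y in lborel. ennreal (min 1 ((norm y)\<^sup>2)) * k y \<noteq> \<infinity>"
      by (rule nn_integral_PInf_AE) (use levy in auto)
    moreover have "AE y in lborel. y \<noteq> (0::real^'n)"
      by (rule AE_lborel_singleton)
    ultimately have "AE y in lborel. y \<notin> ball (0::real^'n) (norm z)"
    proof eventually_elim
      case (elim y)
      show ?case
      proof
        assume "y \<in> ball 0 (norm z)"
        then have "k z \<le> k y" by (intro kanti) auto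
        then have "k y = \<infinity>" using kz by (simp add: top_unique)
        then show False using elim by (auto simp: ennreal_mult_top min_def split: if_splits)
      qed
    qed
    then have "emeasure lborel (ball (0::real^'n) (norm z)) = 0"
      by (subst (asm) AE_iff_measurable[OF _ refl]) (auto simp: ball_def)
    then show False
      using z order_less_imp_not_eq2[OF unit_ball_vol_pos[of "real DIM(real^'n)"]]
      by (simp add: emeasure_ball)
  qed
qed

context levy_kernel
begin

text \<open>If \<open>k 0\<close> is infinite, then \<open>kr 0\<close> is the default 0. Hence
  monotonicity of \<open>kr\<close> excludes the origin, and pairs with \<open>x = y\<close> are
  treated separately later on.\<close>

definition kr :: "real^'n \<Rightarrow> real" where "kr z = enn2real (k z)"

lemma kr_measurable [measurable]: "kr \<in> borel_measurable borel"
  unfolding kr_def by measurable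

lemma kr_nonneg [simp]: "kr z \<ge> 0" by (simp add: kr_def)

lemma ennreal_kr: "z \<noteq> 0 \<Longrightarrow> ennreal (kr z) = k z"
  using k_finite[of z] by (simp add: kr_def)

lemma kr_antimono: "x \<noteq> 0 \<Longrightarrow> norm x \<le> norm y \<Longrightarrow> kr y \<le> kr x"
  unfolding kr_def using k_finite[of x] k_antimono[of x y] by (intro enn2real_mono) auto

lemma kr_norm_cong: "norm x = norm y \<Longrightarrow> kr x = kr y"
  unfolding kr_def using k_antimono[of x y] k_antimono[of y x] by auto

lemma integrable_levy: "integrable lborel (\<lambda>z. min 1 ((norm z)\<^sup>2) * kr z)"
proof (rule integrableI_bounded)
  have "(\<integral>\<^sup>+z. ennreal (norm (min 1 ((norm z)\<^sup>2) * kr z)) \<partial>lborel) \<le>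
      (\<integral>\<^sup>+z. ennreal (min 1 ((norm z)\<^sup>2)) * k z \<partial>lborel)"
  proof (intro nn_integral_mono)
    show "ennreal (norm (min 1 ((norm z)\<^sup>2) * kr z)) \<le> ennreal (min 1 ((norm z)\<^sup>2)) * k z" for z
      by (cases "z = 0") (simp_all add: abs_mult ennreal_mult ennreal_kr)
  qed
  then show "(\<integral>\<^sup>+z. ennreal (norm (min 1 ((norm z)\<^sup>2) * kr z)) \<partial>lborel) < \<infinity>"
    using k_levy by (auto intro: le_less_trans)
qed simp

text \<open>Otherwise monotonicity bounds the kernel by \<open>C\<close> off the origin, and
  together with the Levy condition at large arguments it becomes integrable.\<close>

lemma k_singular: "\<exists>\<rho>>0. \<forall>z. norm z < \<rho> \<longrightarrow> ennreal C < k z"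
proof (rule ccontr)
  assume *: "\<not> ?thesis"
  have le: "k z \<le> ennreal C" if z: "z \<noteq> 0" for z
  proof -
    obtain y where "norm y < norm z" "\<not> ennreal C < k y"
      using * z by (metis zero_less_norm_iff)
    then have "k z \<le> k y" "k y \<le> ennreal C"
      by (auto intro: k_antimono)
    then show ?thesis by (rule order_trans)
  qed
  have [measurable]: "(\<lambda>z. ennreal C * indicator (cball 0 1) z) \<in> borel_measurable (lborel :: (real^'n) measure)"
    by (intro borel_measurable_times_ennreal borel_measurable_indicator borel_measurable_const) simp
  have "(\<integral>\<^sup>+z. k z \<partial>lborel) \<le>
      (\<integral>\<^sup>+z. ennreal C * indicator (cball 0 1) z + ennreal (min 1 ((norm z)\<^sup>2)) * k z \<partial>lborel)"
  proof (rule nn_integral_mono_AE[OF AE_mp[OF AE_lborel_singleton[of "0"] AE_I2]], rule impI)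
    fix z :: "real^'n" assume z: "z \<noteq> 0"
    show "k z \<le> ennreal C * indicator (cball 0 1) z + ennreal (min 1 ((norm z)\<^sup>2)) * k z"
    proof (cases "norm z \<le> 1")
      case True
      then show ?thesis using le[OF z] by (simp add: add_increasing2)
    next
      case False
      then have "min 1 ((norm z)\<^sup>2) = 1" by (simp add: min_def power2_nonneg_ge_1_iff)
      then show ?thesis using False by simp
    qed
  qed
  also have "\<dots> = ennreal C * emeasure lborel (cball (0::real^'n) 1) +
      (\<integral>\<^sup>+z. ennreal (min 1 ((norm z)\<^sup>2)) * k z \<partial>lborel)"
    by (subst nn_integral_add) (simp_all add: nn_integral_cmult_indicator)
  also have "\<dots> < \<infinity>"
    using k_levy by (simp add: emeasure_cball ennreal_mult_less_top)
  finally show False using k_infinite by simp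
qed

subsection \<open>The energy form as an integral over the product space\<close>

text \<open>The integrand of twice the energy form. Using \<open>kr\<close> is harmless because the
  increments vanish on the diagonal.\<close>

definition gam :: "(real^'n \<Rightarrow> real) \<Rightarrow> (real^'n \<Rightarrow> real) \<Rightarrow> (real^'n) \<times> (real^'n) \<Rightarrow> real" where
  "gam u v p = (u (fst p) - u (snd p)) * (v (fst p) - v (snd p)) * kr (fst p - snd p)"

lemma gam_measurable [measurable (raw)]:
  assumes [measurable]: "u \<in> borel_measurable borel" "v \<in> borel_measurable borel"
  shows "gam u v \<in> borel_measurable borel"
  unfolding gam_def[abs_def] borel_prod[symmetric] by measurable

lemma gam_diff_left: "gam (\<lambda>x. u x - u' x) v p = gam u v p - gam u' v p"
  by (simp add: gam_def algebra_simps)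

lemma gam_self_nonneg: "gam u u p \<ge> 0"
  by (simp add: gam_def)

lemma energy_eq:
  assumes [measurable]: "u \<in> borel_measurable borel"
  shows "energy k u = (\<integral>\<^sup>+p. ennreal (gam u u p) \<partial>lborel) / 2"
proof -
  have "ennreal ((u x - u y) * (u x - u y)) * k (x - y) = ennreal (gam u u (x, y))" for x y
    by (cases "x = y") (simp_all add: gam_def ennreal_mult ennreal_kr)
  moreover have "(\<integral>\<^sup>+y. \<integral>\<^sup>+x. ennreal (gam u u (x, y)) \<partial>lborel \<partial>lborel) =
      (\<integral>\<^sup>+p. ennreal (gam u u p) \<partial>lborel)"
    by (subst lborel_pair.nn_integral_snd) (simp_all add: lborel_prod borel_prod)
  ultimately show ?thesis by (simp add: energy_def)
qed

lemma energy_finite_iff: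
  assumes [measurable]: "u \<in> borel_measurable borel"
  shows "energy k u < top \<longleftrightarrow> integrable lborel (gam u u)"
proof -
  have "energy k u < top \<longleftrightarrow> (\<integral>\<^sup>+p. ennreal (gam u u p) \<partial>lborel) < top"
    unfolding energy_eq[OF assms]
    by (cases "\<integral>\<^sup>+p. ennreal (gam u u p) \<partial>lborel") (auto simp: ennreal_top_divide ennreal_divide_numeral)
  then show ?thesis
    by (simp add: integrable_iff_bounded gam_self_nonneg)
qed

lemma integrable_gam:
  assumes [measurable]: "u \<in> borel_measurable borel" "v \<in> borel_measurable borel"
    and "energy k u < \<infinity>" "energy k v < \<infinity>"
  shows "integrable lborel (gam u v)"
proof (rule Bochner_Integration.integrable_bound)
  show "integrable lborel (\<lambda>p. gam u u p + gam v v p)"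
    using assms by (simp add: energy_finite_iff)
  show "AE p in lborel. norm (gam u v p) \<le> norm (gam u u p + gam v v p)"
  proof (intro AE_I2)
    fix p
    define a where "a = u (fst p) - u (snd p)"
    define b where "b = v (fst p) - v (snd p)"
    have "\<bar>a * b\<bar> \<le> a * a + b * b"
      using sum_squares_bound[of a b] sum_squares_bound[of a "-b"] sum_squares_ge_zero[of a b]
      by (simp add: power2_eq_square abs_le_iff)
    then have "\<bar>a * b\<bar> * kr (fst p - snd p) \<le> (a * a + b * b) * kr (fst p - snd p)"
      by (rule mult_right_mono) simp
    then show "norm (gam u v p) \<le> norm (gam u u p + gam v v p)"
      using gam_self_nonneg[of u p] gam_self_nonneg[of v p]
      by (simp add: gam_def a_def b_def abs_mult distrib_right)
  qed
qed simp

lemma energy_form_eq: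
  assumes "integrable lborel (gam u v)"
  shows "energy_form k u v = 1/2 * (LINT p|lborel. gam u v p)"
proof -
  have "(LINT y|lborel. LINT x|lborel. gam u v (x, y)) = (LINT p|lborel. gam u v p)"
    using assms by (subst lborel_pair.integral_snd) (simp_all add: lborel_prod)
  then show ?thesis by (simp add: energy_form_def gam_def kr_def)
qed

text \<open>The admissibility criterion for test functions built by scaling, subtraction and
  truncation: by \<open>(a + b)^2 \<le> 2 a^2 + 2 b^2\<close> only the increments have to be
  compared.\<close>

lemma energy_dominated:
  assumes [measurable]: "u \<in> borel_measurable borel" "v \<in> borel_measurable borel" "w \<in> borel_measurable borel"
    and "energy k u < \<infinity>" "energy k v < \<infinity>"
    and le: "\<And>x y. \<bar>w x - w y\<bar> \<le> \<bar>u x - u y\<bar> + \<bar>v x - v y\<bar>"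
  shows "energy k w < \<infinity>"
proof -
  have "integrable lborel (gam w w)"
  proof (rule Bochner_Integration.integrable_bound)
    show "integrable lborel (\<lambda>p. 2 * gam u u p + 2 * gam v v p)"
      using assms by (simp add: energy_finite_iff)
    show "AE p in lborel. norm (gam w w p) \<le> norm (2 * gam u u p + 2 * gam v v p)"
    proof (intro AE_I2)
      fix p
      define a where "a = u (fst p) - u (snd p)"
      define b where "b = v (fst p) - v (snd p)"
      define c where "c = w (fst p) - w (snd p)"
      have "\<bar>c\<bar>\<^sup>2 \<le> (\<bar>a\<bar> + \<bar>b\<bar>)\<^sup>2"
        using le[of "fst p" "snd p"] by (intro power_mono) (auto simp: a_def b_def c_def)
      also have "\<dots> \<le> 2 * (a * a) + 2 * (b * b)"
        using sum_squares_bound[of "\<bar>a\<bar>" "\<bar>b\<bar>"] by (simp add: power2_eq_square algebra_simps)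
      finally have "(c * c) * kr (fst p - snd p) \<le> (2 * (a * a) + 2 * (b * b)) * kr (fst p - snd p)"
        by (intro mult_right_mono) (simp_all add: power2_eq_square)
      then show "norm (gam w w p) \<le> norm (2 * gam u u p + 2 * gam v v p)"
        using gam_self_nonneg[of u p] gam_self_nonneg[of v p] gam_self_nonneg[of w p]
        by (simp add: gam_def a_def b_def c_def distrib_right)
    qed
  qed simp
  then show ?thesis by (simp add: energy_finite_iff)
qed

lemma gam_mirror: "gam u (\<lambda>x. v (mirror z x)) p = gam (\<lambda>x. u (mirror z x)) v (mirror z (fst p), mirror z (snd p))"
  by (simp add: gam_def kr_norm_cong[OF norm_mirror_diff])

lemma integral_gam_mirror:
  assumes [measurable]: "u \<in> borel_measurable borel" "v \<in> borel_measurable borel"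
  shows "(LINT p|lborel. gam u (\<lambda>x. v (mirror z x)) p) = (LINT p|lborel. gam (\<lambda>x. u (mirror z x)) v p)"
  unfolding gam_mirror
  by (rule integral_isometry[OF isometries_pair(3)]) (auto simp: norm_prod_def)

lemma energy_mirror:
  assumes [measurable]: "u \<in> borel_measurable borel"
  shows "energy k (\<lambda>x. u (mirror z x)) = energy k u"
proof -
  have "(\<integral>\<^sup>+p. ennreal (gam (\<lambda>x. u (mirror z x)) (\<lambda>x. u (mirror z x)) p) \<partial>lborel) =
      (\<integral>\<^sup>+p. ennreal (gam u u (mirror z (fst p), mirror z (snd p))) \<partial>lborel)"
    by (simp add: gam_def kr_norm_cong[OF norm_mirror_diff])
  also have "\<dots> = (\<integral>\<^sup>+p. ennreal (gam u u p) \<partial>lborel)"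
    by (rule nn_integral_isometry[OF isometries_pair(3)]) (auto simp: norm_prod_def)
  finally show ?thesis by (simp add: energy_eq)
qed

text \<open>Reflecting both variables leaves the kernel unchanged, so a reflection can be moved from
  the solution to the test function.\<close>

lemma energy_form_mirror:
  assumes [measurable]: "u \<in> borel_measurable borel" "v \<in> borel_measurable borel"
    and "energy k u < \<infinity>" "energy k v < \<infinity>"
  shows "energy_form k (\<lambda>x. u (mirror z x)) v = energy_form k u (\<lambda>x. v (mirror z x))"
  using assms by (simp add: energy_form_eq integrable_gam energy_mirror integral_gam_mirror)

lemma energy_form_diff:
  assumes [measurable]: "u \<in> borel_measurable borel" "u' \<in> borel_measurable borel" "v \<in> borel_measurable borel"
    and fin: "energy k u < \<infinity>" "energy k u' < \<infinity>" "energy k v < \<infinity>"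
  shows "energy_form k (\<lambda>x. u x - u' x) v = energy_form k u v - energy_form k u' v"
proof -
  have "integrable lborel (gam u v)" "integrable lborel (gam u' v)"
    using fin by (auto intro: integrable_gam)
  moreover then have "integrable lborel (gam (\<lambda>x. u x - u' x) v)"
    unfolding gam_diff_left[abs_def] by simp
  ultimately show ?thesis
    by (simp add: energy_form_eq gam_diff_left right_diff_distrib)
qed

end

subsection \<open>Integrals of products over the product space\<close>

lemma
  fixes g :: "'a::euclidean_space \<Rightarrow> real"
  assumes [measurable]: "g \<in> borel_measurable borel"
  shows integral_lborel_plus: "(LINT x|lborel. g (c + x)) = (LINT x|lborel. g x)"
    and integrable_lborel_plus: "integrable lborel (\<lambda>x. g (c + x)) \<longleftrightarrow> integrable lborel g"
   apply (subst (2) lborel_distr_plus[of c, symmetric], simp add: integral_distr)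
  apply (subst (2) lborel_distr_plus[of c, symmetric], simp add: integrable_distr_eq)
  done

lemma measurable_pair_borel:
  fixes G :: "'a::euclidean_space \<times> 'a \<Rightarrow> 'b::topological_space"
  shows "G \<in> borel_measurable (borel \<Otimes>\<^sub>M borel) \<Longrightarrow> G \<in> borel_measurable borel"
  by (simp add: borel_prod)

lemma
  fixes a b :: "'a::euclidean_space \<Rightarrow> real"
  assumes a: "integrable lborel a" and b: "integrable lborel b"
  shows integrable_tensor: "integrable lborel (\<lambda>p. a (fst p) * b (snd p))"
    and integral_tensor: "(LINT p|lborel. a (fst p) * b (snd p)) = (LINT x|lborel. a x) * (LINT y|lborel. b y)"
proof -
  have [measurable]: "a \<in> borel_measurable borel" "b \<in> borel_measurable borel"
    using a b by simp_all
  have "integrable (lborel \<Otimes>\<^sub>M lborel) (\<lambda>p. a (fst p) * b (snd p))"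
  proof (rule lborel_pair.Fubini_integrable)
    show "integrable lborel (\<lambda>x. LINT y|lborel. norm (a (fst (x, y)) * b (snd (x, y))))"
      using a by (simp add: abs_mult)
    show "AE x in lborel. integrable lborel (\<lambda>y. a (fst (x, y)) * b (snd (x, y)))"
      using b by simp
  qed simp
  then show *: "integrable lborel (\<lambda>p. a (fst p) * b (snd p))"
    by (simp add: lborel_prod)
  have "(LINT x|lborel. LINT y|lborel. a (fst (x, y)) * b (snd (x, y))) = (LINT p|lborel. a (fst p) * b (snd p))"
    using * by (subst lborel_pair.integral_fst') (simp_all add: lborel_prod)
  then show "(LINT p|lborel. a (fst p) * b (snd p)) = (LINT x|lborel. a x) * (LINT y|lborel. b y)"
    by simp
qed

text \<open>For a fixed first entry the map is a point reflection followed by a translation, so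
  integrating the second variable first suffices. It makes \<open>kr (x - y)\<close> a function of
  one variable.\<close>

lemma lborel_distr_shear:
  "distr lborel borel (\<lambda>p. (fst p, fst p - snd p)) = (lborel :: ('a::euclidean_space \<times> 'a) measure)"
proof (rule measure_eqI)
  let ?T = "\<lambda>p::'a \<times> 'a. (fst p, fst p - snd p)"
  have T: "?T \<in> borel_measurable borel"
    by (rule measurable_pair_borel) (simp add: borel_prod[symmetric])
  fix A assume "A \<in> sets (distr lborel borel ?T)"
  then have [measurable]: "A \<in> sets borel" by simp
  have i[measurable]: "indicator A \<in> borel_measurable (borel \<Otimes>\<^sub>M borel)"
    unfolding borel_prod by measurable
  have "emeasure (distr lborel borel ?T) A = (\<integral>\<^sup>+p. indicator A p \<partial>distr lborel borel ?T)"
    by simp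
  also have "\<dots> = (\<integral>\<^sup>+p. indicator A (?T p) \<partial>lborel)"
    using T by (intro nn_integral_distr) simp_all
  also have "\<dots> = (\<integral>\<^sup>+x. \<integral>\<^sup>+y. indicator A (?T (x, y)) \<partial>lborel \<partial>lborel)"
    using measurable_compose[OF T borel_measurable_indicator[of A borel]] by (subst lborel.nn_integral_fst) (simp_all add: lborel_prod)
  also have "\<dots> = (\<integral>\<^sup>+x. \<integral>\<^sup>+y. indicator A (x, y) \<partial>lborel \<partial>lborel)"
    by (simp add: nn_integral_lborel_diff[where g = "\<lambda>y. indicator A (_, y)"])
  also have "\<dots> = (\<integral>\<^sup>+p. indicator A p \<partial>lborel)"
    by (subst lborel.nn_integral_fst) (simp_all add: lborel_prod)
  finally show "emeasure (distr lborel borel ?T) A = emeasure lborel A"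
    by simp
qed simp

lemma
  fixes G :: "'a::euclidean_space \<times> 'a \<Rightarrow> real"
  assumes [measurable]: "G \<in> borel_measurable borel"
  shows integral_shear: "(LINT p|lborel. G (fst p, fst p - snd p)) = (LINT p|lborel. G p)"
    and integrable_shear: "integrable lborel (\<lambda>p. G (fst p, fst p - snd p)) \<longleftrightarrow> integrable lborel G"
proof -
  have T: "(\<lambda>p::'a \<times> 'a. (fst p, fst p - snd p)) \<in> borel_measurable borel"
    by (rule measurable_pair_borel) (simp add: borel_prod[symmetric])
  show "(LINT p|lborel. G (fst p, fst p - snd p)) = (LINT p|lborel. G p)"
    using T by (subst (2) lborel_distr_shear[symmetric]) (simp add: integral_distr)
  show "integrable lborel (\<lambda>p. G (fst p, fst p - snd p)) \<longleftrightarrow> integrable lborel G"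
    using T by (subst (2) lborel_distr_shear[symmetric]) (simp add: integrable_distr_eq)
qed

lemma
  fixes a h :: "'a::euclidean_space \<Rightarrow> real"
  assumes a: "integrable lborel a" and h: "integrable lborel h" and even: "\<And>z. h (- z) = h z"
  shows integrable_convolution: "integrable lborel (\<lambda>p. a (fst p) * h (fst p - snd p))"
    and integral_convolution:
      "(LINT p|lborel. a (fst p) * h (fst p - snd p)) = (LINT x|lborel. a x) * (LINT z|lborel. h z)"
    and integrable_convolution': "integrable lborel (\<lambda>p. a (snd p) * h (fst p - snd p))"
    and integral_convolution':
      "(LINT p|lborel. a (snd p) * h (fst p - snd p)) = (LINT x|lborel. a x) * (LINT z|lborel. h z)"
proof -
  have m: "(\<lambda>p. a (fst p) * h (snd p)) \<in> borel_measurable borel"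
    using integrable_tensor[OF a h] by simp
  show 1: "integrable lborel (\<lambda>p. a (fst p) * h (fst p - snd p))"
    using integrable_shear[OF m] integrable_tensor[OF a h] by simp
  show 2: "(LINT p|lborel. a (fst p) * h (fst p - snd p)) = (LINT x|lborel. a x) * (LINT z|lborel. h z)"
    using integral_shear[OF m] integral_tensor[OF a h] by simp
  have lin: "linear (\<lambda>p::'a \<times> 'a. (snd p, fst p))" and nrm: "norm (snd p, fst p) = norm p" for p :: "'a \<times> 'a"
    by (auto simp: norm_prod_def add.commute intro!: linearI)
  \<comment> \<open>Exchanging the two entries reduces the second pair of claims to the first;
    evenness of \<open>h\<close> is what permits it.\<close>
  have eq: "a (snd p) * h (fst p - snd p) = a (fst (snd p, fst p)) * h (fst (snd p, fst p) - snd (snd p, fst p))" for p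
    using even[of "fst p - snd p"] by simp
  have m1: "(\<lambda>p. a (fst p) * h (fst p - snd p)) \<in> borel_measurable borel"
    using 1 by simp
  show "integrable lborel (\<lambda>p. a (snd p) * h (fst p - snd p))"
    unfolding eq using integrable_isometry[OF lin nrm m1] 1 by simp
  show "(LINT p|lborel. a (snd p) * h (fst p - snd p)) = (LINT x|lborel. a x) * (LINT z|lborel. h z)"
    unfolding eq using integral_isometry[OF lin nrm m1] 2 by simp
qed

subsection \<open>A quadratic bump\<close>

text \<open>A truncated paraboloid instead of a smooth cut-off: besides a Lipschitz bound, only an
  upper bound for its second difference at points of the ball is required, and the kink at the edge
  works in favour of that bound.\<close>

definition bump :: "'a::real_inner \<Rightarrow> real \<Rightarrow> 'a \<Rightarrow> real" where
  "bump x0 \<rho> x = max 0 (1 - (norm (x - x0))\<^sup>2 / \<rho>\<^sup>2)"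

lemma bump_nonneg [simp]: "bump x0 \<rho> x \<ge> 0"
  by (simp add: bump_def)

lemma bump_le_1 [simp]: "bump x0 \<rho> x \<le> 1"
  by (simp add: bump_def)

lemma bump_center [simp]: "bump x0 \<rho> x0 = 1"
  by (simp add: bump_def)

lemma bump_outside:
  assumes "\<rho> > 0" "norm (x - x0) \<ge> \<rho>"
  shows "bump x0 \<rho> x = 0"
proof -
  have "\<rho>\<^sup>2 \<le> (norm (x - x0))\<^sup>2" using assms by (intro power_mono) auto
  then show ?thesis using assms by (simp add: bump_def)
qed

lemma continuous_on_bump: "continuous_on A (bump x0 \<rho>)"
  unfolding bump_def[abs_def] divide_inverse by (intro continuous_intros)

lemma bump_measurable [measurable]: "bump (x0::'a::euclidean_space) \<rho> \<in> borel_measurable borel"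
  by (intro borel_measurable_continuous_onI continuous_on_bump)

lemma bump_lipschitz:
  assumes "\<rho> > 0"
  shows "\<bar>bump x0 \<rho> x - bump x0 \<rho> y\<bar> \<le> 2 / \<rho> * norm (x - y)"
proof -
  \<comment> \<open>The distance to the centre in units of \<rho>, capped at 1. The bump is
    \<open>1 - (m x)^2\<close>, and \<open>m x + m y \<le> 2\<close> gives the factor 2.\<close>
  define m where "m x = min (norm (x - x0) / \<rho>) 1" for x
  have m: "0 \<le> m x" "m x \<le> 1" for x using assms by (auto simp: m_def)
  have b: "bump x0 \<rho> x = 1 - (m x)\<^sup>2" for x
  proof (cases "norm (x - x0) \<le> \<rho>")
    case True
    then have "(norm (x - x0))\<^sup>2 \<le> \<rho>\<^sup>2" by (intro power_mono) auto
    then show ?thesis using True assms by (simp add: bump_def m_def power_divide)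
  next
    case False
    then show ?thesis using assms bump_outside[of \<rho> x x0] by (simp add: m_def min_def)
  qed
  have "\<bar>norm (x - x0) - norm (y - x0)\<bar> \<le> norm (x - y)"
    using norm_triangle_ineq3[of "x - x0" "y - x0"] by simp
  then have "\<bar>norm (x - x0) / \<rho> - norm (y - x0) / \<rho>\<bar> \<le> norm (x - y) / \<rho>"
    using assms by (simp add: diff_divide_distrib[symmetric] divide_right_mono)
  then have d: "\<bar>m x - m y\<bar> \<le> norm (x - y) / \<rho>"
    unfolding m_def by linarith
  have "\<bar>bump x0 \<rho> x - bump x0 \<rho> y\<bar> = \<bar>m x - m y\<bar> * \<bar>m x + m y\<bar>"
    unfolding b abs_mult[symmetric] by (simp add: power2_eq_square algebra_simps abs_minus_commute)
  also have "\<dots> \<le> (norm (x - y) / \<rho>) * 2"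
    using d m[of x] m[of y] by (intro mult_mono) auto
  finally show ?thesis by (simp add: mult.commute)
qed

text \<open>The parallelogram identity gives the second difference of the untruncated paraboloid,
  and truncation at \<open>x + z\<close> and \<open>x - z\<close> only raises the subtracted values.
  For large \<open>z\<close> the trivial bound 2 is better.\<close>

lemma bump_second_difference:
  assumes "\<rho> > 0" "norm (x - x0) < \<rho>"
  shows "2 * bump x0 \<rho> x - bump x0 \<rho> (x + z) - bump x0 \<rho> (x - z) \<le> 2 * max 1 (1 / \<rho>\<^sup>2) * min 1 ((norm z)\<^sup>2)"
proof -
  define a where "a = x - x0"
  have "norm a ^ 2 \<le> \<rho> ^ 2" using assms by (intro power_mono) (auto simp: a_def)
  then have bx: "bump x0 \<rho> x = 1 - (norm a)\<^sup>2 / \<rho>\<^sup>2" using assms by (simp add: bump_def a_def)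
  have "bump x0 \<rho> (x + z) \<ge> 1 - (norm (a + z))\<^sup>2 / \<rho>\<^sup>2" "bump x0 \<rho> (x - z) \<ge> 1 - (norm (a - z))\<^sup>2 / \<rho>\<^sup>2"
    by (auto simp: bump_def a_def algebra_simps)
  moreover have "(norm (a + z))\<^sup>2 + (norm (a - z))\<^sup>2 = 2 * (norm a)\<^sup>2 + 2 * (norm z)\<^sup>2"
    by (simp add: power2_norm_eq_inner inner_simps inner_commute)
  then have "(norm (a + z))\<^sup>2 / \<rho>\<^sup>2 + (norm (a - z))\<^sup>2 / \<rho>\<^sup>2 = 2 * ((norm a)\<^sup>2 / \<rho>\<^sup>2) + 2 * ((norm z)\<^sup>2 / \<rho>\<^sup>2)"
    by (simp add: add_divide_distrib[symmetric])
  moreover have "2 * (1 - X) - B1 - B2 \<le> 2 * Z"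
    if "1 - P \<le> B1" "1 - Q \<le> B2" "P + Q = 2 * X + 2 * Z" for P Q X Z B1 B2 :: real
    using that by (simp add: algebra_simps)
  ultimately have 1: "2 * bump x0 \<rho> x - bump x0 \<rho> (x + z) - bump x0 \<rho> (x - z) \<le> 2 * ((norm z)\<^sup>2 / \<rho>\<^sup>2)"
    unfolding bx by metis
  have 2: "2 * bump x0 \<rho> x - bump x0 \<rho> (x + z) - bump x0 \<rho> (x - z) \<le> 2"
    using bump_le_1[of x0 \<rho> x] bump_nonneg[of x0 \<rho> "x + z"] bump_nonneg[of x0 \<rho> "x - z"] by linarith
  have "min 1 ((norm z)\<^sup>2 / \<rho>\<^sup>2) \<le> max 1 (1 / \<rho>\<^sup>2) * min 1 ((norm z)\<^sup>2)"
  proof (cases "(norm z)\<^sup>2 \<le> 1")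
    case True
    have "(1 / \<rho>\<^sup>2) * (norm z)\<^sup>2 \<le> max 1 (1 / \<rho>\<^sup>2) * (norm z)\<^sup>2" by (intro mult_right_mono) auto
    then show ?thesis using True by simp
  next
    case False
    then show ?thesis by simp
  qed
  then show ?thesis using 1 2 by linarith
qed

section \<open>Energy estimates for the bump\<close>

context levy_kernel
begin

definition levy_mass :: real where
  "levy_mass = (LINT z|lborel. min 1 ((norm z)\<^sup>2) * kr z)"

lemma kr_even: "kr (- z) = kr z"
  by (rule kr_norm_cong) simp

text \<open>The integrable part of the kernel: no other values matter between a point at depth
  \<open>d\<close> in the half-space and a point across the hyperplane.\<close>

definition kr_off :: "real \<Rightarrow> real^'n \<Rightarrow> real" where
  "kr_off d z = (if norm z \<ge> d then kr z else 0)"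

lemma kr_off_nonneg [simp]: "kr_off d z \<ge> 0"
  by (simp add: kr_off_def)

lemma kr_off_even: "kr_off d (- z) = kr_off d z"
  by (simp add: kr_off_def kr_even)

lemma integrable_kr_off:
  assumes "d > 0"
  shows "integrable lborel (kr_off d)"
proof (rule Bochner_Integration.integrable_bound)
  define C where "C = 1 / min 1 (d\<^sup>2)"
  show "integrable lborel (\<lambda>z. C * (min 1 ((norm z)\<^sup>2) * kr z))"
    using integrable_levy by simp
  show "kr_off d \<in> borel_measurable lborel"
    unfolding kr_off_def[abs_def] by measurable
  show "AE z in lborel. norm (kr_off d z) \<le> norm (C * (min 1 ((norm z)\<^sup>2) * kr z))"
  proof (intro AE_I2)
    fix z :: "real^'n"
    have "1 * kr z \<le> (C * min 1 ((norm z)\<^sup>2)) * kr z" if "norm z \<ge> d"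
    proof (intro mult_right_mono)
      have "d\<^sup>2 \<le> (norm z)\<^sup>2" using that assms by (intro power_mono) auto
      then have "min 1 (d\<^sup>2) \<le> min 1 ((norm z)\<^sup>2)" by simp
      then show "1 \<le> C * min 1 ((norm z)\<^sup>2)" using assms by (simp add: C_def field_simps)
    qed simp
    moreover have "C \<ge> 0" by (simp add: C_def)
    ultimately show "norm (kr_off d z) \<le> norm (C * (min 1 ((norm z)\<^sup>2) * kr z))"
      by (simp add: kr_off_def abs_mult mult.assoc)
  qed
qed

lemma energy_bump:
  assumes "\<rho> > 0"
  shows "energy k (bump x0 \<rho>) < top"
proof -
  \<comment> \<open>\<open>4 / \<rho>^2\<close> is the squared Lipschitz constant of the bump, for
    close points; the 1 bounds the squared increment for distant ones.\<close>
  define C where "C = max 1 (4 / \<rho>\<^sup>2)"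
  define b :: "real^'n \<Rightarrow> real" where "b = indicator (ball x0 \<rho>)"
  have b: "integrable lborel b"
    unfolding b_def by (intro integrable_real_indicator emeasure_bounded_finite bounded_ball) simp
  have h: "integrable lborel (\<lambda>z. C * (min 1 ((norm z)\<^sup>2) * kr z))"
    using integrable_levy by simp
  have "integrable lborel (gam (bump x0 \<rho>) (bump x0 \<rho>))"
  proof (rule Bochner_Integration.integrable_bound)
    let ?g = "\<lambda>p. b (fst p) * (C * (min 1 ((norm (fst p - snd p))\<^sup>2) * kr (fst p - snd p))) +
        b (snd p) * (C * (min 1 ((norm (fst p - snd p))\<^sup>2) * kr (fst p - snd p)))"
    show "integrable lborel ?g"
      by (intro Bochner_Integration.integrable_add integrable_convolution[OF b h] integrable_convolution'[OF b h])
         (simp_all add: kr_even)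
    show "AE p in lborel. norm (gam (bump x0 \<rho>) (bump x0 \<rho>) p) \<le> norm (?g p)"
    proof (intro AE_I2)
      fix p :: "(real^'n) \<times> (real^'n)"
      obtain x y where p: "p = (x, y)" by fastforce
      define D where "D = bump x0 \<rho> x - bump x0 \<rho> y"
      have C1: "C \<ge> 1" by (simp add: C_def)
      have "D * D \<le> (b x + b y) * (C * min 1 ((norm (x - y))\<^sup>2))"
      proof (cases "x \<in> ball x0 \<rho> \<or> y \<in> ball x0 \<rho>")
        case True
        have "\<bar>D\<bar> \<le> 1"
          using bump_le_1[of x0 \<rho> x] bump_le_1[of x0 \<rho> y] bump_nonneg[of x0 \<rho> x] bump_nonneg[of x0 \<rho> y]
          unfolding D_def by linarith
        then have D1: "\<bar>D\<bar>\<^sup>2 \<le> 1\<^sup>2" by (intro power_mono) auto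
        have "\<bar>D\<bar>\<^sup>2 \<le> (2 / \<rho> * norm (x - y))\<^sup>2"
          unfolding D_def using bump_lipschitz[OF assms] by (intro power_mono) auto
        then have D2: "D * D \<le> 4 / \<rho>\<^sup>2 * (norm (x - y))\<^sup>2"
          by (simp add: power2_eq_square)
        also have "\<dots> \<le> C * (norm (x - y))\<^sup>2" by (intro mult_right_mono) (auto simp: C_def)
        finally have "D * D \<le> C * min 1 ((norm (x - y))\<^sup>2)"
          using D1 C1 by (auto simp: min_def power2_eq_square)
        also have "\<dots> = 1 * (C * min 1 ((norm (x - y))\<^sup>2))" by simp
        also have "\<dots> \<le> (b x + b y) * (C * min 1 ((norm (x - y))\<^sup>2))"
          using True C1 by (intro mult_right_mono) (auto simp: b_def indicator_def)
        finally show ?thesis .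
      next
        case False
        then have "D = 0" using bump_outside[OF assms, of x x0] bump_outside[OF assms, of y x0]
          by (auto simp: D_def dist_norm norm_minus_commute)
        then show ?thesis using C1 by (simp add: b_def)
      qed
      then have "D * D * kr (x - y) \<le> (b x + b y) * (C * min 1 ((norm (x - y))\<^sup>2)) * kr (x - y)"
        by (rule mult_right_mono) simp
      then have "gam (bump x0 \<rho>) (bump x0 \<rho>) p \<le> ?g p"
        by (simp add: gam_def p D_def algebra_simps)
      then show "norm (gam (bump x0 \<rho>) (bump x0 \<rho>) p) \<le> norm (?g p)"
        using gam_self_nonneg[of "bump x0 \<rho>" p] by simp
    qed
  qed simp
  then show ?thesis by (simp add: energy_finite_iff)
qed

text \<open>A weak substitute for a pointwise upper bound of the operator on the bump. For each
  fixed shift \<open>z\<close> the integral over the other variable produces a second difference, of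
  size \<open>min 1 (norm z)^2\<close> and thus integrable against the kernel. An upper bound
  suffices because \<phi> is nonnegative and lives where the second difference is
  controlled.\<close>

lemma integral_gam_bump_le:
  assumes \<rho>: "\<rho> > 0" and [measurable]: "\<phi> \<in> borel_measurable borel"
    and int: "integrable lborel \<phi>" and nonneg: "\<And>x. \<phi> x \<ge> 0"
    and supp: "\<And>x. norm (x - x0) \<ge> \<rho> \<Longrightarrow> \<phi> x = 0"
    and gi: "integrable lborel (gam (bump x0 \<rho>) \<phi>)"
  shows "(LINT p|lborel. gam (bump x0 \<rho>) \<phi> p) \<le> 2 * max 1 (1 / \<rho>\<^sup>2) * levy_mass * (LINT x|lborel. \<phi> x)"
proof -
  let ?e = "bump x0 \<rho>"
  define C where "C = 2 * max 1 (1 / \<rho>\<^sup>2) * (LINT x|lborel. \<phi> x)"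
  define g where "g y z = gam ?e \<phi> (y, y - z)" for y z
  have gm: "gam ?e \<phi> \<in> borel_measurable borel" by measurable
  have g: "case_prod g = (\<lambda>p. gam ?e \<phi> (fst p, fst p - snd p))"
    by (auto simp: g_def)
  have gi': "integrable (lborel \<Otimes>\<^sub>M lborel) (case_prod g)"
    using gi integrable_shear[OF gm] by (simp add: lborel_prod g)
  have e1: "\<bar>?e x * c\<bar> \<le> \<bar>c\<bar>" for x c
    using mult_right_mono[OF bump_le_1[of x0 \<rho> x], of "\<bar>c\<bar>"] by (simp add: abs_mult)
  have ie: "integrable lborel (\<lambda>y. ?e (h y) * \<phi> y)" if [measurable]: "h \<in> borel_measurable borel" for h
    by (rule Bochner_Integration.integrable_bound[OF int]) (auto simp: e1)
  have inner: "(LINT y|lborel. g y z) \<le> C * (min 1 ((norm z)\<^sup>2) * kr z)" for z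
  proof -
    have i1: "integrable lborel (\<lambda>y. ?e y * \<phi> y)" "integrable lborel (\<lambda>y. ?e (y - z) * \<phi> y)"
      "integrable lborel (\<lambda>y. ?e (y + z) * \<phi> y)"
      by (rule ie, simp)+
    have s: "(LINT y|lborel. h (- z + y)) = (LINT y|lborel. h y)" "integrable lborel (\<lambda>y. h (- z + y)) \<longleftrightarrow> integrable lborel h"
      if "h \<in> borel_measurable borel" for h :: "real^'n \<Rightarrow> real"
      using integral_lborel_plus[OF that] integrable_lborel_plus[OF that] by blast+
    have m: "(\<lambda>y. (?e (y + z) - ?e y) * \<phi> y) \<in> borel_measurable borel" by measurable
    have i2: "integrable lborel (\<lambda>y. (?e (y + z) - ?e y) * \<phi> y)"
      unfolding left_diff_distrib using i1 by simp
    have i3: "integrable lborel (\<lambda>y. (?e y - ?e (y - z)) * \<phi> y)"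
      unfolding left_diff_distrib using i1 by simp
    \<comment> \<open>Translation by \<open>z\<close> brings \<phi> back to the point
      \<open>y\<close>, so that two first differences of the bump combine into a second
      difference.\<close>
    have i4: "integrable lborel (\<lambda>y. (?e y - ?e (y - z)) * \<phi> (y - z))"
      "(LINT y|lborel. (?e y - ?e (y - z)) * \<phi> (y - z)) = (LINT y|lborel. (?e (y + z) - ?e y) * \<phi> y)"
      using s[OF m] i2 by (simp_all add: algebra_simps)
    have "(LINT y|lborel. g y z) = (LINT y|lborel. ((?e y - ?e (y - z)) * \<phi> y - (?e y - ?e (y - z)) * \<phi> (y - z)) * kr z)"
      by (simp add: g_def gam_def algebra_simps)
    also have "\<dots> = (LINT y|lborel. (?e y - ?e (y - z)) * \<phi> y - (?e y - ?e (y - z)) * \<phi> (y - z)) * kr z"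
      by simp
    also have "(LINT y|lborel. (?e y - ?e (y - z)) * \<phi> y - (?e y - ?e (y - z)) * \<phi> (y - z)) =
        (LINT y|lborel. (?e y - ?e (y - z)) * \<phi> y) - (LINT y|lborel. (?e (y + z) - ?e y) * \<phi> y)"
      using i3 i4 by simp
    also have "\<dots> = (LINT y|lborel. (?e y - ?e (y - z)) * \<phi> y - (?e (y + z) - ?e y) * \<phi> y)"
      using i3 i2 by simp
    also have "\<dots> \<le> (LINT y|lborel. 2 * max 1 (1 / \<rho>\<^sup>2) * min 1 ((norm z)\<^sup>2) * \<phi> y)"
    proof (rule integral_mono)
      show "integrable lborel (\<lambda>y. 2 * max 1 (1 / \<rho>\<^sup>2) * min 1 ((norm z)\<^sup>2) * \<phi> y)" using int by simp
      show "integrable lborel (\<lambda>y. (?e y - ?e (y - z)) * \<phi> y - (?e (y + z) - ?e y) * \<phi> y)"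
        using i2 i3 by simp
      fix y
      show "(?e y - ?e (y - z)) * \<phi> y - (?e (y + z) - ?e y) * \<phi> y \<le> 2 * max 1 (1 / \<rho>\<^sup>2) * min 1 ((norm z)\<^sup>2) * \<phi> y"
      proof (cases "norm (y - x0) < \<rho>")
        case True
        have "(2 * ?e y - ?e (y + z) - ?e (y - z)) * \<phi> y \<le> (2 * max 1 (1 / \<rho>\<^sup>2) * min 1 ((norm z)\<^sup>2)) * \<phi> y"
          using nonneg by (intro mult_right_mono bump_second_difference[OF \<rho> True])
        then show ?thesis by (simp only: algebra_simps)
      next
        case False
        then show ?thesis using supp by simp
      qed
    qed
    finally have "(LINT y|lborel. g y z) \<le> (LINT y|lborel. 2 * max 1 (1 / \<rho>\<^sup>2) * min 1 ((norm z)\<^sup>2) * \<phi> y) * kr z"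
      by (simp add: mult_right_mono)
    then show ?thesis by (simp add: C_def ac_simps)
  qed
  have "(LINT p|lborel. gam ?e \<phi> p) = (LINT p|lborel. case_prod g p)"
    using integral_shear[OF gm] by (simp add: g)
  also have "\<dots> = (LINT z|lborel. LINT y|lborel. g y z)"
    using lborel_pair.integral_snd[OF gi'] by (simp add: lborel_prod)
  also have "\<dots> \<le> (LINT z|lborel. C * (min 1 ((norm z)\<^sup>2) * kr z))"
    using integrable_levy by (intro integral_mono inner lborel_pair.integrable_snd[OF gi']) simp
  also have "\<dots> = C * levy_mass" by (simp add: levy_mass_def)
  finally show ?thesis by (simp add: C_def mult.assoc mult.commute[of levy_mass])
qed

end

subsection \<open>A strong maximum principle for antisymmetric functions\<close>

text \<open>Here \<open>W, e, f\<close> and \<open>W', e', f'\<close> stand for the values of \<open>w\<close>, the bump and the test function at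
  two points of the half-space, \<open>j\<close> and \<open>s\<close> for the kernel before and after reflecting one of them.\<close>

lemma barrier_pointwise:
  fixes W W' e e' f f' j s t c q q' :: real
  assumes W: "W \<ge> 0" "W' \<ge> 0" and e: "0 \<le> e" "e \<le> 1" "0 \<le> e'" "e' \<le> 1" and t: "t > 0"
    and f: "f = max 0 (t * e - W)" "f' = max 0 (t * e' - W')"
    and s: "s \<ge> 0" and js: "s \<le> j \<or> (W = W' \<and> e = e')"
    and q: "q = 0 \<or> q = 1" "q' = 0 \<or> q' = 1" "q \<noteq> 0 \<Longrightarrow> e = 0" "q' \<noteq> 0 \<Longrightarrow> e' = 0"
    and c: "f > 0 \<Longrightarrow> q' \<noteq> 0 \<Longrightarrow> c \<le> W' * (j - s)" "f' > 0 \<Longrightarrow> q \<noteq> 0 \<Longrightarrow> c \<le> W * (j - s)"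
  shows "(W - W') * (f - f') * j + (W + W') * (f + f') * s \<le>
    t * ((e - e') * (f - f') * j) + t * (e * f + e' * f') * s + 3 * t * (f + f') * s - c * (f * q' + f' * q)"
proof -
  \<comment> \<open>In \<open>j = a + s\<close> the part with weight \<open>a\<close> carries the
    sign and the gain \<open>c\<close>; the part with weight \<open>s\<close> is an error of order
    \<open>t\<close>.\<close>
  define a where "a = j - s"
  have f0: "f \<ge> 0" "f' \<ge> 0" by (auto simp: f)
  have qf: "q \<noteq> 0 \<Longrightarrow> f = 0" "q' \<noteq> 0 \<Longrightarrow> f' = 0" using q W by (auto simp: f)
  have main: "(W - W') * (f - f') * a + c * (f * q' + f' * q) \<le> t * ((e - e') * (f - f') * a)"
  proof (cases "a \<ge> 0")
    case True
    \<comment> \<open>Exactly one test value is positive. If the other point lies in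
      \<open>Q\<close> (\<open>r = 1\<close>), the bump vanishes there and the value
      \<open>V'\<close> yields the gain; otherwise \<open>V' \<ge> t * d'\<close> is enough.\<close>
    have one: "(V - V') * g * a + c * (g * r) \<le> t * ((d - d') * g * a)"
      if g: "g = t * d - V" "g > 0" and V': "V' \<ge> t * d'" and r: "r = 0 \<or> r = 1" "r \<noteq> 0 \<Longrightarrow> d' = 0"
        "r \<noteq> 0 \<Longrightarrow> c \<le> V' * a" for V V' d d' g r
    proof -
      have "(V - V') * g * a + r * (V' * a) * g \<le> t * ((d - d') * g * a)"
      proof (cases "r = 0")
        case True
        have "(V - V') * (g * a) \<le> (t * (d - d')) * (g * a)"
          using g V' \<open>a \<ge> 0\<close> by (intro mult_right_mono) (auto simp: algebra_simps)
        then show ?thesis using True by (simp add: algebra_simps)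
      next
        case False
        then have "r = 1" "d' = 0" using r by auto
        moreover have "V * (g * a) \<le> (t * d) * (g * a)"
          using g \<open>a \<ge> 0\<close> by (intro mult_right_mono) auto
        ultimately show ?thesis by (simp add: algebra_simps)
      qed
      moreover have "c * (g * r) \<le> r * (V' * a) * g"
        using r g by (cases "r = 0") (auto simp: mult.commute)
      ultimately show ?thesis by linarith
    qed
    consider "f > 0" "f' > 0" | "f > 0" "f' = 0" | "f = 0" "f' > 0" | "f = 0" "f' = 0"
      using f0 by linarith
    then show ?thesis
    proof cases
      case 1
      then have "q = 0" "q' = 0" using qf by auto
      have "W - W' = t * (e - e') - (f - f')" using 1 f by (auto simp: max_def algebra_simps split: if_splits)
      then have "(W - W') * (f - f') * a = (t * (e - e') - (f - f')) * (f - f') * a" by simp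
      also have "\<dots> = t * ((e - e') * (f - f') * a) - (f - f')\<^sup>2 * a"
        by (simp add: power2_eq_square algebra_simps)
      finally have "(W - W') * (f - f') * a = t * ((e - e') * (f - f') * a) - (f - f')\<^sup>2 * a" .
      then show ?thesis using \<open>q = 0\<close> \<open>q' = 0\<close> True by simp
    next
      case 2
      then have "q = 0" using qf by auto
      have "(W - W') * f * a + c * (f * q') \<le> t * ((e - e') * f * a)"
        using 2 f q c(1) W by (intro one) (auto simp: a_def max_def split: if_splits)
      then show ?thesis using 2 \<open>q = 0\<close> by simp
    next
      case 3
      then have "q' = 0" using qf by auto
      have "(W' - W) * f' * a + c * (f' * q) \<le> t * ((e' - e) * f' * a)"
        using 3 f q c(2) W by (intro one) (auto simp: a_def max_def split: if_splits)
      then show ?thesis using 3 \<open>q' = 0\<close> by (simp add: algebra_simps)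
    next
      case 4
      then show ?thesis by simp
    qed
  next
    case False
    \<comment> \<open>In the application this happens only for coinciding points, when
      \<open>kr 0\<close> is the default 0.\<close>
    then have "W = W'" "e = e'" using js by (auto simp: a_def)
    then have "f = f'" by (simp add: f)
    moreover have "f * q' = 0" "f' * q = 0" using \<open>f = f'\<close> qf by auto
    ultimately show ?thesis by auto
  qed
  \<comment> \<open>Where the test function is positive, \<open>W\<close> is at most
    \<open>t\<close>. This accounts for \<open>2 * t\<close> of the constant \<open>3 * t\<close>;
    completing the bump terms with weight \<open>s\<close> costs the remaining
    \<open>t\<close>.\<close>
  have Wf: "V * g \<le> t * g" if "g = max 0 (t * d - V)" "d \<le> 1" for V g d
  proof (cases "g > 0")
    case True
    then have "V \<le> t * d" using that by (auto simp: max_def split: if_splits)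
    also have "t * d \<le> t * 1" using t that by (intro mult_left_mono) auto
    finally show ?thesis using True by (intro mult_right_mono) auto
  next
    case False
    then show ?thesis using that by auto
  qed
  have W2: "2 * (W * f + W' * f') * s \<le> 2 * (t * f + t * f') * s"
    using Wf[OF f(1) e(2)] Wf[OF f(2) e(4)] s by (intro mult_right_mono) auto
  have ef: "e * f' \<le> f'" "e' * f \<le> f"
    using mult_right_mono[OF e(2) f0(2)] mult_right_mono[OF e(4) f0(1)] by auto
  have "- (f + f') \<le> (e - e') * (f - f') + (e * f + e' * f')"
    using ef mult_nonneg_nonneg[OF e(1) f0(1)] mult_nonneg_nonneg[OF e(3) f0(2)] by (simp add: algebra_simps)
  then have "- (f + f') * (t * s) \<le> ((e - e') * (f - f') + (e * f + e' * f')) * (t * s)"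
    using t s by (intro mult_right_mono) auto
  then have e2: "0 \<le> t * ((e - e') * (f - f') * s) + t * (e * f + e' * f') * s + t * (f + f') * s"
    by (simp add: algebra_simps)
  have j: "j = a + s" by (simp add: a_def)
  have "(W - W') * (f - f') * j + (W + W') * (f + f') * s = (W - W') * (f - f') * a + 2 * (W * f + W' * f') * s"
    unfolding j by (simp add: algebra_simps)
  moreover have "t * ((e - e') * (f - f') * j) = t * ((e - e') * (f - f') * a) + t * ((e - e') * (f - f') * s)"
    unfolding j by (simp add: algebra_simps)
  moreover have "2 * (t * f + t * f') * s = 2 * (t * (f + f') * s)" "3 * t * (f + f') * s = 3 * (t * (f + f') * s)"
    by (simp_all add: algebra_simps)
  ultimately show ?thesis using main W2 e2 by linarith
qed

lemma integrable_bounded_support: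
  fixes g :: "'a::euclidean_space \<Rightarrow> real"
  assumes [measurable]: "g \<in> borel_measurable borel" and "bounded S"
    and L: "\<And>x. x \<in> S \<Longrightarrow> \<bar>g x\<bar> \<le> L" and S: "\<And>x. x \<notin> S \<Longrightarrow> g x = 0"
  shows "integrable lborel g"
proof -
  obtain R where R: "S \<subseteq> ball 0 R" using bounded_subset_ballD[OF \<open>bounded S\<close>, of 0] by auto
  show ?thesis
  proof (rule Bochner_Integration.integrable_bound)
    show "integrable lborel (\<lambda>x. L * indicator (ball 0 R) x :: real)"
      by (intro integrable_mult_right integrable_real_indicator emeasure_bounded_finite bounded_ball) simp
    show "AE x in lborel. norm (g x) \<le> norm (L * indicator (ball 0 R) x :: real)"
    proof (intro AE_I2)
      fix x
      show "norm (g x) \<le> norm (L * indicator (ball 0 R) x :: real)"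
      proof (cases "x \<in> S")
        case True
        then have "x \<in> ball 0 R" using R by blast
        then show ?thesis using L[OF True] by simp
      next
        case False
        then show ?thesis using S by simp
      qed
    qed
  qed simp
qed

lemma continuous_bounded_on_bounded:
  fixes g :: "'a::euclidean_space \<Rightarrow> real"
  assumes "continuous_on UNIV g" "bounded S"
  shows "\<exists>M\<ge>0. \<forall>x\<in>S. \<bar>g x\<bar> \<le> M"
proof -
  have "bounded (g ` closure S)"
    using assms by (intro compact_imp_bounded compact_continuous_image continuous_on_subset[OF assms(1)]) auto
  then obtain a where a: "\<And>x. x \<in> closure S \<Longrightarrow> \<bar>g x\<bar> \<le> a"
    unfolding bounded_iff by (metis imageI real_norm_def)
  show ?thesis
  proof (intro exI[of _ "max 0 a"] conjI ballI)
    fix x assume "x \<in> S"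
    then have "\<bar>g x\<bar> \<le> a" using a closure_subset by blast
    then show "\<bar>g x\<bar> \<le> max 0 a" by simp
  qed simp
qed

lemma open_null_empty:
  fixes U :: "'a::euclidean_space set"
  assumes "open U" and "AE x in lborel. x \<notin> U"
  shows "U = {}"
proof -
  have "U \<in> null_sets lborel"
    using assms AE_iff_null_sets[of U lborel] by auto
  then have "negligible U"
    by (simp add: negligible_iff_null_sets null_sets_completionI)
  then show ?thesis using assms open_not_negligible by blast
qed

section \<open>Barriers and the local strong maximum principle\<close>

context levy_kernel
begin

text \<open>The cost \<open>C * t\<close> comes from the bump and from pairs across the hyperplane,
  while the gain \<open>c * measure lborel Q\<close> does not shrink with \<open>t\<close>;
  \<open>C\<close> is independent of \<open>t\<close>. The absolute value equals \<open>w\<close> on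
  the half-space, and the ball keeps the test function away from the other side.\<close>

lemma barrier_estimate:
  fixes w :: "real^'n \<Rightarrow> real"
  assumes cw: "continuous_on UNIV w" and ew: "energy k w < top"
    and anti: "\<And>x. w (mirror z x) = - w x" and pos: "\<And>x. x \<bullet> z \<ge> 0 \<Longrightarrow> w x \<ge> 0"
    and z: "z \<noteq> 0" and \<rho>: "\<rho> > 0" and d: "d > 0"
    and ball: "\<And>x. norm (x - x0) < \<rho> \<Longrightarrow> x \<bullet> z \<ge> d * norm z"
    and Q [measurable]: "Q \<in> sets borel" and Qfin: "emeasure lborel Q < top"
    and Qz: "\<And>y. y \<in> Q \<Longrightarrow> y \<bullet> z > 0" and Qb: "\<And>y. y \<in> Q \<Longrightarrow> norm (y - x0) \<ge> \<rho>"
    and c: "\<And>x y. norm (x - x0) < \<rho> \<Longrightarrow> y \<in> Q \<Longrightarrow> c \<le> w y * (kr (x - y) - kr (x - mirror z y))"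
  obtains C where "\<And>t. 0 < t \<Longrightarrow> t \<le> 1 \<Longrightarrow>
      energy k (\<lambda>x. max 0 (t * bump x0 \<rho> x - \<bar>w x\<bar>)) < top \<and>
      energy_form k w (\<lambda>x. max 0 (t * bump x0 \<rho> x - \<bar>w x\<bar>)) \<le>
        (C * t - c * measure lborel Q) * (LINT x|lborel. max 0 (t * bump x0 \<rho> x - \<bar>w x\<bar>))"
proof
  let ?e = "bump x0 \<rho>"
  define K where "K = (LINT y|lborel. kr_off d y)"
  define C where "C = max 1 (1 / \<rho>\<^sup>2) * levy_mass + 3 * K"
  fix t :: real assume t: "0 < t" "t \<le> 1"
  define \<phi> where "\<phi> x = max 0 (t * ?e x - \<bar>w x\<bar>)" for x
  have [measurable]: "w \<in> borel_measurable borel"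
    using cw by (rule borel_measurable_continuous_onI)
  have c\<phi>: "continuous_on UNIV \<phi>"
    unfolding \<phi>_def[abs_def] by (intro continuous_intros continuous_on_bump cw)
  then have [measurable]: "\<phi> \<in> borel_measurable borel"
    by (rule borel_measurable_continuous_onI)
  have \<phi>0: "\<phi> x \<ge> 0" for x by (simp add: \<phi>_def)
  have \<phi>1: "\<phi> x \<le> 1" for x
    using mult_mono[of t 1 "?e x" 1] t by (auto simp: \<phi>_def)
  have \<phi>s: "\<phi> x = 0" if "norm (x - x0) \<ge> \<rho>" for x
    using bump_outside[OF \<rho> that] by (simp add: \<phi>_def)
  have neg: "norm (x - x0) \<ge> \<rho>" if "x \<bullet> z \<le> 0" for x
    using ball[of x] that d z by (meson dual_order.trans linorder_not_less mult_pos_pos zero_less_norm_iff)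
  have \<phi>int: "integrable lborel \<phi>"
  proof (rule Bochner_Integration.integrable_bound)
    show "integrable lborel (indicator (ball x0 \<rho>) :: real^'n \<Rightarrow> real)"
      by (intro integrable_real_indicator emeasure_bounded_finite bounded_ball) simp
    show "AE x in lborel. norm (\<phi> x) \<le> norm (indicator (ball x0 \<rho>) x :: real)"
      using \<phi>0 \<phi>1 \<phi>s by (intro AE_I2) (auto simp: indicator_def dist_norm norm_minus_commute not_less)
  qed simp
  have e\<phi>: "energy k \<phi> < top"
  proof -
    have te: "energy k (\<lambda>x. t * ?e x) < top"
      using energy_dominated[of ?e "\<lambda>x. 0" "\<lambda>x. t * ?e x"] energy_bump[OF \<rho>, of x0] t
      by (simp add: energy_finite_iff gam_def[abs_def] right_diff_distrib[symmetric] abs_mult mult_left_le_one_le)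
    show ?thesis
    proof (rule energy_dominated[of "\<lambda>x. t * ?e x" w \<phi>, unfolded infinity_ennreal_def, OF _ _ _ te ew])
      show "\<bar>\<phi> x - \<phi> y\<bar> \<le> \<bar>t * ?e x - t * ?e y\<bar> + \<bar>w x - w y\<bar>" for x y
        unfolding \<phi>_def by linarith
    qed simp_all
  qed
  have ge\<phi>: "integrable lborel (gam ?e \<phi>)"
    using integrable_gam energy_bump[OF \<rho>] e\<phi> by simp
  have gw\<phi>: "integrable lborel (gam w \<phi>)"
    using integrable_gam ew e\<phi> by simp
  have ioff: "integrable lborel (kr_off d)" using integrable_kr_off[OF d] .
  have iQ: "integrable lborel (indicator Q :: _ \<Rightarrow> real)"
    using Qfin by (intro integrable_real_indicator) auto
  note conv = integrable_convolution[OF \<phi>int ioff kr_off_even] integrable_convolution'[OF \<phi>int ioff kr_off_even]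
    integrable_tensor[OF \<phi>int iQ] integrable_tensor[OF iQ \<phi>int]
  note conv' = integral_convolution[OF \<phi>int ioff kr_off_even] integral_convolution'[OF \<phi>int ioff kr_off_even]
    integral_tensor[OF \<phi>int iQ] integral_tensor[OF iQ \<phi>int]
  \<comment> \<open>An integrable majorant after symmetrisation. Its three groups are the bump
    energy, the error from reflected pairs and the gain from \<open>Q\<close>; unlike the raw
    kernel, \<open>kr_off\<close> can be integrated against \<phi>.\<close>
  define B where "B p = t * gam ?e \<phi> p
      + (3 * t) * (\<phi> (fst p) * kr_off d (fst p - snd p) + \<phi> (snd p) * kr_off d (fst p - snd p))
      - c * (\<phi> (fst p) * indicator Q (snd p) + indicator Q (fst p) * \<phi> (snd p))" for p
  have iB: "integrable lborel B"
    unfolding B_def[abs_def]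
    by (intro Bochner_Integration.integrable_add Bochner_Integration.integrable_diff integrable_mult_right ge\<phi> conv)
  have "(LINT p|lborel. gam w \<phi> p) \<le> (LINT p|lborel. B p)"
  proof (rule integral_mirror_le[OF gw\<phi> iB, of z])
    fix x y :: "real^'n" assume xy: "x \<bullet> z \<ge> 0" "y \<bullet> z \<ge> 0"
    let ?sx = "mirror z x" and ?sy = "mirror z y"
    have sz: "?sx \<bullet> z \<le> 0" "?sy \<bullet> z \<le> 0" using xy by (simp_all add: inner_mirror_normal)
    have s0: "\<phi> ?sx = 0" "\<phi> ?sy = 0" "?e ?sx = 0" "?e ?sy = 0"
      using sz neg \<phi>s bump_outside[OF \<rho>] by auto
    have Q0: "indicator Q ?sx = (0::real)" "indicator Q ?sy = (0::real)"
      using sz Qz[of ?sx] Qz[of ?sy] by (auto simp: indicator_def)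
    define j where "j = kr (x - y)"
    define s where "s = kr (x - ?sy)"
    have ks: "kr (?sx - y) = s"
      unfolding s_def by (rule kr_norm_cong[OF norm_diff_mirror])
    have off: "\<phi> x * kr_off d (x - ?sy) = \<phi> x * s" "\<phi> y * kr_off d (?sx - y) = \<phi> y * s"
    proof -
      \<comment> \<open>The first point has depth \<open>d\<close>, the mirror image is across the
        hyperplane, so cutting the kernel off below distance \<open>d\<close> changes
        nothing.\<close>
      have far: "norm (a - mirror z b) \<ge> d" if "norm (a - x0) < \<rho>" "b \<bullet> z \<ge> 0" for a b
      proof -
        have "d * norm z \<le> a \<bullet> z + b \<bullet> z" using ball[OF that(1)] that(2) by simp
        also have "\<dots> = (a - mirror z b) \<bullet> z" by (simp add: inner_diff_left inner_mirror_normal)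
        also have "\<dots> \<le> norm (a - mirror z b) * norm z" by (rule norm_cauchy_schwarz)
        finally show ?thesis using z by simp
      qed
      show "\<phi> x * kr_off d (x - ?sy) = \<phi> x * s"
        using far[of x y] xy \<phi>s[of x] by (cases "norm (x - x0) < \<rho>") (auto simp: kr_off_def s_def)
      have "norm (?sx - y) = norm (y - ?sx)" by (rule norm_minus_commute)
      then show "\<phi> y * kr_off d (?sx - y) = \<phi> y * s"
        using far[of y x] xy \<phi>s[of y] by (cases "norm (y - x0) < \<rho>") (auto simp: kr_off_def ks)
    qed
    have js: "s \<le> j \<or> (w x = w y \<and> ?e x = ?e y)"
      using kr_antimono[OF _ norm_diff_le_mirror[OF xy]] by (cases "x = y") (auto simp: s_def j_def)
    have sumG: "mirror_sum z (gam w \<phi>) (x, y) = (w x - w y) * (\<phi> x - \<phi> y) * j + (w x + w y) * (\<phi> x + \<phi> y) * s"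
      unfolding mirror_sum_def gam_def by (simp add: s0 anti ks j_def[symmetric] s_def[symmetric] algebra_simps)
    have "mirror_sum z B (x, y) = t * ((?e x - ?e y) * (\<phi> x - \<phi> y) * j) + t * (?e x * \<phi> x + ?e y * \<phi> y) * s
        + 3 * t * (\<phi> x + \<phi> y) * s - c * (\<phi> x * indicator Q y + \<phi> y * indicator Q x)
        + (3 * t) * (\<phi> x * kr_off d (x - y) + \<phi> y * kr_off d (x - y))"
      unfolding mirror_sum_def B_def gam_def
      by (simp add: s0 Q0 off ks j_def[symmetric] s_def[symmetric]) (simp add: algebra_simps)
    moreover have "(3 * t) * (\<phi> x * kr_off d (x - y) + \<phi> y * kr_off d (x - y)) \<ge> 0"
      using t \<phi>0 by simp
    moreover have "(w x - w y) * (\<phi> x - \<phi> y) * j + (w x + w y) * (\<phi> x + \<phi> y) * s \<le>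
        t * ((?e x - ?e y) * (\<phi> x - \<phi> y) * j) + t * (?e x * \<phi> x + ?e y * \<phi> y) * s
        + 3 * t * (\<phi> x + \<phi> y) * s - c * (\<phi> x * indicator Q y + \<phi> y * indicator Q x)"
    proof (rule barrier_pointwise[OF pos[OF xy(1)] pos[OF xy(2)] _ _ _ _ t(1) _ _ _ js])
      show "\<phi> x = max 0 (t * ?e x - w x)" "\<phi> y = max 0 (t * ?e y - w y)"
        using pos[OF xy(1)] pos[OF xy(2)] by (simp_all add: \<phi>_def)
      show "s \<ge> 0" by (simp add: s_def)
      show "indicator Q x \<noteq> (0::real) \<Longrightarrow> ?e x = 0" "indicator Q y \<noteq> (0::real) \<Longrightarrow> ?e y = 0"
        using bump_outside[OF \<rho>] Qb by (auto simp: indicator_def split: if_splits)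
      show "c \<le> w y * (j - s)" if "\<phi> x > 0" "indicator Q y \<noteq> (0::real)"
      proof -
        have "norm (x - x0) < \<rho>" using that \<phi>s[of x] by force
        then show ?thesis using c that by (auto simp: j_def s_def indicator_def split: if_splits)
      qed
      show "c \<le> w x * (j - s)" if "\<phi> y > 0" "indicator Q x \<noteq> (0::real)"
      proof -
        have "norm (y - x0) < \<rho>" using that \<phi>s[of y] by force
        moreover have "kr (y - x) = j" "kr (y - ?sx) = s"
          unfolding j_def ks[symmetric] by (auto intro!: kr_norm_cong simp: norm_minus_commute)
        ultimately show ?thesis using c[of y x] that by (auto simp: indicator_def split: if_splits)
      qed
    qed (auto simp: indicator_def)
    ultimately show "mirror_sum z (gam w \<phi>) (x, y) \<le> mirror_sum z B (x, y)"
      unfolding sumG by linarith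
  qed
  also have "(LINT p|lborel. B p) = t * (LINT p|lborel. gam ?e \<phi> p) + 3 * t * (2 * (LINT x|lborel. \<phi> x) * K)
      - c * (2 * (LINT x|lborel. \<phi> x) * measure lborel Q)"
  proof -
    have "(LINT p|lborel. B p) = t * (LINT p|lborel. gam ?e \<phi> p)
        + (3 * t) * ((LINT x|lborel. \<phi> x) * K + (LINT x|lborel. \<phi> x) * K)
        - c * ((LINT x|lborel. \<phi> x) * measure lborel Q + measure lborel Q * (LINT x|lborel. \<phi> x))"
      unfolding B_def[abs_def] K_def using ge\<phi> conv Qfin by (simp add: conv')
    then show ?thesis by (simp add: algebra_simps)
  qed
  also have "\<dots> \<le> t * (2 * max 1 (1 / \<rho>\<^sup>2) * levy_mass * (LINT x|lborel. \<phi> x)) + 3 * t * (2 * (LINT x|lborel. \<phi> x) * K)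
      - c * (2 * (LINT x|lborel. \<phi> x) * measure lborel Q)"
    using integral_gam_bump_le[OF \<rho> _ \<phi>int \<phi>0 \<phi>s ge\<phi>] t by (simp add: mult_left_mono)
  also have "\<dots> = 2 * ((C * t - c * measure lborel Q) * (LINT x|lborel. \<phi> x))"
    by (simp add: C_def algebra_simps)
  finally have "energy_form k w \<phi> \<le> (C * t - c * measure lborel Q) * (LINT x|lborel. \<phi> x)"
    by (simp add: energy_form_eq[OF gw\<phi>])
  then show "energy k (\<lambda>x. max 0 (t * bump x0 \<rho> x - \<bar>w x\<bar>)) < top \<and>
      energy_form k w (\<lambda>x. max 0 (t * bump x0 \<rho> x - \<bar>w x\<bar>)) \<le>
        (C * t - c * measure lborel Q) * (LINT x|lborel. max 0 (t * bump x0 \<rho> x - \<bar>w x\<bar>))"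
    using e\<phi> by (simp add: \<phi>_def[abs_def])
qed

text \<open>At \<open>x0\<close> the test function equals \<open>t\<close>, so its integral is
  positive. Dividing the tested equation by this integral and letting \<open>t\<close> tend to 0
  removes the cost \<open>C * t\<close>.\<close>

lemma barrier_contradiction:
  fixes w F :: "real^'n \<Rightarrow> real"
  assumes cw: "continuous_on UNIV w" and ew: "energy k w < top"
    and anti: "\<And>x. w (mirror z x) = - w x" and pos: "\<And>x. x \<bullet> z \<ge> 0 \<Longrightarrow> w x \<ge> 0"
    and z: "z \<noteq> 0" and \<rho>: "\<rho> > 0" and d: "d > 0"
    and ball: "\<And>x. norm (x - x0) < \<rho> \<Longrightarrow> x \<bullet> z \<ge> d * norm z"
    and Q: "Q \<in> sets borel" and Qfin: "emeasure lborel Q < top"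
    and Qz: "\<And>y. y \<in> Q \<Longrightarrow> y \<bullet> z > 0" and Qb: "\<And>y. y \<in> Q \<Longrightarrow> norm (y - x0) \<ge> \<rho>"
    and c: "\<And>x y. norm (x - x0) < \<rho> \<Longrightarrow> y \<in> Q \<Longrightarrow> c \<le> w y * (kr (x - y) - kr (x - mirror z y))"
    and w0: "w x0 = 0" and \<Omega>: "\<And>x. norm (x - x0) < \<rho> \<Longrightarrow> x \<in> \<Omega>"
    and cF: "continuous_on UNIV F" and m: "\<And>x. norm (x - x0) < \<rho> \<Longrightarrow> m \<le> F x"
    and weak: "\<And>\<phi>. \<phi> \<in> energy_space k \<Omega> \<Longrightarrow> energy_form k w \<phi> = (LINT x:\<Omega>|lborel. F x * \<phi> x)"
  shows "m + c * measure lborel Q \<le> 0"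
proof -
  obtain C where C: "\<And>t. 0 < t \<Longrightarrow> t \<le> 1 \<Longrightarrow>
      energy k (\<lambda>x. max 0 (t * bump x0 \<rho> x - \<bar>w x\<bar>)) < top \<and>
      energy_form k w (\<lambda>x. max 0 (t * bump x0 \<rho> x - \<bar>w x\<bar>)) \<le>
        (C * t - c * measure lborel Q) * (LINT x|lborel. max 0 (t * bump x0 \<rho> x - \<bar>w x\<bar>))"
    using barrier_estimate[OF cw ew anti pos z \<rho> d ball Q Qfin Qz Qb c] by blast
  have key: "m + c * measure lborel Q \<le> C * t" if t: "0 < t" "t \<le> 1" for t
  proof -
    define \<phi> where "\<phi> x = max 0 (t * bump x0 \<rho> x - \<bar>w x\<bar>)" for x
    have c\<phi>: "continuous_on UNIV \<phi>"
      unfolding \<phi>_def[abs_def] by (intro continuous_intros continuous_on_bump cw)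
    then have [measurable]: "\<phi> \<in> borel_measurable borel"
      by (rule borel_measurable_continuous_onI)
    have [measurable]: "F \<in> borel_measurable borel"
      using cF by (rule borel_measurable_continuous_onI)
    have \<phi>0: "\<phi> x \<ge> 0" for x by (simp add: \<phi>_def)
    have \<phi>1: "\<phi> x \<le> 1" for x
      using mult_mono[of t 1 "bump x0 \<rho> x" 1] t by (auto simp: \<phi>_def)
    have \<phi>s: "\<phi> x = 0" if "norm (x - x0) \<ge> \<rho>" for x
      using bump_outside[OF \<rho> that] by (simp add: \<phi>_def)
    have \<phi>\<Omega>: "indicator \<Omega> x * \<phi> x = \<phi> x" for x
      using \<Omega>[of x] \<phi>s[of x] by (cases "norm (x - x0) < \<rho>") auto
    obtain M where M: "M \<ge> 0" "\<And>x. x \<in> ball x0 \<rho> \<Longrightarrow> \<bar>F x\<bar> \<le> M"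
      using continuous_bounded_on_bounded[OF cF bounded_ball] by blast
    have \<phi>b: "\<phi> x = 0" if "x \<notin> ball x0 \<rho>" for x
      using that by (intro \<phi>s) (simp add: dist_norm norm_minus_commute)
    have int: "integrable lborel \<phi>"
      by (rule integrable_bounded_support[of _ "ball x0 \<rho>" 1]) (use \<phi>0 \<phi>1 \<phi>b in auto)
    have int2: "integrable lborel (\<lambda>x. (\<phi> x)\<^sup>2)"
      by (rule integrable_bounded_support[of _ "ball x0 \<rho>" 1]) (use \<phi>0 \<phi>1 \<phi>b in \<open>auto simp: power_le_one\<close>)
    have intF: "integrable lborel (\<lambda>x. F x * \<phi> x)"
    proof (rule integrable_bounded_support[of _ "ball x0 \<rho>" M])
      fix x assume "x \<in> ball x0 \<rho>"
      then have "\<bar>F x\<bar> * \<phi> x \<le> M * 1" using M \<phi>0 \<phi>1 by (intro mult_mono) auto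
      then show "\<bar>F x * \<phi> x\<bar> \<le> M" using \<phi>0 by (simp add: abs_mult)
    qed (use \<phi>b in auto)
    have "energy k \<phi> < top"
      using C[OF t] unfolding \<phi>_def[abs_def] by blast
    moreover have "\<phi> x = 0" if "x \<notin> \<Omega>" for x
      using \<phi>\<Omega>[of x] that by simp
    ultimately have "\<phi> \<in> energy_space k \<Omega>"
      using int2 by (simp add: energy_space_def)
    then have "energy_form k w \<phi> = (LINT x|lborel. F x * \<phi> x)"
      using weak by (simp add: set_lebesgue_integral_def mult.left_commute[of "indicator _ _"] \<phi>\<Omega>)
    moreover have "(LINT x|lborel. m * \<phi> x) \<le> (LINT x|lborel. F x * \<phi> x)"
    proof (rule integral_mono)
      show "m * \<phi> x \<le> F x * \<phi> x" for x
        using m[of x] \<phi>s[of x] \<phi>0[of x] by (cases "norm (x - x0) < \<rho>") (auto intro: mult_right_mono)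
    qed (use int intF in auto)
    moreover have "energy_form k w \<phi> \<le> (C * t - c * measure lborel Q) * (LINT x|lborel. \<phi> x)"
      using C[OF t] by (simp add: \<phi>_def[abs_def])
    ultimately have le: "m * (LINT x|lborel. \<phi> x) \<le> (C * t - c * measure lborel Q) * (LINT x|lborel. \<phi> x)"
      by simp
    have "(LINT x|lborel. \<phi> x) \<noteq> 0"
    proof
      assume "(LINT x|lborel. \<phi> x) = 0"
      then have "AE x in lborel. \<phi> x = 0"
        using integral_nonneg_eq_0_iff_AE[OF int] \<phi>0 by simp
      then have "{x. 0 < \<phi> x} = {}"
        using c\<phi> by (intro open_null_empty open_Collect_less continuous_on_const) (auto elim: eventually_mono)
      moreover have "\<phi> x0 = t" using t w0 by (simp add: \<phi>_def)
      ultimately show False using t by auto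
    qed
    moreover have "(LINT x|lborel. \<phi> x) \<ge> 0" using \<phi>0 by (intro integral_nonneg_AE) simp
    ultimately have "m \<le> C * t - c * measure lborel Q" using le by simp
    then show ?thesis by simp
  qed
  show ?thesis
  proof (rule ccontr)
    assume no: "\<not> ?thesis"
    define a where "a = m + c * measure lborel Q"
    have a: "a > 0" using no by (simp add: a_def)
    \<comment> \<open>Makes \<open>C * t\<close> at most \<open>a / 2\<close>; the denominator is
      positive whatever the sign of \<open>C\<close>.\<close>
    define t where "t = min 1 (a / (2 * (\<bar>C\<bar> + 1)))"
    have t: "0 < t" "t \<le> 1" using a by (auto simp: t_def)
    have "a \<le> C * t" using key[OF t] by (simp add: a_def)
    also have "\<dots> \<le> (\<bar>C\<bar> + 1) * (a / (2 * (\<bar>C\<bar> + 1)))"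
      using t by (intro mult_mono) (auto simp: t_def)
    also have "\<dots> = a / 2" by (simp add: field_simps)
    finally show False using a by simp
  qed
qed

text \<open>The barrier is used twice: with \<open>Q\<close> empty it excludes a positive
  \<open>F x0\<close>, and with a small ball \<open>Q\<close> around a nearby point of positivity it
  excludes such points. \<open>Q\<close> has to be near \<open>x0\<close>, where the singular kernel
  beats its reflected value.\<close>

theorem strong_maximum_principle:
  fixes w F :: "real^'n \<Rightarrow> real"
  assumes cw: "continuous_on UNIV w" and ew: "energy k w < top"
    and anti: "\<And>x. w (mirror z x) = - w x" and pos: "\<And>x. x \<bullet> z \<ge> 0 \<Longrightarrow> w x \<ge> 0"
    and x0: "x0 \<in> \<Omega>" "x0 \<bullet> z > 0" "w x0 = 0" and F0: "F x0 \<ge> 0" and o\<Omega>: "open \<Omega>"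
    and cF: "continuous_on UNIV F"
    and weak: "\<And>\<phi>. \<phi> \<in> energy_space k \<Omega> \<Longrightarrow> energy_form k w \<phi> = (LINT x:\<Omega>|lborel. F x * \<phi> x)"
  shows "F x0 = 0 \<and> (\<exists>\<rho>>0. \<forall>x. norm (x - x0) < \<rho> \<longrightarrow> w x = 0)"
proof -
  have z: "z \<noteq> 0" using x0 by auto
  define d where "d = (x0 \<bullet> z) / (2 * norm z)"
  have d: "d > 0" using x0 z by (simp add: d_def)
  have ball: "x \<bullet> z \<ge> d * norm z" if "norm (x - x0) \<le> d" for x
  proof -
    have "\<bar>(x - x0) \<bullet> z\<bar> \<le> norm (x - x0) * norm z" by (rule Cauchy_Schwarz_ineq2)
    also have "\<dots> \<le> d * norm z" using that by (intro mult_right_mono) auto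
    finally have "x \<bullet> z \<ge> x0 \<bullet> z - d * norm z" by (simp add: inner_diff_left)
    moreover have "x0 \<bullet> z = 2 * (d * norm z)" using z by (simp add: d_def)
    ultimately show ?thesis by simp
  qed
  obtain r\<Omega> where r\<Omega>: "r\<Omega> > 0" "\<And>x. norm (x - x0) < r\<Omega> \<Longrightarrow> x \<in> \<Omega>"
    using o\<Omega> x0(1) unfolding open_dist dist_norm by blast
  have Fnear: "\<exists>r>0. \<forall>x. norm (x - x0) < r \<longrightarrow> m \<le> F x" if "m < F x0" for m
  proof -
    have "eventually (\<lambda>x. m < F x) (at x0)"
      using cF that by (intro order_tendstoD) (auto simp: continuous_on_def)
    then obtain r where "r > 0" "\<And>x. x \<noteq> x0 \<Longrightarrow> norm (x - x0) < r \<Longrightarrow> m < F x"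
      unfolding eventually_at dist_norm by auto
    then show ?thesis using that by (intro exI[of _ r]) (metis less_imp_le)
  qed
  have "F x0 \<le> 0"
  proof (rule ccontr)
    assume "\<not> F x0 \<le> 0"
    then obtain r where r: "r > 0" "\<And>x. norm (x - x0) < r \<Longrightarrow> F x0 / 2 \<le> F x"
      using Fnear[of "F x0 / 2"] by auto
    have "F x0 / 2 + 0 * measure lborel ({}::(real^'n) set) \<le> 0"
      using r r\<Omega> d ball
      by (intro barrier_contradiction[where \<rho> = "min (min r r\<Omega>) d" and d = d, OF cw ew anti pos z _ d _ _ _ _ _ _ x0(3) _ cF _ weak]) auto
    then show False using \<open>\<not> F x0 \<le> 0\<close> by simp
  qed
  then have F00: "F x0 = 0" using F0 by simp
  moreover have "\<exists>\<rho>>0. \<forall>x. norm (x - x0) < \<rho> \<longrightarrow> w x = 0"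
  proof (rule ccontr)
    assume no: "\<not> ?thesis"
    \<comment> \<open>A reference vector of length \<open>d\<close>: \<open>kr e\<close> bounds the
      kernel between a point of the bump's ball and the mirror image of a point of \<open>Q\<close>.
      Within distance \<open>r\<close> the kernel exceeds this by 1, hence the gain constant
      \<open>w y0 / 2\<close>.\<close>
    define e where "e = (d / norm z) *\<^sub>R z"
    have e: "norm e = d" using d z by (simp add: e_def)
    then have e0: "e \<noteq> 0" using d by auto
    obtain r where r: "r > 0" "\<And>v. norm v < r \<Longrightarrow> ennreal (kr e + 1) < k v"
      using k_singular[of "kr e + 1"] by auto
    obtain y0 where y0: "norm (y0 - x0) < min (r / 2) (d / 2)" "w y0 \<noteq> 0"
      using no r d by (metis half_gt_zero min_less_iff_conj)
    define l where "l = norm (y0 - x0)"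
    have l: "l > 0" "l < r / 2" "l < d / 2" using y0 x0(3) by (auto simp: l_def)
    have "y0 \<bullet> z \<ge> d * norm z" using l d by (intro ball) (simp add: l_def)
    then have "y0 \<bullet> z \<ge> 0" using d by (meson dual_order.trans less_imp_le mult_nonneg_nonneg norm_ge_zero)
    then have w0: "w y0 > 0" using pos[of y0] y0 by simp
    have "eventually (\<lambda>x. w y0 / 2 < w x) (at y0)"
      using cw w0 by (intro order_tendstoD) (auto simp: continuous_on_def)
    then obtain \<sigma>' where \<sigma>': "\<sigma>' > 0" "\<And>x. x \<noteq> y0 \<Longrightarrow> norm (x - y0) < \<sigma>' \<Longrightarrow> w y0 / 2 < w x"
      unfolding eventually_at dist_norm by auto
    define \<sigma> where "\<sigma> = min \<sigma>' (l / 2)"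
    have \<sigma>: "\<sigma> > 0" "\<sigma> \<le> l / 2" using \<sigma>' l by (auto simp: \<sigma>_def)
    define Q where "Q = ball y0 \<sigma>"
    have wQ: "w y \<ge> w y0 / 2" if "y \<in> Q" for y
      using \<sigma>'(2)[of y] that w0 by (cases "y = y0") (auto simp: Q_def \<sigma>_def dist_norm norm_minus_commute)
    have Ql: "l / 2 \<le> norm (y - x0)" "norm (y - x0) \<le> 2 * l" if "y \<in> Q" for y
    proof -
      have "norm (y - y0) \<le> l / 2" using that \<sigma> by (auto simp: Q_def dist_norm norm_minus_commute)
      then show "l / 2 \<le> norm (y - x0)" "norm (y - x0) \<le> 2 * l"
        using norm_triangle_ineq[of "y - y0" "y0 - x0"] norm_triangle_ineq[of "y0 - y" "y - x0"]
        by (auto simp: l_def norm_minus_commute)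
    qed
    have mQ: "measure lborel Q > 0"
      using \<sigma> unit_ball_vol_pos[of "real DIM(real^'n)"] by (simp add: Q_def content_ball)
    \<comment> \<open>Minus one half of the gain from \<open>Q\<close>; by continuity
      \<open>F\<close> stays above this level near \<open>x0\<close>, so half of the gain is
      left.\<close>
    define m where "m = - (w y0 / 2 * measure lborel Q / 2)"
    have "m < F x0" using mQ w0 F00 by (simp add: m_def)
    then obtain rF where rF: "rF > 0" "\<And>x. norm (x - x0) < rF \<Longrightarrow> m \<le> F x"
      using Fnear by blast
    \<comment> \<open>Points of \<open>Q\<close> have distance at least \<open>l / 2\<close> from
      \<open>x0\<close>, so the ball of the bump stays disjoint from \<open>Q\<close>.\<close>
    define \<rho> where "\<rho> = min (min rF r\<Omega>) (l / 2)"
    have \<rho>: "\<rho> > 0" "\<rho> \<le> rF" "\<rho> \<le> r\<Omega>" "\<rho> \<le> l / 2" using rF r\<Omega> l by (auto simp: \<rho>_def)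
    have "m + w y0 / 2 * measure lborel Q \<le> 0"
    proof (rule barrier_contradiction[where \<rho> = \<rho> and d = d, OF cw ew anti pos z \<rho>(1) d _ _ _ _ _ _ x0(3) _ cF _ weak])
      show "x \<bullet> z \<ge> d * norm z" if "norm (x - x0) < \<rho>" for x
        using that \<rho> l by (intro ball) simp
      show "Q \<in> sets borel" by (simp add: Q_def)
      show "emeasure lborel Q < top"
        unfolding Q_def using emeasure_bounded_finite[OF bounded_ball] by simp
      show Qz: "y \<bullet> z > 0" if "y \<in> Q" for y
      proof -
        have "d * norm z \<le> y \<bullet> z" using Ql[OF that] l by (intro ball) simp
        moreover have "d * norm z > 0" using d z by simp
        ultimately show ?thesis by linarith
      qed
      show "\<rho> \<le> norm (y - x0)" if "y \<in> Q" for y using Ql[OF that] \<rho> by simp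
      show "x \<in> \<Omega>" if "norm (x - x0) < \<rho>" for x using that \<rho> by (intro r\<Omega>) simp
      show "m \<le> F x" if "norm (x - x0) < \<rho>" for x using that \<rho> by (intro rF) simp
      fix x y assume x: "norm (x - x0) < \<rho>" and y: "y \<in> Q"
      have "norm (x - y) < r"
        using norm_triangle_ineq[of "x - x0" "x0 - y"] norm_triangle_ineq4[of "x - x0" "y - x0"] x Ql[OF y] \<rho> l \<sigma> y
          norm_triangle_ineq[of "x - x0" "x0 - y0"] norm_triangle_ineq[of "x - y0" "y0 - y"]
        by (auto simp: l_def Q_def dist_norm norm_minus_commute)
      then have "ennreal (kr e + 1) < k (x - y)" by (rule r)
      moreover have "x \<noteq> y" using x Ql[OF y] \<rho> by auto
      ultimately have 1: "kr e + 1 \<le> kr (x - y)"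
        by (metis eq_iff_diff_eq_0 ennreal_kr ennreal_less_iff add_nonneg_nonneg kr_nonneg less_imp_le zero_le_one)
      have "d * norm z \<le> x \<bullet> z + y \<bullet> z"
        using ball[of x] x \<rho> l Qz[OF y] by simp
      also have "\<dots> = (x - mirror z y) \<bullet> z" by (simp add: inner_diff_left inner_mirror_normal)
      also have "\<dots> \<le> norm (x - mirror z y) * norm z" by (rule norm_cauchy_schwarz)
      finally have "norm e \<le> norm (x - mirror z y)" using z e by simp
      then have "kr (x - mirror z y) \<le> kr e" by (rule kr_antimono[OF e0])
      then have "w y0 / 2 * 1 \<le> w y * (kr (x - y) - kr (x - mirror z y))"
        using 1 wQ[OF y] w0 by (intro mult_mono) auto
      then show "w y0 / 2 \<le> w y * (kr (x - y) - kr (x - mirror z y))" by simp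
    qed
    then show False using mult_pos_pos[OF w0 mQ] by (simp add: m_def)
  qed
  ultimately show ?thesis by blast
qed

end

subsection \<open>A maximum principle for sets of small measure\<close>

text \<open>\<open>W, W'\<close> are the values of \<open>w\<close> at two points of the half-space,
  \<open>f, f'\<close> its negative parts, \<open>j\<close> and \<open>s\<close> the kernel before
  and after reflecting one point. The expression in \<open>f\<close> alone is the four-pair sum for
  the negative part extended by zero, the last right-hand side that for \<open>w\<close>. The order
  of \<open>s\<close> and \<open>j\<close> can fail only on the diagonal, covered by
  \<open>W = W'\<close>.\<close>

lemma neg_part_pointwise:
  fixes W W' f f' j s :: real
  assumes f: "f = max 0 (- W)" "f' = max 0 (- W')" and s: "s \<ge> 0" and js: "s \<le> j \<or> W = W'"
    and j: "j \<ge> 0"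
  shows "(W - W') * (f - f') * j + (W + W') * (f + f') * s \<le>
      - ((f - f') * (f - f') * j + f' * f' * s + f * f * s)"
    and "(f - f') * (f - f') * j + f' * f' * s + f * f * s \<le>
      (W - W') * (W - W') * j + (W + W') * (W + W') * s + (W + W') * (W + W') * s + (W - W') * (W - W') * j"
proof -
  have Wf: "W * f = - (f * f)" "W' * f' = - (f' * f')" by (auto simp: f max_def)
  have ff: "f \<ge> 0" "f' \<ge> 0" by (auto simp: f)
  have 1: "(W - W') * (f - f') \<le> - ((f - f') * (f - f'))"
  proof -
    have "W * f' \<ge> - (f * f')" "W' * f \<ge> - (f' * f)"
      using mult_right_mono[of "- f" W f'] mult_right_mono[of "- f'" W' f] ff by (auto simp: f)
    then show ?thesis using Wf by (simp add: algebra_simps)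
  qed
  have 2: "(W - W') * (f - f') * (j - s) \<le> - ((f - f') * (f - f')) * (j - s)"
  proof (cases "s \<le> j")
    case True
    then show ?thesis using 1 by (intro mult_right_mono) auto
  next
    case False
    then show ?thesis using js f by auto
  qed
  have 3: "(f - f') * (f - f') \<le> f * f + f' * f'"
    using mult_nonneg_nonneg[OF ff] by (simp add: algebra_simps)
  then have "(f - f') * (f - f') * s \<le> (f * f + f' * f') * s" using s by (rule mult_right_mono)
  moreover have "(W - W') * (f - f') * j + (W + W') * (f + f') * s =
      (W - W') * (f - f') * (j - s) + 2 * (W * f + W' * f') * s"
    by (simp add: algebra_simps)
  ultimately show "(W - W') * (f - f') * j + (W + W') * (f + f') * s \<le>
      - ((f - f') * (f - f') * j + f' * f' * s + f * f * s)"
    using 2 unfolding Wf by (simp add: algebra_simps)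
  have "\<bar>f - f'\<bar> \<le> \<bar>W - W'\<bar>" by (auto simp: f max_def)
  then have "\<bar>f - f'\<bar> * \<bar>f - f'\<bar> \<le> \<bar>W - W'\<bar> * \<bar>W - W'\<bar>" by (intro mult_mono) auto
  then have a: "(f - f') * (f - f') * j \<le> (W - W') * (W - W') * j"
    using j by (intro mult_right_mono) (auto simp: abs_mult_self_eq)
  have fW: "f * f \<le> W * W" "f' * f' \<le> W' * W'" by (auto simp: f max_def)
  have b: "f' * f' * s + f * f * s \<le> 2 * (W * W + W' * W') * s"
    using mult_right_mono[OF fW(1) s] mult_right_mono[OF fW(2) s] mult_nonneg_nonneg[OF zero_le_square[of W] s]
      mult_nonneg_nonneg[OF zero_le_square[of W'] s] by (simp add: algebra_simps)
  have c: "2 * (W * W + W' * W') * s \<le> 2 * ((W + W') * (W + W') * s) + (W - W') * (W - W') * j"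
  proof (cases "s \<le> j")
    case True
    then have "(W - W') * (W - W') * s \<le> (W - W') * (W - W') * j"
      by (intro mult_left_mono) auto
    moreover have "0 \<le> (W + W') * (W + W') * s"
      by (rule mult_nonneg_nonneg[OF zero_le_square s])
    ultimately show ?thesis by (simp add: algebra_simps)
  next
    case False
    then have "W = W'" using js by auto
    then show ?thesis using mult_nonneg_nonneg[OF zero_le_square[of W'] s] by (simp add: algebra_simps)
  qed
  show "(f - f') * (f - f') * j + f' * f' * s + f * f * s \<le>
      (W - W') * (W - W') * j + (W + W') * (W + W') * s + (W + W') * (W + W') * s + (W - W') * (W - W') * j"
    using a b c by linarith
qed

context levy_kernel
begin

text \<open>Pairs with one point outside \<open>A\<close> already give enough energy: the kernel
  mass outside \<open>A\<close>, seen from any point, is at least that of \<open>min k n\<close>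
  minus \<open>n\<close> times the measure of \<open>A\<close>, and the former is unbounded in
  \<open>n\<close>.\<close>

lemma poincare_small_support:
  assumes \<Lambda>: "\<Lambda> \<ge> 0"
  obtains \<mu> :: real where "\<mu> > 0"
    and "\<And>A \<phi>. A \<in> sets borel \<Longrightarrow> emeasure lborel A \<le> ennreal \<mu> \<Longrightarrow> \<phi> \<in> borel_measurable borel \<Longrightarrow>
      (\<And>x. x \<notin> A \<Longrightarrow> \<phi> x = 0) \<Longrightarrow>
      ennreal \<Lambda> * (\<integral>\<^sup>+x. ennreal ((\<phi> x)\<^sup>2) \<partial>lborel) \<le> energy k \<phi>"
proof -
  have "(SUP n. (\<integral>\<^sup>+z. min (k z) (of_nat n) \<partial>lborel)) = (\<integral>\<^sup>+z. (SUP n. min (k z) (of_nat n)) \<partial>lborel)"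
    by (rule nn_integral_monotone_convergence_SUP[symmetric])
       (auto simp: incseq_def le_fun_def intro!: min.coboundedI2 of_nat_mono)
  also have "\<dots> = (\<integral>\<^sup>+z. k z \<partial>lborel)"
  proof (rule nn_integral_cong)
    fix z
    have "(SUP n. min (k z) (of_nat n)) = min (k z) (SUP n. of_nat n :: ennreal)"
      by (simp add: inf_min[symmetric] inf_SUP)
    then show "(SUP n. min (k z) (of_nat n)) = k z"
      by (simp add: ennreal_SUP_of_nat_eq_top)
  qed
  finally have SUP: "(SUP n. (\<integral>\<^sup>+z. min (k z) (of_nat n) \<partial>lborel)) = (\<integral>\<^sup>+z. k z \<partial>lborel)" .
  \<comment> \<open>The factor 2 compensates the one half in the energy; the 1 is what a set of
    measure at most \<open>1 / (n + 1)\<close> can take away.\<close>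
  have "ennreal (2 * \<Lambda> + 1) < (SUP n. (\<integral>\<^sup>+z. min (k z) (of_nat n) \<partial>lborel))"
    unfolding SUP k_infinite by simp
  then obtain n where n: "ennreal (2 * \<Lambda> + 1) < (\<integral>\<^sup>+z. min (k z) (of_nat n) \<partial>lborel)"
    by (auto simp: less_SUP_iff)
  show ?thesis
  proof
    show "1 / (real n + 1) > 0" by simp
    fix A :: "(real^'n) set" and \<phi> :: "real^'n \<Rightarrow> real"
    assume [measurable]: "A \<in> sets borel" "\<phi> \<in> borel_measurable borel"
      and A: "emeasure lborel A \<le> ennreal (1 / (real n + 1))" and supp: "\<And>x. x \<notin> A \<Longrightarrow> \<phi> x = 0"
    have [measurable]: "- A \<in> sets borel" by simp
    have 1: "ennreal (2 * \<Lambda>) \<le> (\<integral>\<^sup>+y. k (x - y) * indicator (- A) y \<partial>lborel)" (is "_ \<le> ?I") for x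
    proof -
      have "(\<integral>\<^sup>+z. min (k z) (of_nat n) \<partial>lborel) = (\<integral>\<^sup>+y. min (k (x - y)) (of_nat n) \<partial>lborel)"
        by (subst nn_integral_lborel_diff[where g = "\<lambda>z. min (k z) (of_nat n)"]) simp_all
      also have "\<dots> \<le> (\<integral>\<^sup>+y. k (x - y) * indicator (- A) y + of_nat n * indicator A y \<partial>lborel)"
        by (intro nn_integral_mono) (auto simp: indicator_def)
      also have "\<dots> = ?I + of_nat n * emeasure lborel A"
        by (simp add: nn_integral_add nn_integral_cmult)
      also have "of_nat n * emeasure lborel A \<le> ennreal (real n) * ennreal (1 / (real n + 1))"
        using A by (intro mult_mono) (auto simp: ennreal_of_nat_eq_real_of_nat)
      also have "\<dots> \<le> ennreal 1"
        by (subst ennreal_mult[symmetric]) (auto intro!: ennreal_leI simp: field_simps)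
      finally have "(\<integral>\<^sup>+z. min (k z) (of_nat n) \<partial>lborel) \<le> ?I + 1"
        by (simp add: add_left_mono)
      then have "ennreal (2 * \<Lambda> + 1) \<le> ?I + 1" using n by simp
      then show ?thesis using \<Lambda> by (simp add: ennreal_plus)
    qed
    have "ennreal (2 * \<Lambda>) * (\<integral>\<^sup>+x. ennreal ((\<phi> x)\<^sup>2) \<partial>lborel) =
        (\<integral>\<^sup>+x. ennreal ((\<phi> x)\<^sup>2) * ennreal (2 * \<Lambda>) \<partial>lborel)"
      by (subst nn_integral_multc) (simp_all add: mult.commute)
    also have "\<dots> \<le> (\<integral>\<^sup>+x. ennreal ((\<phi> x)\<^sup>2) * (\<integral>\<^sup>+y. k (x - y) * indicator (- A) y \<partial>lborel) \<partial>lborel)"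
      by (intro nn_integral_mono mult_left_mono 1) simp
    also have "\<dots> = (\<integral>\<^sup>+x. \<integral>\<^sup>+y. ennreal ((\<phi> x)\<^sup>2) * (k (x - y) * indicator (- A) y) \<partial>lborel \<partial>lborel)"
      by (simp add: nn_integral_cmult)
    also have "\<dots> \<le> (\<integral>\<^sup>+x. \<integral>\<^sup>+y. ennreal (gam \<phi> \<phi> (x, y)) \<partial>lborel \<partial>lborel)"
    proof (intro nn_integral_mono)
      fix x y
      show "ennreal ((\<phi> x)\<^sup>2) * (k (x - y) * indicator (- A) y) \<le> ennreal (gam \<phi> \<phi> (x, y))"
        using supp[of y]
        by (cases "x = y"; cases "y \<in> A") (auto simp: gam_def ennreal_mult ennreal_kr[symmetric] power2_eq_square)
    qed
    also have "\<dots> = (\<integral>\<^sup>+p. ennreal (gam \<phi> \<phi> p) \<partial>lborel)"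
      by (subst lborel.nn_integral_fst) (simp_all add: lborel_prod borel_prod)
    finally have "ennreal (2 * \<Lambda>) * (\<integral>\<^sup>+x. ennreal ((\<phi> x)\<^sup>2) \<partial>lborel) / 2 \<le> energy k \<phi>"
      by (simp add: energy_eq divide_right_mono_ennreal)
    moreover have "ennreal (2 * \<Lambda>) * c / 2 = ennreal \<Lambda> * c" for c
    proof -
      have "ennreal (2 * \<Lambda>) * c = (ennreal \<Lambda> * c) * 2"
        using \<Lambda> by (simp add: ennreal_mult mult.commute mult.left_commute)
      then show ?thesis by (simp add: ennreal_mult_divide_eq)
    qed
    ultimately show "ennreal \<Lambda> * (\<integral>\<^sup>+x. ennreal ((\<phi> x)\<^sup>2) \<partial>lborel) \<le> energy k \<phi>"
      by simp
  qed
qed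

text \<open>Across the hyperplane an increment of \<phi> may exceed that of \<open>w\<close>, so
  \<open>energy_dominated\<close> does not apply. Antisymmetry repairs this after summation over the
  four reflected pairs.\<close>

lemma
  fixes w :: "real^'n \<Rightarrow> real"
  assumes [measurable]: "w \<in> borel_measurable borel" and ew: "energy k w < top"
    and anti: "\<And>x. w (mirror z x) = - w x"
    and \<phi>: "\<And>x. \<phi> x = (if x \<bullet> z > 0 then max 0 (- w x) else 0)"
  shows energy_neg_part: "energy k \<phi> < top"
    and energy_form_neg_part: "energy_form k w \<phi> \<le> - energy_form k \<phi> \<phi>"
proof -
  have [measurable]: "\<phi> \<in> borel_measurable borel"
    unfolding \<phi>[abs_def] by measurable
  have \<phi>m: "\<phi> (mirror z x) = 0" if "x \<bullet> z \<ge> 0" for x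
    using that by (simp add: \<phi> inner_mirror_normal)
  have \<phi>H: "\<phi> x = max 0 (- w x)" if "x \<bullet> z \<ge> 0" for x
  proof (cases "x \<bullet> z = 0")
    case True
    then have "w x = 0" using anti[of x] by (simp add: mirror_fixed)
    then show ?thesis by (simp add: \<phi>)
  qed (use that \<phi> in auto)
  have ks: "kr (mirror z x - y) = kr (x - mirror z y)" for x y
    by (rule kr_norm_cong[OF norm_diff_mirror])
  have km: "kr (mirror z x - mirror z y) = kr (x - y)" for x y
    by (rule kr_norm_cong[OF norm_mirror_diff])
  have js: "kr (x - mirror z y) \<le> kr (x - y) \<or> w x = w y" if "x \<bullet> z \<ge> 0" "y \<bullet> z \<ge> 0" for x y
    using kr_antimono[OF _ norm_diff_le_mirror[OF that]] by (cases "x = y") auto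
  note pw = neg_part_pointwise[OF \<phi>H \<phi>H kr_nonneg js kr_nonneg]
  have sq: "mirror_sum z (gam \<phi> \<phi>) (x, y) = (\<phi> x - \<phi> y) * (\<phi> x - \<phi> y) * kr (x - y) + \<phi> y * \<phi> y * kr (x - mirror z y)
      + \<phi> x * \<phi> x * kr (x - mirror z y)" if "x \<bullet> z \<ge> 0" "y \<bullet> z \<ge> 0" for x y
    unfolding mirror_sum_def gam_def using that by (simp add: \<phi>m ks km)
  have "(\<integral>\<^sup>+p. ennreal (gam \<phi> \<phi> p) \<partial>lborel) \<le> (\<integral>\<^sup>+p. ennreal (gam w w p) \<partial>lborel)"
  proof (rule nn_integral_mirror_le[of _ _ z])
    fix x y :: "real^'n" assume xy: "x \<bullet> z \<ge> 0" "y \<bullet> z \<ge> 0"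
    have m: "mirror_sum z (\<lambda>p. ennreal (gam g g p)) q = ennreal (mirror_sum z (gam g g) q)" for g q
      by (simp add: mirror_sum_def gam_self_nonneg)
    have "mirror_sum z (gam w w) (x, y) = (w x - w y) * (w x - w y) * kr (x - y) + (w x + w y) * (w x + w y) * kr (x - mirror z y)
        + (w x + w y) * (w x + w y) * kr (x - mirror z y) + (w x - w y) * (w x - w y) * kr (x - y)"
      unfolding mirror_sum_def gam_def by (simp add: anti ks km) (simp add: algebra_simps)
    then show "mirror_sum z (\<lambda>p. ennreal (gam \<phi> \<phi> p)) (x, y) \<le> mirror_sum z (\<lambda>p. ennreal (gam w w p)) (x, y)"
      unfolding m using pw(2)[OF xy(1) xy(2) xy(1) xy(2)] sq[OF xy] by (intro ennreal_leI) simp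
  qed simp_all
  then have "(\<integral>\<^sup>+p. ennreal (gam \<phi> \<phi> p) \<partial>lborel) / 2 \<le> energy k w"
    by (simp add: energy_eq divide_right_mono_ennreal)
  then show e\<phi>: "energy k \<phi> < top"
    using ew by (simp add: energy_eq le_less_trans)
  have i: "integrable lborel (gam w \<phi>)" "integrable lborel (gam \<phi> \<phi>)"
    using e\<phi> ew by (auto intro: integrable_gam)
  have "(LINT p|lborel. gam w \<phi> p) \<le> (LINT p|lborel. - gam \<phi> \<phi> p)"
  proof (rule integral_mirror_le[of _ _ z])
    fix x y :: "real^'n" assume xy: "x \<bullet> z \<ge> 0" "y \<bullet> z \<ge> 0"
    have "mirror_sum z (gam w \<phi>) (x, y) = (w x - w y) * (\<phi> x - \<phi> y) * kr (x - y) + (w x + w y) * (\<phi> x + \<phi> y) * kr (x - mirror z y)"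
      unfolding mirror_sum_def gam_def using xy by (simp add: \<phi>m anti ks km) (simp add: algebra_simps)
    moreover have "mirror_sum z (\<lambda>p. - gam \<phi> \<phi> p) (x, y) = - mirror_sum z (gam \<phi> \<phi>) (x, y)"
      by (simp add: mirror_sum_def)
    ultimately show "mirror_sum z (gam w \<phi>) (x, y) \<le> mirror_sum z (\<lambda>p. - gam \<phi> \<phi> p) (x, y)"
      using pw(1)[OF xy(1) xy(2) xy(1) xy(2)] sq[OF xy] by simp
  qed (use i in auto)
  then show "energy_form k w \<phi> \<le> - energy_form k \<phi> \<phi>"
    using i by (simp add: energy_form_eq)
qed

text \<open>Each equation is tested with the negative part of its own component on the half-space.
  The coupling terms are products of negative parts, absorbed by the Poincare inequality once all
  components are added.\<close>

theorem small_domain_maximum_principle: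
  fixes w F :: "'m::finite \<Rightarrow> real^'n \<Rightarrow> real" and L :: real
  assumes cw: "\<And>i. continuous_on UNIV (w i)" and ew: "\<And>i. energy k (w i) < top"
    and anti: "\<And>i x. w i (mirror z x) = - w i x"
    and b\<Omega>: "bounded \<Omega>" and w0: "\<And>i x. x \<notin> \<Omega> \<Longrightarrow> w i x = 0"
    and cF: "\<And>i. continuous_on UNIV (F i)"
    and weak: "\<And>i \<phi>. \<phi> \<in> energy_space k \<Omega> \<Longrightarrow> energy_form k (w i) \<phi> = (LINT x:\<Omega>|lborel. F i x * \<phi> x)"
    and L: "L \<ge> 0" and FL: "\<And>i x. x \<in> \<Omega> \<Longrightarrow> x \<bullet> z > 0 \<Longrightarrow> w i x < 0 \<Longrightarrow> F i x \<ge> - L * (\<Sum>j\<in>UNIV. max 0 (- w j x))"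
    and A: "\<And>i x. x \<bullet> z > 0 \<Longrightarrow> w i x < 0 \<Longrightarrow> x \<in> A"
    and poincare: "\<And>\<phi>. \<phi> \<in> borel_measurable borel \<Longrightarrow> (\<And>x. x \<notin> A \<Longrightarrow> \<phi> x = 0) \<Longrightarrow>
      ennreal (L * CARD('m) + 1) * (\<integral>\<^sup>+x. ennreal ((\<phi> x)\<^sup>2) \<partial>lborel) \<le> energy k \<phi>"
    and x: "x \<bullet> z > 0"
  shows "w i x \<ge> 0"
proof -
  define \<phi> where "\<phi> i x = (if x \<bullet> z > 0 then max 0 (- w i x) else 0)" for i x
  have wm [measurable]: "w i \<in> borel_measurable borel" for i
    using cw by (rule borel_measurable_continuous_onI)
  have Fm [measurable]: "F i \<in> borel_measurable borel" for i
    using cF by (rule borel_measurable_continuous_onI)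
  have \<phi>m [measurable]: "\<phi> i \<in> borel_measurable borel" for i
    unfolding \<phi>_def by measurable
  have e\<phi>: "energy k (\<phi> i) < top" and f\<phi>: "energy_form k (w i) (\<phi> i) \<le> - energy_form k (\<phi> i) (\<phi> i)" for i
    using energy_neg_part[OF wm ew anti \<phi>_def] energy_form_neg_part[OF wm ew anti \<phi>_def] by auto
  have \<phi>0: "\<phi> i x \<ge> 0" for i x by (simp add: \<phi>_def)
  have \<phi>\<Omega>: "\<phi> i x = 0" if "x \<notin> \<Omega>" for i x using w0[OF that] by (simp add: \<phi>_def)
  from continuous_bounded_on_bounded[OF cw b\<Omega>] obtain Mw where Mw: "\<And>i. Mw i \<ge> 0" "\<And>i x. x \<in> \<Omega> \<Longrightarrow> \<bar>w i x\<bar> \<le> Mw i"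
    by metis
  from continuous_bounded_on_bounded[OF cF b\<Omega>] obtain MF where MF: "\<And>i. MF i \<ge> 0" "\<And>i x. x \<in> \<Omega> \<Longrightarrow> \<bar>F i x\<bar> \<le> MF i"
    by metis
  have \<phi>b: "\<phi> i x \<le> Mw i" for i x
  proof (cases "x \<in> \<Omega>")
    case True
    then show ?thesis using Mw(1)[of i] Mw(2)[OF True, of i] by (auto simp: \<phi>_def)
  qed (use \<phi>\<Omega> Mw in auto)
  have int: "integrable lborel (\<lambda>x. \<phi> j x * \<phi> i x)" for i j
  proof (rule integrable_bounded_support[OF _ b\<Omega>])
    show "\<bar>\<phi> j x * \<phi> i x\<bar> \<le> Mw j * Mw i" for x
      using \<phi>b \<phi>0 Mw by (simp add: abs_mult mult_mono)
  qed (use \<phi>\<Omega> in auto)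
  have intF: "integrable lborel (\<lambda>x. F i x * \<phi> i x)" for i
  proof (rule integrable_bounded_support[OF _ b\<Omega>])
    show "\<bar>F i x * \<phi> i x\<bar> \<le> MF i * Mw i" for x
    proof (cases "x \<in> \<Omega>")
      case True
      then show ?thesis using \<phi>b[of i x] \<phi>0[of i x] Mw MF by (simp add: abs_mult mult_mono)
    qed (use \<phi>\<Omega> Mw MF in auto)
  qed (use \<phi>\<Omega> in auto)
  have es: "\<phi> i \<in> energy_space k \<Omega>" for i
    using e\<phi> \<phi>\<Omega> int[of i i] by (simp add: energy_space_def power2_eq_square)
  define a where "a i = (LINT x|lborel. \<phi> i x * \<phi> i x)" for i
  have a0: "a i \<ge> 0" for i
    unfolding a_def by (rule integral_nonneg_AE) simp
  define \<Lambda> where "\<Lambda> = L * CARD('m) + 1"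
  have \<Lambda>0: "\<Lambda> \<ge> 0" using L by (simp add: \<Lambda>_def)
  have each: "\<Lambda> * a i \<le> L * (\<Sum>j\<in>UNIV. (a j + a i) / 2)" for i
  proof -
    have "ennreal \<Lambda> * (\<integral>\<^sup>+x. ennreal ((\<phi> i x)\<^sup>2) \<partial>lborel) \<le> energy k (\<phi> i)"
      unfolding \<Lambda>_def
    proof (rule poincare)
      show "\<phi> i x = 0" if "x \<notin> A" for x
        using that A[of x i] by (cases "x \<bullet> z > 0 \<and> w i x < 0") (auto simp: \<phi>_def not_less)
    qed simp
    moreover have "(\<integral>\<^sup>+x. ennreal ((\<phi> i x)\<^sup>2) \<partial>lborel) = ennreal (a i)"
      unfolding a_def power2_eq_square by (rule nn_integral_eq_integral[OF int]) simp
    ultimately have "ennreal (\<Lambda> * a i) \<le> energy k (\<phi> i)"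
      using \<Lambda>0 a0 by (simp add: ennreal_mult)
    then have "enn2real (ennreal (\<Lambda> * a i)) \<le> enn2real (energy k (\<phi> i))"
      using e\<phi> by (rule enn2real_mono)
    then have "\<Lambda> * a i \<le> enn2real (energy k (\<phi> i))"
      using \<Lambda>0 a0 by simp
    also have "\<dots> = energy_form k (\<phi> i) (\<phi> i)"
      using e\<phi>[of i] by (intro energy_form_self[symmetric] k_finite) simp_all
    also have "\<dots> \<le> - energy_form k (w i) (\<phi> i)"
      using f\<phi>[of i] by simp
    also have "energy_form k (w i) (\<phi> i) = (LINT x|lborel. F i x * \<phi> i x)"
    proof -
      have "indicator \<Omega> x *\<^sub>R (F i x * \<phi> i x) = F i x * \<phi> i x" for x
        using \<phi>\<Omega>[of x i] by (cases "x \<in> \<Omega>") auto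
      then show ?thesis using weak[OF es] by (simp only: set_lebesgue_integral_def)
    qed
    also have "- (LINT x|lborel. F i x * \<phi> i x) = (LINT x|lborel. - (F i x * \<phi> i x))"
      by simp
    also have "\<dots> \<le> (LINT x|lborel. L * (\<Sum>j\<in>UNIV. (\<phi> j x * \<phi> j x + \<phi> i x * \<phi> i x) / 2))"
    proof (rule integral_mono)
      show "integrable lborel (\<lambda>x. - (F i x * \<phi> i x))" using intF by simp
      show "integrable lborel (\<lambda>x. L * (\<Sum>j\<in>UNIV. (\<phi> j x * \<phi> j x + \<phi> i x * \<phi> i x) / 2))"
        by (intro integrable_mult_right Bochner_Integration.integrable_sum integrable_divide Bochner_Integration.integrable_add int)
      fix x
      have ab: "\<phi> j x * \<phi> i x \<le> (\<phi> j x * \<phi> j x + \<phi> i x * \<phi> i x) / 2" for j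
        using sum_squares_bound[of "\<phi> j x" "\<phi> i x"] by (simp add: power2_eq_square)
      have "- (F i x * \<phi> i x) \<le> L * (\<Sum>j\<in>UNIV. \<phi> j x * \<phi> i x)"
      proof (cases "\<phi> i x = 0")
        case False
        then have x: "x \<bullet> z > 0" "w i x < 0" by (auto simp: \<phi>_def split: if_splits)
        then have "x \<in> \<Omega>" using w0 by force
        have "F i x \<ge> - L * (\<Sum>j\<in>UNIV. \<phi> j x)"
          using FL[OF \<open>x \<in> \<Omega>\<close> x] x(1) by (simp add: \<phi>_def)
        then have "F i x * \<phi> i x \<ge> (- L * (\<Sum>j\<in>UNIV. \<phi> j x)) * \<phi> i x"
          using \<phi>0 by (intro mult_right_mono)
        then show ?thesis by (simp add: sum_distrib_right mult.assoc)
      qed simp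
      also have "\<dots> \<le> L * (\<Sum>j\<in>UNIV. (\<phi> j x * \<phi> j x + \<phi> i x * \<phi> i x) / 2)"
        using L ab by (intro mult_left_mono sum_mono) auto
      finally show "- (F i x * \<phi> i x) \<le> L * (\<Sum>j\<in>UNIV. (\<phi> j x * \<phi> j x + \<phi> i x * \<phi> i x) / 2)" .
    qed
    also have "\<dots> = L * (\<Sum>j\<in>UNIV. (a j + a i) / 2)"
      using int by (simp add: a_def Bochner_Integration.integral_sum)
    finally show ?thesis .
  qed
  \<comment> \<open>Summed over \<open>i\<close>, the right-hand sides amount to
    \<open>L * CARD('m) * S\<close>, so the surplus 1 in \<Lambda> forces
    \<open>S \<le> 0\<close>.\<close>
  define S where "S = (\<Sum>i\<in>UNIV. a i)"
  have "\<Lambda> * S \<le> (\<Sum>i\<in>UNIV. L * (\<Sum>j\<in>UNIV. (a j + a i) / 2))"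
    unfolding S_def sum_distrib_left[of \<Lambda>] by (rule sum_mono) (rule each)
  also have "\<dots> = L * ((\<Sum>i\<in>UNIV. \<Sum>j\<in>UNIV. a j + a i) / 2)"
    by (simp add: sum_distrib_left sum_divide_distrib)
  also have "(\<Sum>i\<in>(UNIV::'m set). \<Sum>j\<in>(UNIV::'m set). a j + a i) = 2 * (CARD('m) * S)"
    by (simp add: sum.distrib S_def sum_distrib_left[symmetric])
  finally have "S \<le> 0" by (simp add: \<Lambda>_def algebra_simps)
  then have "a i = 0"
    using a0 sum_nonneg_eq_0_iff[of UNIV a] sum_nonneg[of UNIV a] by (simp add: S_def)
  then have "AE x in lborel. \<phi> i x * \<phi> i x = 0"
    unfolding a_def using integral_nonneg_eq_0_iff_AE[OF int[of i i]] by simp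
  then have "{x. x \<bullet> z > 0} \<inter> {x. w i x < 0} = {}"
    using cw by (intro open_null_empty open_Int open_Collect_less continuous_intros)
      (auto elim!: eventually_mono simp: \<phi>_def)
  then show ?thesis using x by force
qed

end

subsection \<open>Cooperative nonlinearities\<close>

text \<open>At \<open>r = 0\<close> the joint derivative is one-sided in \<open>r\<close> only;
  along the slice \<open>v\<close> moves freely, so the chain rule gives a full derivative in
  \<open>v\<close>.\<close>

lemma C1_on_slice:
  fixes f :: "real \<Rightarrow> real^'m \<Rightarrow> real"
  assumes "C1_on ({0..} \<times> UNIV) (\<lambda>(r, v). f r v)"
  obtains D :: "real \<times> (real^'m) \<Rightarrow> (real^'m) \<Rightarrow>\<^sub>L real" where
    "\<And>r v. r \<ge> 0 \<Longrightarrow> (f r has_derivative blinfun_apply (D (r, v))) (at v)"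
    "continuous_on ({0..} \<times> UNIV) D"
proof -
  obtain g' :: "real \<times> (real^'m) \<Rightarrow> (real \<times> (real^'m)) \<Rightarrow>\<^sub>L real"
    where g': "\<And>p. p \<in> {0..} \<times> UNIV \<Longrightarrow>
        ((\<lambda>(r, v). f r v) has_derivative blinfun_apply (g' p)) (at p within {0..} \<times> UNIV)"
      and cg: "continuous_on ({0..} \<times> UNIV) g'"
    using assms unfolding C1_on_def by blast
  define I :: "(real^'m) \<Rightarrow>\<^sub>L (real \<times> (real^'m))" where "I = Blinfun (\<lambda>h. (0, h))"
  have bl: "bounded_linear (\<lambda>h::real^'m. (0::real, h))"
    by (intro bounded_linear_Pair bounded_linear_zero bounded_linear_ident)
  have I: "blinfun_apply I h = (0, h)" for h
    unfolding I_def by (simp add: bounded_linear_Blinfun_apply[OF bl])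
  show ?thesis
  proof
    show "(f r has_derivative blinfun_apply (g' (r, v) o\<^sub>L I)) (at v)" if "r \<ge> 0" for r v
    proof -
      have "((\<lambda>v. (r, v)) has_derivative (\<lambda>h. (0, h))) (at v)"
        by (auto intro!: derivative_eq_intros)
      moreover have "((\<lambda>(r, v). f r v) has_derivative blinfun_apply (g' (r, v))) (at (r, v) within range (\<lambda>v. (r, v)))"
        using that by (intro has_derivative_subset[OF g']) auto
      ultimately have "((\<lambda>v. case (r, v) of (r, v) \<Rightarrow> f r v) has_derivative (\<lambda>h. g' (r, v) (0, h))) (at v)"
        using has_derivative_in_compose[of "\<lambda>v. (r, v)" "\<lambda>h. (0, h)" v UNIV "\<lambda>(r, v). f r v" "g' (r, v)"] by blast
      moreover have "blinfun_apply (g' (r, v) o\<^sub>L I) = (\<lambda>h. g' (r, v) (0, h))"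
        by (rule ext) (simp add: I)
      ultimately show ?thesis by simp
    qed
    show "continuous_on ({0..} \<times> UNIV) (\<lambda>p. g' p o\<^sub>L I)"
      by (intro continuous_intros cg)
  qed
qed

text \<open>Along the segment the derivative is a combination of partial derivatives with weights
  \<open>h $ i\<close>; the diagonal one, of unknown sign, drops out because
  \<open>h $ j = 0\<close>.\<close>

lemma cooperative_less:
  fixes f :: "real \<Rightarrow> real^'m \<Rightarrow> real"
  assumes C1: "C1_on ({0..} \<times> UNIV) (\<lambda>(r, v). f r v)"
    and coop: "\<And>i v. i \<noteq> j \<Longrightarrow> partial_deriv i (f r) v > 0"
    and r: "r \<ge> 0" and hj: "h $ j = 0" and h: "\<And>i. h $ i \<ge> 0" and h0: "h \<noteq> 0"
  shows "f r v < f r (v + h)"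
proof -
  obtain D :: "real \<times> (real^'m) \<Rightarrow> (real^'m) \<Rightarrow>\<^sub>L real"
    where D: "\<And>v. (f r has_derivative blinfun_apply (D (r, v))) (at v)"
    using C1_on_slice[OF C1] r by metis
  have line: "((\<lambda>s. f r (v + s *\<^sub>R e)) has_real_derivative D (r, v + s *\<^sub>R e) e) (at s)" for s v e
  proof -
    have "((\<lambda>s. f r (v + s *\<^sub>R e)) has_derivative (\<lambda>t. D (r, v + s *\<^sub>R e) (t *\<^sub>R e))) (at s)"
      by (rule has_derivative_compose[OF _ D]) (auto intro!: derivative_eq_intros)
    moreover have "(\<lambda>t. D (r, v + s *\<^sub>R e) (t *\<^sub>R e)) = (*) (D (r, v + s *\<^sub>R e) e)"
      by (rule ext) (simp add: blinfun.scaleR_right)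
    ultimately show ?thesis
      by (simp add: has_field_derivative_def)
  qed
  have pos: "D (r, v) (axis i 1) > 0" if "i \<noteq> j" for i v
    using coop[OF that, of v] DERIV_imp_deriv[OF line[of v "axis i 1" 0]] by (simp add: partial_deriv_def)
  have Dh: "D (r, v) h > 0" for v
  proof -
    obtain i where i: "h $ i \<noteq> 0" using h0 by (auto simp: vec_eq_iff)
    have "h = (\<Sum>i\<in>UNIV. h $ i *\<^sub>R axis i 1)"
      using basis_expansion[of h] by (simp add: scalar_mult_eq_scaleR)
    then have "D (r, v) h = D (r, v) (\<Sum>i\<in>UNIV. h $ i *\<^sub>R axis i 1)" by simp
    also have "\<dots> = (\<Sum>i\<in>UNIV. h $ i * D (r, v) (axis i 1))"
      by (simp add: blinfun.sum_right blinfun.scaleR_right)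
    also have "\<dots> > 0"
    proof (rule sum_pos2[of _ i])
      show "0 < h $ i * D (r, v) (axis i 1)"
        using i h[of i] hj pos[of i v] by (cases "i = j") (auto simp: less_le)
      show "0 \<le> h $ l * D (r, v) (axis l 1)" for l
        using h[of l] hj pos[of l v] by (cases "l = j") (auto intro: less_imp_le)
    qed auto
    finally show ?thesis .
  qed
  have "f r (v + 0 *\<^sub>R h) < f r (v + 1 *\<^sub>R h)"
  proof (rule DERIV_pos_imp_increasing[of 0 1 "\<lambda>s. f r (v + s *\<^sub>R h)"])
    show "\<exists>y. ((\<lambda>s. f r (v + s *\<^sub>R h)) has_real_derivative y) (at s) \<and> y > 0" for s
      using line[of v h s] Dh by blast
  qed simp
  then show ?thesis by simp
qed

text \<open>Pass through the componentwise minimum \<open>m\<close> of \<open>v\<close> and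
  \<open>v'\<close>. From \<open>m\<close> to \<open>v\<close> only components other than
  \<open>j\<close> grow, which cooperation controls; from \<open>m\<close> to \<open>v'\<close> a
  Lipschitz bound costs exactly the positive parts of \<open>v' - v\<close>.\<close>

lemma cooperative_lower_bound:
  fixes f :: "real \<Rightarrow> real^'m \<Rightarrow> real"
  assumes C1: "C1_on ({0..} \<times> UNIV) (\<lambda>(r, v). f r v)"
    and coop: "\<And>i r v. i \<noteq> j \<Longrightarrow> r \<ge> 0 \<Longrightarrow> partial_deriv i (f r) v > 0"
  obtains L where "L \<ge> 0" and "\<And>r v v'. 0 \<le> r \<Longrightarrow> r \<le> R \<Longrightarrow> (\<And>i. \<bar>v $ i\<bar> \<le> b) \<Longrightarrow> (\<And>i. \<bar>v' $ i\<bar> \<le> b) \<Longrightarrow>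
      v $ j \<le> v' $ j \<Longrightarrow> f r v - f r v' \<ge> - L * (\<Sum>i\<in>UNIV. max 0 (v' $ i - v $ i))"
proof -
  obtain D :: "real \<times> (real^'m) \<Rightarrow> (real^'m) \<Rightarrow>\<^sub>L real"
    where D: "\<And>r v. r \<ge> 0 \<Longrightarrow> (f r has_derivative blinfun_apply (D (r, v))) (at v)"
      and cD: "continuous_on ({0..} \<times> UNIV) D"
    using C1_on_slice[OF C1] by metis
  define B where "B = CARD('m) * b"
  have "bounded (D ` ({0..R} \<times> cball 0 B))"
    by (intro compact_imp_bounded compact_continuous_image continuous_on_subset[OF cD] compact_Times) auto
  then obtain L0 where L0: "\<And>p. p \<in> {0..R} \<times> cball 0 B \<Longrightarrow> norm (D p) \<le> L0"
    unfolding bounded_iff by (metis imageI)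
  define L where "L = max 0 L0"
  have L: "L \<ge> 0" by (simp add: L_def)
  have inB: "v \<in> cball 0 B" if "\<And>i. \<bar>v $ i\<bar> \<le> b" for v :: "real^'m"
  proof -
    have "norm v \<le> (\<Sum>i\<in>UNIV. \<bar>v $ i\<bar>)" by (rule norm_le_l1_cart)
    also have "\<dots> \<le> (\<Sum>i\<in>(UNIV::'m set). b)" using that by (intro sum_mono) auto
    finally show ?thesis by (simp add: B_def)
  qed
  show ?thesis
  proof
    show "L \<ge> 0" by fact
    fix r and v v' :: "real^'m"
    assume r: "0 \<le> r" "r \<le> R" and v: "\<And>i. \<bar>v $ i\<bar> \<le> b" "\<And>i. \<bar>v' $ i\<bar> \<le> b" and j: "v $ j \<le> v' $ j"
    define m where "m = (\<chi> i. min (v $ i) (v' $ i))"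
    have "f r m \<le> f r v"
    proof (cases "m = v")
      case False
      have "f r m < f r (m + (v - m))"
        using j False r by (intro cooperative_less[OF C1, of j]) (auto simp: m_def coop)
      then show ?thesis by simp
    qed simp
    moreover have "norm (f r v' - f r m) \<le> L * norm (v' - m)"
    proof (rule differentiable_bound[of "cball 0 B"])
      show "(f r has_derivative blinfun_apply (D (r, x))) (at x within cball 0 B)" for x
        using D[OF r(1)] by (rule has_derivative_at_withinI)
      show "onorm (blinfun_apply (D (r, x))) \<le> L" if "x \<in> cball 0 B" for x
        using L0[of "(r, x)"] that r by (simp add: norm_blinfun.rep_eq[symmetric] L_def)
      show "m \<in> cball 0 B" using v by (intro inB) (auto simp: m_def min_def)
      show "v' \<in> cball 0 B" using v by (intro inB)
    qed auto
    moreover have "norm (v' - m) \<le> (\<Sum>i\<in>UNIV. max 0 (v' $ i - v $ i))"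
    proof -
      have "norm (v' - m) \<le> (\<Sum>i\<in>UNIV. \<bar>(v' - m) $ i\<bar>)" by (rule norm_le_l1_cart)
      also have "\<dots> = (\<Sum>i\<in>UNIV. max 0 (v' $ i - v $ i))"
        by (intro sum.cong) (auto simp: m_def)
      finally show ?thesis .
    qed
    then have "L * norm (v' - m) \<le> L * (\<Sum>i\<in>UNIV. max 0 (v' $ i - v $ i))"
      using L by (rule mult_left_mono)
    ultimately show "f r v - f r v' \<ge> - L * (\<Sum>i\<in>UNIV. max 0 (v' $ i - v $ i))"
      by (simp add: abs_le_iff)
  qed
qed

subsection \<open>Radial domains\<close>

text \<open>In dimension at least two some rotation takes \<open>x\<close> to any point of the same
  norm; in dimension one the identity is the only rotation.\<close>

lemma radial_domain_sphere:
  fixes \<Omega> :: "(real^'n) set"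
  assumes "CARD('n) \<ge> 2" "radial_domain \<Omega>" "x \<in> \<Omega>" "norm y = norm x"
  shows "y \<in> \<Omega>"
proof -
  obtain g where g: "orthogonal_transformation g" "det (matrix g) = 1" "g x = y"
    using rotation_exists[of x y] assms by metis
  then have "rotation_matrix (matrix g)"
    by (simp add: rotation_matrix_def orthogonal_transformation_matrix)
  then have "(\<lambda>x. matrix g *v x) ` \<Omega> = \<Omega>"
    using assms by (simp add: radial_domain_def)
  moreover have "matrix g *v x = y"
    using g by (simp add: matrix_works orthogonal_transformation_linear)
  ultimately show ?thesis using assms by blast
qed

text \<open>In polar coordinates this half is the image of an interval of radii times an open
  half-sphere.\<close>

lemma connected_radial_half:
  fixes \<Omega> :: "(real^'n) set"
  assumes N: "CARD('n) \<ge> 2" and rad: "radial_domain \<Omega>"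
  shows "connected (\<Omega> \<inter> {x. x \<bullet> z > 0})"
proof -
  let ?H = "{x::real^'n. x \<bullet> z > 0}"
  define J where "J = norm ` \<Omega> \<inter> {0<..}"
  define S where "S = (\<lambda>x. x /\<^sub>R norm x) ` ?H"
  have "connected (norm ` \<Omega>)"
    using rad by (intro connected_continuous_image continuous_intros) (simp add: radial_domain_def)
  then have J: "connected J"
    unfolding J_def is_interval_connected_1[symmetric] by (intro is_interval_Int) (auto simp: is_interval_def)
  have "convex ?H"
    using convex_halfspace_gt[of 0 z] by (simp add: inner_commute)
  then have S: "connected S"
    unfolding S_def by (intro connected_continuous_image convex_connected continuous_intros) auto
  have "\<Omega> \<inter> ?H = (\<lambda>(r, v). r *\<^sub>R v) ` (J \<times> S)"
  proof (intro set_eqI iffI)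
    fix x assume x: "x \<in> \<Omega> \<inter> ?H"
    then have "x \<noteq> 0" by auto
    then have "x = (\<lambda>(r, v). r *\<^sub>R v) (norm x, x /\<^sub>R norm x)" by simp
    moreover have "(norm x, x /\<^sub>R norm x) \<in> J \<times> S" using x \<open>x \<noteq> 0\<close> by (auto simp: J_def S_def)
    ultimately show "x \<in> (\<lambda>(r, v). r *\<^sub>R v) ` (J \<times> S)" by (rule image_eqI)
  next
    fix x assume "x \<in> (\<lambda>(r, v). r *\<^sub>R v) ` (J \<times> S)"
    then obtain y a where ya: "y \<in> \<Omega>" "norm y > 0" "a \<bullet> z > 0" "x = norm y *\<^sub>R (a /\<^sub>R norm a)"
      by (auto simp: J_def S_def)
    then have "a \<noteq> 0" by auto
    then have "norm x = norm y" "x \<bullet> z > 0" using ya by auto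
    then show "x \<in> \<Omega> \<inter> ?H" using radial_domain_sphere[OF N rad ya(1)] by simp
  qed
  moreover have "connected ((\<lambda>(r, v). r *\<^sub>R v) ` (J \<times> S))"
    unfolding case_prod_beta by (intro connected_continuous_image connected_Times J S continuous_intros)
  ultimately show ?thesis by simp
qed

lemma continuous_on_mirror: "continuous_on A (mirror z)"
  using linear_mirror by (intro linear_continuous_on linear_conv_bounded_linear[THEN iffD1])

lemma mirror_minus: "mirror (- z) x = mirror z x"
  by (simp add: mirror_def)

lemma continuous_on_mirror_pair:
  "continuous_on {p. fst p \<noteq> 0} (\<lambda>p. mirror (fst p) (snd p))"
  unfolding mirror_def by (intro continuous_intros) auto

subsection \<open>Reflected solutions of the system\<close>

locale cooperative_system = levy_kernel k
  for k :: "real^'n \<Rightarrow> ennreal" +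
  fixes \<Omega> :: "(real^'n) set" and f :: "'m::finite \<Rightarrow> real \<Rightarrow> real^'m \<Rightarrow> real"
    and u :: "'m \<Rightarrow> real^'n \<Rightarrow> real"
  assumes N2: "CARD('n) \<ge> 2"
    and bdd: "bounded \<Omega>" and rad: "radial_domain \<Omega>"
    and C1: "\<And>i. C1_on ({0..} \<times> UNIV) (\<lambda>(r, v). f i r v)"
    and coop: "\<And>i j r v. i \<noteq> j \<Longrightarrow> r \<ge> 0 \<Longrightarrow> partial_deriv i (f j r) v > 0"
    and cu: "\<And>i. continuous_on UNIV (u i)"
    and weak_u: "weak_solution k \<Omega> f u"
    and u0: "\<And>i x. x \<notin> \<Omega> \<Longrightarrow> u i x = 0"
begin

definition w :: "real^'n \<Rightarrow> 'm \<Rightarrow> real^'n \<Rightarrow> real" where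
  "w z i x = u i x - u i (mirror z x)"

definition rhs :: "'m \<Rightarrow> real^'n \<Rightarrow> real" where
  "rhs i x = f i (norm x) (\<chi> j. u j x)"

text \<open>The right-hand side of the equation for \<open>w z i\<close>. It is used only through
  its sign at zeros of \<open>w z i\<close> and a one-sided bound where \<open>w z i\<close> is
  negative, besides continuity.\<close>

definition F :: "real^'n \<Rightarrow> 'm \<Rightarrow> real^'n \<Rightarrow> real" where
  "F z i x = rhs i x - rhs i (mirror z x)"

lemma open_\<Omega>: "open \<Omega>"
  using rad by (simp add: radial_domain_def)

text \<open>A reflection in a hyperplane has determinant -1 and is not a rotation, so invariance is
  obtained from whole spheres.\<close>

lemma mirror_\<Omega>: "mirror z x \<in> \<Omega> \<longleftrightarrow> x \<in> \<Omega>"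
  using radial_domain_sphere[OF N2 rad, of x "mirror z x"] radial_domain_sphere[OF N2 rad, of "mirror z x" x] by auto

lemma w_mirror: "w z i (mirror z x) = - w z i x"
  by (simp add: w_def)

lemma w_outside: "x \<notin> \<Omega> \<Longrightarrow> w z i x = 0"
  using mirror_\<Omega> by (simp add: w_def u0)

lemma w_boundary: "x \<bullet> z = 0 \<Longrightarrow> w z i x = 0"
  by (simp add: w_def mirror_fixed)

lemma w_minus: "w (- z) i x = w z i x"
  by (simp add: w_def mirror_minus)

lemma continuous_on_w: "continuous_on UNIV (w z i)"
  unfolding w_def[abs_def]
  by (intro continuous_intros cu continuous_on_compose2[OF cu continuous_on_mirror]) auto

lemma continuous_on_rhs: "continuous_on UNIV (rhs i)"
proof -
  obtain g' :: "real \<times> (real^'m) \<Rightarrow> (real \<times> (real^'m)) \<Rightarrow>\<^sub>L real"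
    where "\<And>p. p \<in> {0..} \<times> UNIV \<Longrightarrow>
        ((\<lambda>(r, v). f i r v) has_derivative blinfun_apply (g' p)) (at p within {0..} \<times> UNIV)"
    using C1[of i] unfolding C1_on_def by blast
  then have "continuous_on ({0..} \<times> UNIV) (\<lambda>(r, v). f i r v)"
    by (rule has_derivative_continuous_on)
  then have "continuous_on UNIV (\<lambda>x. (\<lambda>(r, v). f i r v) (norm x, \<chi> j. u j x))"
    by (rule continuous_on_compose2) (auto intro!: continuous_intros cu)
  then show ?thesis by (simp add: rhs_def[abs_def])
qed

lemma continuous_on_F: "continuous_on UNIV (F z i)"
  unfolding F_def[abs_def]
  by (intro continuous_intros continuous_on_rhs continuous_on_compose2[OF continuous_on_rhs continuous_on_mirror]) auto

lemma u_measurable [measurable]: "u i \<in> borel_measurable borel"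
  using cu by (rule borel_measurable_continuous_onI)

lemma energy_u: "energy k (u i) < top"
  using weak_u by (simp add: weak_solution_def energy_space_def)

lemma energy_w: "energy k (w z i) < top"
proof (rule energy_dominated[of "u i" "\<lambda>x. u i (mirror z x)" "w z i", unfolded infinity_ennreal_def])
  show "\<bar>w z i x - w z i y\<bar> \<le> \<bar>u i x - u i y\<bar> + \<bar>u i (mirror z x) - u i (mirror z y)\<bar>" for x y
    unfolding w_def by linarith
  show "w z i \<in> borel_measurable borel" unfolding w_def[abs_def] by measurable
qed (simp_all add: energy_u energy_mirror)

lemma energy_space_mirror:
  assumes "\<phi> \<in> energy_space k \<Omega>"
  shows "(\<lambda>x. \<phi> (mirror z x)) \<in> energy_space k \<Omega>"
proof -
  have [measurable]: "\<phi> \<in> borel_measurable borel" using assms by (simp add: energy_space_def)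
  have "AE x in distr lborel borel (mirror z). x \<notin> \<Omega> \<longrightarrow> \<phi> x = 0"
    unfolding lborel_distr_isometry[OF linear_mirror norm_mirror] using assms by (simp add: energy_space_def)
  then have "AE x in lborel. mirror z x \<notin> \<Omega> \<longrightarrow> \<phi> (mirror z x) = 0"
    by (rule AE_distrD[rotated]) simp
  moreover have "integrable lborel (\<lambda>x. (\<phi> (mirror z x))\<^sup>2)"
    using assms integrable_isometry[OF linear_mirror norm_mirror, of "\<lambda>x. (\<phi> x)\<^sup>2"]
    by (simp add: energy_space_def)
  ultimately show ?thesis
    using assms by (simp add: energy_space_def mirror_\<Omega> energy_mirror)
qed

lemma integrable_test:
  assumes "continuous_on UNIV g" "\<phi> \<in> energy_space k \<Omega>"
  shows "set_integrable lborel \<Omega> (\<lambda>x. g x * \<phi> x)"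
proof -
  have [measurable]: "\<phi> \<in> borel_measurable borel" using assms by (simp add: energy_space_def)
  have [measurable]: "g \<in> borel_measurable borel" using assms by (simp add: borel_measurable_continuous_onI)
  have [measurable]: "\<Omega> \<in> sets borel" using open_\<Omega> by simp
  obtain a where a: "a \<ge> 0" "\<And>x. x \<in> \<Omega> \<Longrightarrow> \<bar>g x\<bar> \<le> a"
    using continuous_bounded_on_bounded[OF assms(1) bdd] by blast
  show ?thesis
    unfolding set_integrable_def
  proof (rule Bochner_Integration.integrable_bound)
    show "integrable lborel (\<lambda>x. a * (indicator \<Omega> x + (\<phi> x)\<^sup>2))"
      using assms bdd
      by (intro integrable_mult_right Bochner_Integration.integrable_add integrable_real_indicator emeasure_bounded_finite)
         (simp_all add: energy_space_def)
    show "AE x in lborel. norm (indicator \<Omega> x *\<^sub>R (g x * \<phi> x)) \<le> norm (a * (indicator \<Omega> x + (\<phi> x)\<^sup>2))"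
    proof (intro AE_I2)
      fix x
      show "norm (indicator \<Omega> x *\<^sub>R (g x * \<phi> x)) \<le> norm (a * (indicator \<Omega> x + (\<phi> x)\<^sup>2))"
      proof (cases "x \<in> \<Omega>")
        case True
        have "2 * \<bar>\<phi> x\<bar> \<le> (\<phi> x)\<^sup>2 + 1"
          using sum_squares_bound[of "\<bar>\<phi> x\<bar>" 1] by simp
        then have "\<bar>\<phi> x\<bar> \<le> 1 + (\<phi> x)\<^sup>2" using abs_ge_zero[of "\<phi> x"] by linarith
        then have "\<bar>g x\<bar> * \<bar>\<phi> x\<bar> \<le> a * (1 + (\<phi> x)\<^sup>2)" using a True by (intro mult_mono) auto
        then show ?thesis using True a by (simp add: abs_mult)
      qed simp
    qed
    show "(\<lambda>x. indicator \<Omega> x *\<^sub>R (g x * \<phi> x)) \<in> borel_measurable lborel" by measurable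
  qed
qed

text \<open>The test space is invariant under reflection, so the reflected function is tested by
  reflecting the test function and changing variables on \<Omega>.\<close>

lemma weak_w:
  assumes \<phi>: "\<phi> \<in> energy_space k \<Omega>"
  shows "energy_form k (w z i) \<phi> = (LINT x:\<Omega>|lborel. F z i x * \<phi> x)"
proof -
  have m [measurable]: "\<phi> \<in> borel_measurable borel" and e: "energy k \<phi> < top"
    using \<phi> by (simp_all add: energy_space_def)
  have [measurable]: "rhs i \<in> borel_measurable borel"
    using continuous_on_rhs by (rule borel_measurable_continuous_onI)
  have [measurable]: "\<Omega> \<in> sets borel" using open_\<Omega> by simp
  have cm: "continuous_on UNIV (\<lambda>x. rhs i (mirror z x))"
    by (intro continuous_on_compose2[OF continuous_on_rhs continuous_on_mirror]) auto
  have wk: "energy_form k (u i) \<psi> = (LINT x:\<Omega>|lborel. rhs i x * \<psi> x)" if "\<psi> \<in> energy_space k \<Omega>" for \<psi>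
    using weak_u that by (simp add: weak_solution_def rhs_def)
  have "energy_form k (w z i) \<phi> = energy_form k (u i) \<phi> - energy_form k (\<lambda>x. u i (mirror z x)) \<phi>"
    unfolding w_def[abs_def] using e by (intro energy_form_diff) (simp_all add: energy_u energy_mirror)
  also have "energy_form k (\<lambda>x. u i (mirror z x)) \<phi> = energy_form k (u i) (\<lambda>x. \<phi> (mirror z x))"
    using e by (intro energy_form_mirror) (simp_all add: energy_u)
  also have "\<dots> = (LINT x:\<Omega>|lborel. rhs i x * \<phi> (mirror z x))"
    by (rule wk[OF energy_space_mirror[OF \<phi>]])
  also have "\<dots> = (LINT x:\<Omega>|lborel. rhs i (mirror z x) * \<phi> x)"
  proof -
    have "indicator \<Omega> (mirror z x) = (indicator \<Omega> x :: real)" for x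
      by (simp add: indicator_def mirror_\<Omega>)
    then show ?thesis
      using integral_isometry[OF linear_mirror norm_mirror, of "\<lambda>x. indicator \<Omega> x *\<^sub>R (rhs i x * \<phi> (mirror z x))" z]
      by (simp add: set_lebesgue_integral_def)
  qed
  also have "energy_form k (u i) \<phi> = (LINT x:\<Omega>|lborel. rhs i x * \<phi> x)" by (rule wk[OF \<phi>])
  also have "(LINT x:\<Omega>|lborel. rhs i x * \<phi> x) - (LINT x:\<Omega>|lborel. rhs i (mirror z x) * \<phi> x) =
      (LINT x:\<Omega>|lborel. rhs i x * \<phi> x - rhs i (mirror z x) * \<phi> x)"
    by (rule set_integral_diff(2)[symmetric] integrable_test continuous_on_rhs cm \<phi>)+
  finally show ?thesis by (simp add: F_def left_diff_distrib)
qed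

text \<open>At a zero of component \<open>i\<close> the two value vectors agree in entry
  \<open>i\<close>, and the radial argument is the same because reflections preserve the norm.
  Strict cooperation then decides both claims.\<close>

lemma F_nonneg:
  assumes "\<And>j. w z j x \<ge> 0" "w z i x = 0"
  shows "F z i x \<ge> 0" and "F z i x = 0 \<Longrightarrow> w z j x = 0"
proof -
  define v where "v = (\<chi> j. u j (mirror z x))"
  define h where "h = (\<chi> j. w z j x)"
  have vh: "v + h = (\<chi> j. u j x)" by (simp add: v_def h_def w_def vec_eq_iff)
  have F: "F z i x = f i (norm x) (v + h) - f i (norm x) v"
    by (simp add: F_def rhs_def vh) (simp add: v_def)
  have less: "F z i x > 0" if "h \<noteq> 0"
  proof -
    have "f i (norm x) v < f i (norm x) (v + h)"
      using that assms by (intro cooperative_less[OF C1[of i], of i]) (auto simp: coop h_def)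
    then show ?thesis by (simp add: F)
  qed
  show "F z i x \<ge> 0"
    using less F by (cases "h = 0") auto
  show "w z j x = 0" if "F z i x = 0"
  proof -
    have "h = 0" using less that by force
    then show ?thesis by (simp add: h_def vec_eq_iff)
  qed
qed

definition dominating :: "(real^'n) set" where
  "dominating = {z. z \<noteq> 0 \<and> (\<forall>i. \<forall>x\<in>\<Omega>. x \<bullet> z > 0 \<longrightarrow> w z i x > 0)}"

text \<open>Zeros of one component in the open half of \<Omega> form a closed set, and an open one
  by the local maximum principle; connectedness leaves all or none. If all, \<open>F z i\<close>
  vanishes as well and \<open>F_nonneg\<close> carries the vanishing over to the other
  components.\<close>

lemma dominating_dichotomy:
  assumes z: "z \<noteq> 0" and nonneg: "\<And>i x. x \<bullet> z > 0 \<Longrightarrow> w z i x \<ge> 0"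
  shows "(\<forall>i x. w z i x = 0) \<or> z \<in> dominating"
proof (rule ccontr)
  assume no: "\<not> ?thesis"
  have nonneg': "w z i x \<ge> 0" if "x \<bullet> z \<ge> 0" for i x
    using nonneg[of x i] w_boundary[of x z i] that by (cases "x \<bullet> z = 0") auto
  obtain i x0 where x0: "x0 \<in> \<Omega>" "x0 \<bullet> z > 0" "w z i x0 = 0"
    using no z nonneg by (force simp: dominating_def not_less intro: antisym)
  have smp: "F z i x = 0 \<and> (\<exists>\<rho>>0. \<forall>y. norm (y - x) < \<rho> \<longrightarrow> w z i y = 0)"
    if "x \<in> \<Omega>" "x \<bullet> z > 0" "w z i x = 0" for x
  proof (rule strong_maximum_principle[OF continuous_on_w energy_w w_mirror nonneg' that _ open_\<Omega> continuous_on_F weak_w])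
    show "F z i x \<ge> 0" using that by (intro F_nonneg(1) nonneg') auto
  qed auto
  let ?S = "\<Omega> \<inter> {x. x \<bullet> z > 0}"
  let ?T = "?S \<inter> {x. w z i x = 0}"
  have oS: "open ?S"
    using open_\<Omega> by (intro open_Int open_Collect_less continuous_intros)
  have "closed {x. w z i x = 0}"
    by (intro closed_Collect_eq continuous_on_w continuous_intros)
  then have "closedin (top_of_set ?S) ?T"
    by (rule closedin_closed_Int)
  moreover have "open ?T"
    unfolding open_dist dist_norm
  proof
    fix x assume x: "x \<in> ?T"
    then obtain \<rho> where \<rho>: "\<rho> > 0" "\<And>y. norm (y - x) < \<rho> \<Longrightarrow> w z i y = 0" using smp[of x] by auto
    obtain e where e: "e > 0" "\<And>y. norm (y - x) < e \<Longrightarrow> y \<in> ?S"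
      using oS x unfolding open_dist dist_norm by blast
    show "\<exists>e>0. \<forall>y. norm (y - x) < e \<longrightarrow> y \<in> ?T"
      using \<rho> e by (intro exI[of _ "min \<rho> e"]) auto
  qed
  then have "openin (top_of_set ?S) ?T"
    by (intro open_subset) auto
  ultimately have "?T = {} \<or> ?T = ?S"
    using connected_radial_half[OF N2 rad] unfolding connected_clopen by blast
  then have T: "?T = ?S" using x0 by blast
  have half: "w z j x = 0" if "x \<bullet> z > 0" for j x
  proof (cases "x \<in> \<Omega>")
    case True
    then have wi: "w z i x = 0" using T that by blast
    have "F z i x = 0" using smp[OF True that wi] by simp
    then show ?thesis using F_nonneg(2)[OF nonneg' wi] that by simp
  qed (rule w_outside)
  have "w z j x = 0" for j x
  proof (cases "x \<bullet> z < 0")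
    case True
    then show ?thesis using half[of "mirror z x" j] by (simp add: inner_mirror_normal w_mirror)
  next
    case False
    then show ?thesis using half w_boundary[of x z j] by (cases "x \<bullet> z = 0") auto
  qed
  then show False using no by blast
qed

text \<open>Uniformity in \<open>z\<close> is essential: \<open>L\<close> fixes the admissible
  measure of the exceptional set before a neighbourhood of directions is chosen.\<close>

lemma F_lower_bound:
  obtains L where "L \<ge> 0"
    "\<And>z i x. x \<in> \<Omega> \<Longrightarrow> w z i x < 0 \<Longrightarrow> F z i x \<ge> - L * (\<Sum>j\<in>UNIV. max 0 (- w z j x))"
proof -
  obtain R where R: "\<And>x. x \<in> \<Omega> \<Longrightarrow> norm x \<le> R" using bdd unfolding bounded_iff by blast
  from continuous_bounded_on_bounded[OF cu bdd] obtain b where b\<Omega>: "\<And>i. b i \<ge> 0" "\<And>i x. x \<in> \<Omega> \<Longrightarrow> \<bar>u i x\<bar> \<le> b i"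
    by metis
  have b: "\<bar>u i x\<bar> \<le> b i" for i x
    using b\<Omega> u0 by (cases "x \<in> \<Omega>") auto
  define B where "B = (\<Sum>i\<in>UNIV. \<bar>b i\<bar>)"
  define P where "P i l \<longleftrightarrow> l \<ge> 0 \<and> (\<forall>r v v'. 0 \<le> r \<longrightarrow> r \<le> R \<longrightarrow> (\<forall>j. \<bar>v $ j\<bar> \<le> B) \<longrightarrow>
      (\<forall>j. \<bar>v' $ j\<bar> \<le> B) \<longrightarrow> v $ i \<le> v' $ i \<longrightarrow>
      f i r v - f i r v' \<ge> - l * (\<Sum>j\<in>UNIV. max 0 (v' $ j - v $ j)))" for i l
  have b': "\<bar>u i x\<bar> \<le> B" for i x
    using b[of i x] member_le_sum[of i UNIV "\<lambda>i. \<bar>b i\<bar>"] by (simp add: B_def)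
  have "\<exists>l. P i l" for i
  proof (rule cooperative_lower_bound[OF C1[of i] coop, of i R B])
    fix l
    assume "l \<ge> 0" and "\<And>r v v'. 0 \<le> r \<Longrightarrow> r \<le> R \<Longrightarrow> (\<And>i. \<bar>v $ i\<bar> \<le> B) \<Longrightarrow> (\<And>i. \<bar>v' $ i\<bar> \<le> B) \<Longrightarrow>
      v $ i \<le> v' $ i \<Longrightarrow> - l * (\<Sum>i\<in>UNIV. max 0 (v' $ i - v $ i)) \<le> f i r v - f i r v'"
    then show "\<exists>l. P i l" unfolding P_def by blast
  qed auto
  then obtain L where P: "\<And>i. P i (L i)" by metis
  have L: "\<And>i. L i \<ge> 0" "\<And>i r v v'. 0 \<le> r \<Longrightarrow> r \<le> R \<Longrightarrow> (\<And>j. \<bar>v $ j\<bar> \<le> B) \<Longrightarrow>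
      (\<And>j. \<bar>v' $ j\<bar> \<le> B) \<Longrightarrow> v $ i \<le> v' $ i \<Longrightarrow>
      f i r v - f i r v' \<ge> - L i * (\<Sum>j\<in>UNIV. max 0 (v' $ j - v $ j))"
    using P unfolding P_def by blast+
  show ?thesis
  proof
    show "(\<Sum>i\<in>UNIV. L i) \<ge> 0" using L by (intro sum_nonneg) auto
    fix z i x assume x: "x \<in> \<Omega>" "w z i x < 0"
    let ?S = "\<Sum>j\<in>UNIV. max 0 (- w z j x)"
    have "F z i x \<ge> - L i * ?S"
      using L(2)[of "norm x" "\<chi> j. u j x" "\<chi> j. u j (mirror z x)" i] R x b' by (simp add: F_def rhs_def w_def)
    moreover have "L i * ?S \<le> (\<Sum>i\<in>UNIV. L i) * ?S"
      using L by (intro mult_right_mono member_le_sum sum_nonneg) auto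
    ultimately show "F z i x \<ge> - (\<Sum>i\<in>UNIV. L i) * ?S" by simp
  qed
qed

text \<open>For \<open>z\<close> close to a dominating \<open>z0\<close>, the functions \<open>w z i\<close> are positive on a large compact part of
  the half-space, so the maximum principle for small sets applies to the remainder.\<close>

lemma open_dominating:
  assumes ne: "\<Omega> \<noteq> {}"
  shows "open dominating"
proof (subst open_subopen, intro ballI)
  fix z0 assume z0: "z0 \<in> dominating"
  then have z00: "z0 \<noteq> 0" by (simp add: dominating_def)
  obtain L where L: "L \<ge> 0"
    "\<And>z i x. x \<in> \<Omega> \<Longrightarrow> w z i x < 0 \<Longrightarrow> F z i x \<ge> - L * (\<Sum>j\<in>UNIV. max 0 (- w z j x))"
    using F_lower_bound by blast
  have "L * CARD('m) + 1 \<ge> 0" using L(1) by simp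
  then obtain \<mu> where \<mu>: "\<mu> > 0"
    and poincare: "\<And>A \<phi>. A \<in> sets borel \<Longrightarrow> emeasure lborel A \<le> ennreal \<mu> \<Longrightarrow> \<phi> \<in> borel_measurable borel \<Longrightarrow>
      (\<And>x. x \<notin> A \<Longrightarrow> \<phi> x = 0) \<Longrightarrow>
      ennreal (L * CARD('m) + 1) * (\<integral>\<^sup>+x. ennreal ((\<phi> x)\<^sup>2) \<partial>lborel) \<le> energy k \<phi>"
    using poincare_small_support by blast
  \<comment> \<open>The functions \<open>w z0 i\<close> vanish on this hyperplane, so the compact
    set must avoid it; as a null set it does not count in the remainder.\<close>
  define P where "P = {x. z0 \<bullet> x = 0}"
  have clP: "closed P" unfolding P_def by (rule closed_hyperplane)
  have negP: "negligible P"
    unfolding P_def using z00 negligible_hyperplane by blast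
  have "\<Omega> - P \<in> sets lebesgue"
    using open_\<Omega> clP by (intro sets.Diff) (auto intro: sets_completionI_sets)
  then obtain T where T: "closed T" "T \<subseteq> \<Omega> - P" "emeasure lebesgue (\<Omega> - P - T) < ennreal \<mu>"
    using sets_lebesgue_inner_closed \<mu> by metis
  \<comment> \<open>Placed in \<open>K\<close>, this point later excludes the alternative that all
    differences vanish.\<close>
  obtain x1 where x1: "x1 \<in> \<Omega>" "x1 \<bullet> z0 > 0"
  proof -
    have "open \<Omega>" by (rule open_\<Omega>)
    then have "\<not> \<Omega> \<subseteq> {0}" using ne by (metis finite.emptyI finite_insert finite_subset not_open_singleton subset_singletonD)
    then obtain y where y: "y \<in> \<Omega>" "y \<noteq> 0" by auto
    have "(norm y / norm z0) *\<^sub>R z0 \<in> \<Omega>"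
      using y z00 by (intro radial_domain_sphere[OF N2 rad y(1)]) simp
    moreover have "(norm y / norm z0) *\<^sub>R z0 \<bullet> z0 > 0" using y z00 by simp
    ultimately show ?thesis using that by blast
  qed
  define K where "K = insert x1 T"
  have "bounded T" using T bdd by (meson Diff_subset bounded_subset order_trans)
  then have K: "compact K" unfolding K_def using T(1) by (intro compact_insert) (simp add: compact_eq_bounded_closed)
  have K\<Omega>: "x \<in> \<Omega>" "x \<bullet> z0 \<noteq> 0" if "x \<in> K" for x
    using that T x1 by (auto simp: K_def P_def inner_commute)
  define A where "A = \<Omega> - K"
  have A: "A \<in> sets borel" unfolding A_def using open_\<Omega> K by (intro sets.Diff) (auto simp: compact_imp_closed)
  have "emeasure lborel A = emeasure lebesgue A"
    using A by simp
  also have "\<dots> \<le> emeasure lebesgue ((\<Omega> - P - T) \<union> P)"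
    using open_\<Omega> clP T by (intro emeasure_mono) (auto simp: A_def K_def intro!: sets.Un sets.Diff intro: sets_completionI_sets)
  also have "\<dots> = emeasure lebesgue (\<Omega> - P - T)"
    using negP open_\<Omega> clP T
    by (intro emeasure_Un_null_set) (auto simp: negligible_iff_null_sets intro!: sets.Diff intro: sets_completionI_sets)
  also have "\<dots> \<le> ennreal \<mu>" using T by simp
  finally have A\<mu>: "emeasure lborel A \<le> ennreal \<mu>" .
  let ?Z = "{p :: (real^'n) \<times> (real^'n). fst p \<noteq> 0}"
  \<comment> \<open>Pairs of a direction and a point that is either strictly on the negative side or
    has all differences positive. This open set contains \<open>{z0} \<times> K\<close>, hence by
    compactness also \<open>X \<times> K\<close> for a neighbourhood \<open>X\<close> of
    \<open>z0\<close>.\<close>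
  define W where "W = ({p. fst p \<noteq> 0} \<inter> {p. snd p \<bullet> fst p < 0}) \<union>
     ({p. snd p \<bullet> fst p > 0} \<inter> (\<Inter>i. {p\<in>?Z. w (fst p) i (snd p) > 0}))"
  have "open W"
  proof -
    have oZ: "open ?Z" by (intro open_Collect_neq continuous_intros)
    have "open {p\<in>?Z. w (fst p) i (snd p) > 0}" for i
    proof -
      have c: "continuous_on ?Z (\<lambda>p. w (fst p) i (snd p))"
        unfolding w_def
        by (intro continuous_intros continuous_on_compose2[OF cu] continuous_on_mirror_pair) auto
      have "open (?Z \<inter> (\<lambda>p. w (fst p) i (snd p)) -` {0<..})"
        by (rule continuous_open_preimage[OF c oZ]) simp
      moreover have "?Z \<inter> (\<lambda>p. w (fst p) i (snd p)) -` {0<..} = {p\<in>?Z. w (fst p) i (snd p) > 0}" by auto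
      ultimately show ?thesis by simp
    qed
    then show ?thesis
      unfolding W_def using oZ
      by (intro open_Un open_Int open_INT finite open_Collect_less continuous_intros) auto
  qed
  moreover have "{z0} \<times> K \<subseteq> W"
  proof (clarify)
    fix x assume "x \<in> K"
    then show "(z0, x) \<in> W"
      using K\<Omega>[of x] z0 z00 by (cases "x \<bullet> z0 > 0") (auto simp: W_def dominating_def)
  qed
  ultimately obtain X where X: "z0 \<in> X" "open X" "X \<times> K \<subseteq> W"
    using Elementary_Topology.tube_lemma[OF K, of W z0] by blast
  have "X \<inter> {z. x1 \<bullet> z > 0} \<subseteq> dominating"
  proof
    fix z assume z: "z \<in> X \<inter> {z. x1 \<bullet> z > 0}"
    then have z': "z \<noteq> 0" by auto
    have wK: "w z i x > 0" if "x \<in> K" "x \<bullet> z > 0" for i x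
    proof -
      have "(z, x) \<in> W" using X(3) z that by blast
      then show ?thesis using that by (auto simp: W_def)
    qed
    have "w z i x \<ge> 0" if "x \<bullet> z > 0" for i x
    proof (rule small_domain_maximum_principle[where w = "w z" and F = "F z" and A = A and L = L and \<Omega> = \<Omega> and z = z])
      show "y \<in> A" if "y \<bullet> z > 0" "w z j y < 0" for j y
        using that wK[of y j] w_outside[of y z j] by (force simp: A_def)
      show "ennreal (L * CARD('m) + 1) * (\<integral>\<^sup>+x. ennreal ((\<phi> x)\<^sup>2) \<partial>lborel) \<le> energy k \<phi>"
        if "\<phi> \<in> borel_measurable borel" "\<And>x. x \<notin> A \<Longrightarrow> \<phi> x = 0" for \<phi>
        by (rule poincare[OF A A\<mu> that])
    qed (use that L bdd w_outside in \<open>auto intro: continuous_on_w energy_w w_mirror continuous_on_F weak_w\<close>)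
    then have "(\<forall>i x. w z i x = 0) \<or> z \<in> dominating"
      using dominating_dichotomy[OF z'] by blast
    \<comment> \<open>Any index would do; \<open>undefined\<close> names one.\<close>
    moreover have "w z undefined x1 > 0" using z by (intro wK) (auto simp: K_def)
    ultimately show "z \<in> dominating" by (metis less_irrefl)
  qed
  moreover have "open (X \<inter> {z. x1 \<bullet> z > 0})"
    using X by (intro open_Int open_Collect_less continuous_intros)
  moreover have "z0 \<in> X \<inter> {z. x1 \<bullet> z > 0}" using X x1 by simp
  ultimately show "\<exists>T. open T \<and> z0 \<in> T \<and> T \<subseteq> dominating" by blast
qed

subsection \<open>The set of dominating directions is a half-space\<close>

lemma closure_dominating_nonneg:
  assumes z: "z \<in> closure dominating" "z \<noteq> 0" and x: "x \<bullet> z > 0"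
  shows "w z i x \<ge> 0"
proof -
  obtain s where s: "\<And>n. s n \<in> dominating" "s \<longlonglongrightarrow> z"
    using z(1) unfolding closure_sequential by blast
  have "(\<lambda>n. x \<bullet> s n) \<longlonglongrightarrow> x \<bullet> z" by (intro tendsto_intros s)
  then have ev: "eventually (\<lambda>n. x \<bullet> s n > 0) sequentially" using x by (rule order_tendstoD)
  have "(\<lambda>n. mirror (s n) x) \<longlonglongrightarrow> mirror z x"
    unfolding mirror_def using z(2) by (intro tendsto_intros s) simp
  then have "(\<lambda>n. u i (mirror (s n) x)) \<longlonglongrightarrow> u i (mirror z x)"
    using cu[of i] by (intro isCont_tendsto_compose[of "mirror z x" "u i"]) (simp add: continuous_on_eq_continuous_at)
  then have "(\<lambda>n. w (s n) i x) \<longlonglongrightarrow> w z i x"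
    unfolding w_def by (intro tendsto_intros)
  moreover have "eventually (\<lambda>n. w (s n) i x \<ge> 0) sequentially"
    using ev
  proof eventually_elim
    case (elim n)
    then show ?case
      using s(1)[of n] w_outside[of x "s n" i] by (cases "x \<in> \<Omega>") (auto simp: dominating_def intro: less_imp_le)
  qed
  ultimately show ?thesis
    by (rule tendsto_lowerbound) simp
qed

text \<open>With \<open>q\<close> on the negative side its mirror image would have a larger value
  than the maximum. If \<open>q\<close> lies on the hyperplane, openness allows tilting
  \<open>z\<close> away from \<open>q\<close> into the excluded case.\<close>

lemma dominating_inner_maximiser:
  assumes ne: "\<Omega> \<noteq> {}" and q: "q \<in> \<Omega>" "q \<noteq> 0" "\<And>y. norm y = norm q \<Longrightarrow> u i y \<le> u i q" and z: "z \<in> dominating"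
  shows "z \<bullet> q > 0"
proof -
  have not_neg: "\<not> z' \<bullet> q < 0" if z': "z' \<in> dominating" for z'
  proof
    assume "z' \<bullet> q < 0"
    then have "mirror z' q \<bullet> z' > 0" unfolding inner_mirror_normal by (simp add: inner_commute)
    then have "w z' i (mirror z' q) > 0"
      using z' q(1) by (simp add: dominating_def mirror_\<Omega>)
    then show False using q(3)[of "mirror z' q"] by (simp add: w_def)
  qed
  have "z \<bullet> q \<noteq> 0"
  proof
    assume zq: "z \<bullet> q = 0"
    obtain e where e: "e > 0" "\<And>y. norm (y - z) < e \<Longrightarrow> y \<in> dominating"
      using open_dominating[OF ne] z unfolding open_dist dist_norm by blast
    define y where "y = z - (e / (2 * norm q)) *\<^sub>R q"
    have "norm (y - z) < e" using e q by (simp add: y_def)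
    then have "y \<in> dominating" by (rule e)
    moreover have "y \<bullet> q < 0" using zq e q by (simp add: y_def inner_diff_left)
    ultimately show False using not_neg by blast
  qed
  then show ?thesis using not_neg[OF z] by linarith
qed

lemma dominating_eq_halfspace:
  assumes q: "q \<in> \<Omega>" "q \<noteq> 0" "\<And>y. norm y = norm q \<Longrightarrow> u i y \<le> u i q" and ne: "dominating \<noteq> {}"
  shows "dominating = {z. z \<bullet> q > 0}"
proof -
  have \<Omega>: "\<Omega> \<noteq> {}" using q by auto
  let ?H = "{z. z \<bullet> q > 0}"
  have sub: "dominating \<subseteq> ?H"
    using dominating_inner_maximiser[OF \<Omega> q] by blast
  have "?H \<inter> closure dominating \<subseteq> dominating"
  proof
    fix z assume z: "z \<in> ?H \<inter> closure dominating"
    then have z0: "z \<noteq> 0" by auto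
    have "(\<forall>i x. w z i x = 0) \<or> z \<in> dominating"
      using z z0 by (intro dominating_dichotomy closure_dominating_nonneg) auto
    moreover have "\<not> (\<forall>i x. w z i x = 0)"
    proof
      assume "\<forall>i x. w z i x = 0"
      then have uq: "u i (mirror z q) = u i q" by (metis eq_iff_diff_eq_0 w_def)
      define q' where "q' = mirror z q"
      have nq': "norm q' = norm q" by (simp add: q'_def)
      have q': "q' \<in> \<Omega>" "q' \<noteq> 0" "\<And>y. norm y = norm q' \<Longrightarrow> u i y \<le> u i q'"
        using q nq' uq mirror_\<Omega>[of z q] norm_eq_zero[of q'] norm_eq_zero[of q] by (auto simp: q'_def)
      have "dominating \<subseteq> {z. 0 \<le> z \<bullet> q'}"
        using dominating_inner_maximiser[OF \<Omega> q'] by (force intro: less_imp_le)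
      then have "closure dominating \<subseteq> {z. 0 \<le> z \<bullet> q'}"
        by (rule closure_minimal) (intro closed_Collect_le continuous_intros)
      then have "0 \<le> z \<bullet> q'" using z by auto
      moreover have "z \<bullet> q' = - (z \<bullet> q)"
        by (simp add: q'_def inner_commute[of z] inner_mirror_normal)
      ultimately show False using z by simp
    qed
    ultimately show "z \<in> dominating" by blast
  qed
  then have "dominating = ?H \<inter> closure dominating"
    using sub closure_subset[of dominating] by blast
  \<comment> \<open>A nonempty relatively open and closed subset of a convex set is all of
    it.\<close>
  then have "closedin (top_of_set ?H) dominating"
    by (metis closed_closure closedin_closed_Int)
  moreover have "openin (top_of_set ?H) dominating"
    using sub open_dominating[OF \<Omega>] by (rule open_subset)
  moreover have "connected ?H"
    using convex_halfspace_gt[of 0 q] by (intro convex_connected) (simp add: inner_commute)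
  ultimately show ?thesis
    using ne unfolding connected_clopen by blast
qed

text \<open>The direction \<open>x - y\<close> is orthogonal to \<open>q\<close>, so it and its
  negative are both limits of dominating directions. Nonnegativity on both sides together with
  antisymmetry leaves only 0.\<close>

lemma axially_symmetric:
  assumes H: "dominating = {z. z \<bullet> q > 0}" and q: "q \<noteq> 0"
    and xy: "norm x = norm y" "x \<bullet> q = y \<bullet> q"
  shows "u i x = u i y"
proof (cases "x = y")
  case False
  define z where "z = x - y"
  have z: "z \<noteq> 0" "z \<bullet> q = 0" using False xy by (auto simp: z_def inner_diff_left)
  have cl: "z' \<in> closure dominating" if "z' \<bullet> q = 0" for z'
  proof -
    have "(\<lambda>n. z' + inverse (real (Suc n)) *\<^sub>R q) \<longlonglongrightarrow> z' + 0 *\<^sub>R q"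
      by (intro tendsto_intros LIMSEQ_inverse_real_of_nat)
    moreover have "z' + inverse (real (Suc n)) *\<^sub>R q \<in> dominating" for n
      unfolding H using that q by (simp add: inner_add_left)
    ultimately show ?thesis unfolding closure_sequential by (intro exI conjI allI) auto
  qed
  have nonneg: "w z i v \<ge> 0" if "v \<bullet> z > 0" for v
    using closure_dominating_nonneg[OF cl[OF z(2)] z(1) that] .
  have nonpos: "w z i v \<ge> 0" if "v \<bullet> z < 0" for v
    using closure_dominating_nonneg[of "- z" v i] cl[of "- z"] z that by (simp add: w_minus)
  have "w z i v = 0" if "v \<bullet> z > 0" for v
    using nonneg[OF that] nonpos[of "mirror z v"] that by (simp add: inner_mirror_normal w_mirror)
  then have "w z i x = 0"
    using nonneg[of x] nonpos[of x] w_boundary[of x z i] nonneg[of "mirror z x"]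
    by (cases "x \<bullet> z" "0::real" rule: linorder_cases) (auto simp: inner_mirror_normal w_mirror)
  then show ?thesis
    using mirror_difference[OF xy(1)] by (simp add: w_def z_def)
qed simp

lemma strictly_monotone:
  assumes H: "dominating = {z. z \<bullet> q > 0}"
    and xy: "x \<in> \<Omega>" "norm x = norm y" "x \<bullet> q > y \<bullet> q"
  shows "u i x > u i y"
proof -
  define z where "z = x - y"
  have "z \<in> dominating" unfolding H using xy by (simp add: z_def inner_diff_left)
  moreover have "x \<bullet> z > 0"
  proof -
    have "z \<bullet> z > 0" using xy by (auto simp: z_def)
    moreover have "x \<bullet> x = y \<bullet> y" using xy by (simp add: norm_eq_sqrt_inner)
    then have "z \<bullet> z = 2 * (x \<bullet> z)" by (simp add: z_def inner_simps inner_commute)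
    ultimately show ?thesis by simp
  qed
  ultimately have "w z i x > 0" using xy by (simp add: dominating_def)
  then show ?thesis using mirror_difference[OF xy(2)] by (simp add: w_def z_def)
qed

end

section \<open>Superlevel sets as geodesic balls, and the conclusion\<close>

lemma foliated_Schwarz_symmetricI:
  fixes u :: "real^'n \<Rightarrow> real"
  assumes cu: "continuous_on UNIV u" and p: "norm p = 1"
    and eq: "\<And>x y. x \<in> \<Omega> \<Longrightarrow> norm x = norm y \<Longrightarrow> x \<bullet> p = y \<bullet> p \<Longrightarrow> u x = u y"
    and less: "\<And>x y. x \<in> \<Omega> \<Longrightarrow> norm x = norm y \<Longrightarrow> x \<bullet> p > y \<bullet> p \<Longrightarrow> u x > u y"
  shows "foliated_Schwarz_symmetric p \<Omega> u"
  unfolding foliated_Schwarz_symmetric_def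
proof (intro allI impI disjI2)
  fix r c :: real assume r: "0 < r" and sub: "sphere 0 r \<subseteq> \<Omega>"
  let ?S = "{x \<in> sphere 0 r. c \<le> u x}"
  have in1: "\<bar>(x \<bullet> p) / r\<bar> \<le> 1" if "x \<in> sphere 0 r" for x
    using Cauchy_Schwarz_ineq2[of x p] that p r by (simp add: field_simps)
  have dist0: "geodesic_dist r p x \<ge> 0" if "x \<in> sphere 0 r" for x
  proof -
    have "0 \<le> arccos ((x \<bullet> p) / r)" using in1[OF that] by (intro arccos_lbound; linarith)
    then show ?thesis using r by (simp add: geodesic_dist_def)
  qed
  show "geodesic_ball r p ?S"
  proof (cases "?S = {}")
    case True
    \<comment> \<open>The empty superlevel set is the open ball of radius 0.\<close>
    have "?S = {x \<in> sphere 0 r. geodesic_dist r p x < 0}"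
      unfolding True using dist0 by force
    then show ?thesis unfolding geodesic_ball_def by blast
  next
    case False
    have "?S = sphere 0 r \<inter> {x. c \<le> u x}" by auto
    moreover have "closed {x. c \<le> u x}" using cu by (intro closed_Collect_le continuous_intros)
    \<comment> \<open>Compactness provides a point \<open>a\<close> of largest polar angle in the
      superlevel set; by monotonicity the set is the closed ball reaching to \<open>a\<close>. The
      full sphere is included, with \<open>a\<close> the antipode of the centre.\<close>
    ultimately have "compact ?S" by (simp add: compact_Int_closed)
    then have "\<exists>a\<in>?S. \<forall>x\<in>?S. a \<bullet> p \<le> x \<bullet> p"
      using False by (rule continuous_attains_inf) (intro continuous_intros)
    then obtain a where a: "a \<in> ?S" "\<And>x. x \<in> ?S \<Longrightarrow> a \<bullet> p \<le> x \<bullet> p"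
      by blast
    have up: "c \<le> u x" if "x \<in> sphere 0 r" "a \<bullet> p \<le> x \<bullet> p" for x
      using less[of x a] eq[of x a] a(1) that sub by (cases "x \<bullet> p = a \<bullet> p") auto
    have "geodesic_dist r p x \<le> geodesic_dist r p a \<longleftrightarrow> a \<bullet> p \<le> x \<bullet> p" if "x \<in> sphere 0 r" for x
      unfolding geodesic_dist_def using r arccos_le_mono[OF in1[OF that] in1[of a]] a(1)
      by (simp add: divide_le_cancel)
    then have "?S = {x \<in> sphere 0 r. geodesic_dist r p x \<le> geodesic_dist r p a}"
      using a up by blast
    moreover have "geodesic_dist r p a \<ge> 0"
      using dist0[of a] a(1) by simp
    ultimately show ?thesis unfolding geodesic_ball_def by blast
  qed
qed

lemma mirror_axis: "mirror (axis a 1) x = reflect a x"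
proof -
  have "2 * (x \<bullet> axis a 1) / (axis a 1 \<bullet> axis a (1::real)) = 2 * x $ a"
    by (simp add: inner_axis)
  then show ?thesis
    by (simp add: vec_eq_iff mirror_def reflect_def) (simp add: axis_def)
qed

theorem theorem1p1:
  fixes \<Omega> :: "(real^'n) set"
    and k0 :: "real \<Rightarrow> ennreal"
    and k :: "real^'n \<Rightarrow> ennreal"
    and f :: "'m::finite \<Rightarrow> real \<Rightarrow> real^'m \<Rightarrow> real"
    and u :: "'m \<Rightarrow> real^'n \<Rightarrow> real"
    and first_coord :: 'n
    and first_comp :: 'm
  assumes "CARD('n) \<ge> 2"
    and "kernel_profile CARD('n) k0"
    and "\<And>z. k z = k0 (norm z)"
    and "bounded \<Omega>" and "radial_domain \<Omega>"
    and "\<And>i. C1_on ({0..} \<times> UNIV) (\<lambda>(r, v). f i r v)"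
    and "\<And>i j r v. i \<noteq> j \<Longrightarrow> r \<ge> 0 \<Longrightarrow> partial_deriv i (f j r) v > 0"
    and "\<And>i. continuous_on UNIV (u i)"
    and "\<And>i. bounded (range (u i))"
    and "weak_solution k \<Omega> f u"
    and "\<And>i x. x \<notin> \<Omega> \<Longrightarrow> u i x = 0"
    and "\<And>i x. x $ first_coord > 0 \<Longrightarrow> u i x \<ge> u i (reflect first_coord x)"
    and "\<exists>x. x $ first_coord > 0 \<and> u first_comp x > u first_comp (reflect first_coord x)"
  shows "\<exists>p\<in>sphere 0 1. \<forall>i. foliated_Schwarz_symmetric p \<Omega> (u i) \<and>
           strictly_decreasing_polar_angle p \<Omega> (u i)"
proof -
  interpret levy_kernel k
    by (rule levy_kernelI[OF assms(2,3)])
  interpret cooperative_system k \<Omega> f u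
    by unfold_locales (fact assms)+
  obtain x1 where x1: "x1 $ first_coord > 0" "u first_comp x1 > u first_comp (reflect first_coord x1)"
    using assms(13) by blast
  define e :: "real^'n" where "e = axis first_coord 1"
  have e: "e \<noteq> 0" by (simp add: e_def axis_eq_0_iff)
  have xe: "x \<bullet> e = x $ first_coord" for x by (simp add: e_def inner_axis)
  have we: "w e i x = u i x - u i (reflect first_coord x)" for i x
    by (simp add: w_def e_def mirror_axis)
  have "w e first_comp x1 \<noteq> 0" using x1 by (simp add: we)
  \<comment> \<open>The strict inequality at \<open>x1\<close> rules out vanishing differences and
    also puts \<open>x1\<close>, hence its whole sphere, into \<Omega>.\<close>
  then have dom: "e \<in> dominating" and x1\<Omega>: "x1 \<in> \<Omega>"
    using dominating_dichotomy[OF e] assms(12) w_outside[of x1 e first_comp] by (auto simp: xe we)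
  \<comment> \<open>A maximiser of one component on one sphere suffices: it determines the set of
    dominating directions, which is common to all components and spheres.\<close>
  have "\<exists>q\<in>sphere 0 (norm x1). \<forall>y\<in>sphere 0 (norm x1). u first_comp y \<le> u first_comp q"
    by (intro continuous_attains_sup continuous_on_subset[OF cu]) auto
  then obtain q where q: "norm q = norm x1" "\<And>y. norm y = norm x1 \<Longrightarrow> u first_comp y \<le> u first_comp q"
    by auto
  have q0: "q \<noteq> 0" using q(1) x1(1) by auto
  have q\<Omega>: "q \<in> \<Omega>" using radial_domain_sphere[OF N2 rad x1\<Omega> q(1)] .
  define p where "p = q /\<^sub>R norm q"
  have p: "norm p = 1" "p \<noteq> 0" using q0 by (simp_all add: p_def)
  have "dominating = {z. z \<bullet> q > 0}"
    using q q\<Omega> q0 dom by (intro dominating_eq_halfspace[of q first_comp]) auto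
  then have H: "dominating = {z. z \<bullet> p > 0}"
    using q0 by (simp add: p_def zero_less_mult_iff)
  have "foliated_Schwarz_symmetric p \<Omega> (u i)" for i
  proof (rule foliated_Schwarz_symmetricI[OF cu p(1)])
    show "u i x = u i y" if "norm x = norm y" "x \<bullet> p = y \<bullet> p" for x y
      by (rule axially_symmetric[OF H p(2) that])
    show "u i x > u i y" if "x \<in> \<Omega>" "norm x = norm y" "x \<bullet> p > y \<bullet> p" for x y
      by (rule strictly_monotone[OF H that])
  qed
  moreover have "strictly_decreasing_polar_angle p \<Omega> (u i)" for i
    unfolding strictly_decreasing_polar_angle_def
  proof (intro allI impI ballI)
    fix r :: real and x y :: "real^'n"
    assume "sphere 0 r \<subseteq> \<Omega>" "x \<in> sphere 0 r" "y \<in> sphere 0 r" "x \<bullet> p > y \<bullet> p"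
    then show "u i x > u i y" by (intro strictly_monotone[OF H]) auto
  qed
  ultimately show ?thesis using p(1) by (intro bexI[of _ p]) auto
qed

end
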